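(* Let $\{A_0,A_1,\dots,A_n\}$ and $\{B_0,B_1,\dots,B_m\}$ be two noncommutative CW (NCCW) complexes, put $A=A_n$ and $B=B_m$, and let $f:A\to B$ be a $*$-homomorphism. Then $f$ is homotopic to a cellular map of NCCW complexes $h:A\to B$; that is, there exist a cellular $*$-homomorphism $h:A\to B$ and a $*$-homomorphism $\Phi:A\to C([0,1])\otimes B\cong C([0,1],B)$ such that $\Phi(a)(0)=f(a)$ and $\Phi(a)(1)=h(a)$ for all $a\in A$.
   Context: Notation: for a C*-algebra $F$ and $k\ge 1$, $\mathbf I^kF=C([0,1]^k,F)$; $\mathbf I^k_0F=C_0((0,1)^k,F)$, regarded as the functions in $\mathbf I^kF$ vanishing on the boundary of the cube; and $\mathbf S^{k-1}F=C(\mathbf S^{k-1},F)$, where $\mathbf S^{k-1}$ is identified with the boundary $\partial [0,1]^k$. The map $\partial:\mathbf I^kF\to \mathbf S^{k-1}F$ is restriction to the boundary. NCCW complex: a 0-dimensional NCCW complex is a finite-dimensional C*-algebra $A_0=\bigoplus_k \mathbf M_{n(k)}$ (a finite direct sum of full complex matrix algebras). An NCCW complex of dimension $n$ is a sequence $\{A_0,A_1,\dots,A_n\}$ of C*-algebras such that $A_0$ is a finite-dimensional C*-algebra and, for each $1\le k\le n$, $A_k$ is obtained from $A_{k-1}$ as a pullback $$A_k=\mathbf I^kF_k\oplus_{\mathbf S^{k-1}F_k}A_{k-1}=\{(g,a)\in \mathbf I^kF_k\oplus A_{k-1}:\ \partial(g)=\sigma_k(a)\},$$ where $F_k$ is some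 finite-dimensional C*-algebra and $\sigma_k:A_{k-1}\to \mathbf S^{k-1}F_k$ is some $*$-homomorphism (the connecting morphism). The projection on the second coordinate $\pi:A_k\to A_{k-1}$ is surjective with kernel $\mathbf I_0^kF_k$. Cellular map: composing the projections gives quotient maps $\pi^A_p:A=A_n\to A_p$ for $0\le p\le n$, and likewise $\pi^B_p:B=B_m\to B_p$ for $0\le p\le m$. Put $A_p=A$, $\pi^A_p=\mathrm{id}_A$ for $p>n$, and $B_p=B$, $\pi^B_p=\mathrm{id}_B$ for $p>m$. A $*$-homomorphism $h:A\to B$ is cellular if for every $p\ge 0$ it induces a $*$-homomorphism $h_p:A_p\to B_p$ with $\pi^B_p\circ h=h_p\circ\pi^A_p$ (equivalently, $h(\ker\pi^A_p)\subseteq\ker\pi^B_p$). *)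

theory Defs
  imports
    "HOL-Analysis.Analysis"
    "Jordan_Normal_Form.Schur_Decomposition"
begin

section \<open>Normed *-algebras with explicit carriers\<close>

text \<open>
  All C*-algebras below are instances of this record, built from full matrix algebras
  by direct sums, algebras of continuous functions and pullbacks. They need not be unital, since
  connecting morphisms need not be, so no unit is recorded.
\<close>

record 'a cstar = "'a partial_object" +
  cs_add   :: "'a \<Rightarrow> 'a \<Rightarrow> 'a"
  cs_mult  :: "'a \<Rightarrow> 'a \<Rightarrow> 'a"
  cs_scale :: "complex \<Rightarrow> 'a \<Rightarrow> 'a"
  cs_star  :: "'a \<Rightarrow> 'a"
  cs_norm  :: "'a \<Rightarrow> real"

definition cs_dist :: "'a cstar \<Rightarrow> 'a \<Rightarrow> 'a \<Rightarrow> real" where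
  "cs_dist F x y = cs_norm F (cs_add F x (cs_scale F (-1) y))"

definition star_hom :: "'a cstar \<Rightarrow> 'b cstar \<Rightarrow> ('a \<Rightarrow> 'b) \<Rightarrow> bool" where
  "star_hom A B f \<longleftrightarrow>
     f \<in> carrier A \<rightarrow> carrier B \<and>
     (\<forall>x\<in>carrier A. \<forall>y\<in>carrier A. f (cs_add A x y) = cs_add B (f x) (f y)) \<and>
     (\<forall>x\<in>carrier A. \<forall>y\<in>carrier A. f (cs_mult A x y) = cs_mult B (f x) (f y)) \<and>
     (\<forall>c. \<forall>x\<in>carrier A. f (cs_scale A c x) = cs_scale B c (f x)) \<and>
     (\<forall>x\<in>carrier A. f (cs_star A x) = cs_star B (f x))"

section \<open>Finite-dimensional C*-algebras\<close>

definition cvec_norm :: "complex vec \<Rightarrow> real" where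
  "cvec_norm v = sqrt (Re (v \<bullet>c v))"

definition mat_opnorm :: "complex mat \<Rightarrow> real" where
  "mat_opnorm M = Sup {cvec_norm (M *\<^sub>v v) | v. v \<in> carrier_vec (dim_col M) \<and> cvec_norm v \<le> 1}"

definition matrix_algebra :: "nat \<Rightarrow> complex mat cstar" where
  "matrix_algebra r =
     \<lparr> carrier = carrier_mat r r, cs_add = (+), cs_mult = (*), cs_scale = (\<cdot>\<^sub>m),
       cs_star = mat_adjoint, cs_norm = mat_opnorm \<rparr>"

text \<open>
  \<open>findim ns\<close> is the direct sum of the full matrix algebras of sizes \<open>ns ! 0, ns ! 1, \<dots>\<close>; an
  element is the family of its blocks. The empty list gives the zero algebra, whence the
  \<open>insert 0\<close> in the norm.
\<close>

type_synonym fd = "nat \<Rightarrow> complex mat"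

definition findim :: "nat list \<Rightarrow> fd cstar" where
  "findim ns =
     (let J = {..<length ns}; M = (\<lambda>i. matrix_algebra (ns ! i)) in
     \<lparr> carrier = (\<Pi>\<^sub>E i\<in>J. carrier (M i)),
       cs_add = (\<lambda>x y. \<lambda>i\<in>J. cs_add (M i) (x i) (y i)),
       cs_mult = (\<lambda>x y. \<lambda>i\<in>J. cs_mult (M i) (x i) (y i)),
       cs_scale = (\<lambda>c x. \<lambda>i\<in>J. cs_scale (M i) c (x i)),
       cs_star = (\<lambda>x. \<lambda>i\<in>J. cs_star (M i) (x i)),
       cs_norm = (\<lambda>x. Max (insert 0 ((\<lambda>i. cs_norm (M i) (x i)) ` J))) \<rparr>)"

definition findim_cstar :: "fd cstar \<Rightarrow> bool" where
  "findim_cstar F \<longleftrightarrow> (\<exists>ns. (\<forall>r\<in>set ns. 1 \<le> r) \<and> F = findim ns)"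

section \<open>Algebras of continuous functions\<close>

text \<open>
  \<open>C_alg X F\<close> is \<open>C(X, F)\<close>, meant for nonempty compact \<open>X\<close>; continuity is with respect to the
  norm of \<open>F\<close>. Functions are \<open>undefined\<close> off \<open>X\<close>, so that equality is equality on \<open>X\<close>.
\<close>

definition C_alg :: "'x::topological_space set \<Rightarrow> 'a cstar \<Rightarrow> ('x \<Rightarrow> 'a) cstar" where
  "C_alg X F =
     \<lparr> carrier = {g \<in> X \<rightarrow>\<^sub>E carrier F.
                    \<forall>x\<in>X. ((\<lambda>y. cs_dist F (g y) (g x)) \<longlongrightarrow> 0) (at x within X)},
       cs_add = (\<lambda>g h. \<lambda>x\<in>X. cs_add F (g x) (h x)),
       cs_mult = (\<lambda>g h. \<lambda>x\<in>X. cs_mult F (g x) (h x)),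
       cs_scale = (\<lambda>c g. \<lambda>x\<in>X. cs_scale F c (g x)),
       cs_star = (\<lambda>g. \<lambda>x\<in>X. cs_star F (g x)),
       cs_norm = (\<lambda>g. SUP x\<in>X. cs_norm F (g x)) \<rparr>"

text \<open>
  The cube \<open>[0,1]\<^sup>k\<close> sits in the type \<open>nat \<Rightarrow> real\<close> (with its product topology) as the set of
  sequences supported on the first \<open>k\<close> coordinates, so that the dimension can vary.
\<close>

definition cube :: "nat \<Rightarrow> (nat \<Rightarrow> real) set" where
  "cube k = {x. (\<forall>i<k. 0 \<le> x i \<and> x i \<le> 1) \<and> (\<forall>i\<ge>k. x i = 0)}"

definition cube_boundary :: "nat \<Rightarrow> (nat \<Rightarrow> real) set" where
  "cube_boundary k = {x \<in> cube k. \<exists>i<k. x i = 0 \<or> x i = 1}"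

definition I_alg :: "nat \<Rightarrow> 'a cstar \<Rightarrow> ((nat \<Rightarrow> real) \<Rightarrow> 'a) cstar" where
  "I_alg k F = C_alg (cube k) F"

text \<open>\<open>S_alg k F\<close> is \<open>\<^bold>S\<^sup>k\<^sup>-\<^sup>1F\<close>, the functions on the boundary of the \<open>k\<close>-cube.\<close>

definition S_alg :: "nat \<Rightarrow> 'a cstar \<Rightarrow> ((nat \<Rightarrow> real) \<Rightarrow> 'a) cstar" where
  "S_alg k F = C_alg (cube_boundary k) F"

definition bdry :: "nat \<Rightarrow> ((nat \<Rightarrow> real) \<Rightarrow> 'a) \<Rightarrow> ((nat \<Rightarrow> real) \<Rightarrow> 'a)" where
  "bdry k g = restrict g (cube_boundary k)"

section \<open>Noncommutative CW complexes\<close>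

text \<open>
  A common type for the elements of the algebras \<open>A\<^sub>0, A\<^sub>1, \<dots>\<close>: \<open>Vertex a\<close> is an element of
  \<open>A\<^sub>0\<close>, and \<open>Cell g a\<close> is the pair \<open>(g, a)\<close> in the pullback, whose second coordinate is again
  of this type. Thus \<open>skel\<close> is the projection of \<open>A\<^sub>k\<close> onto the second coordinate.
\<close>

datatype nccw_elt =
    Vertex (vertex: fd)
  | Cell (cell: "(nat \<Rightarrow> real) \<Rightarrow> fd") (skel: nccw_elt)

definition vertex_alg :: "fd cstar \<Rightarrow> nccw_elt cstar" where
  "vertex_alg F =
     \<lparr> carrier = Vertex ` carrier F,
       cs_add = (\<lambda>x y. Vertex (cs_add F (vertex x) (vertex y))),
       cs_mult = (\<lambda>x y. Vertex (cs_mult F (vertex x) (vertex y))),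
       cs_scale = (\<lambda>c x. Vertex (cs_scale F c (vertex x))),
       cs_star = (\<lambda>x. Vertex (cs_star F (vertex x))),
       cs_norm = (\<lambda>x. cs_norm F (vertex x)) \<rparr>"

definition pullback_alg ::
  "nat \<Rightarrow> fd cstar \<Rightarrow> (nccw_elt \<Rightarrow> (nat \<Rightarrow> real) \<Rightarrow> fd) \<Rightarrow> nccw_elt cstar \<Rightarrow> nccw_elt cstar" where
  "pullback_alg k F \<sigma> A =
     (let G = I_alg k F in
     \<lparr> carrier = {Cell g a | g a. g \<in> carrier G \<and> a \<in> carrier A \<and> bdry k g = \<sigma> a},
       cs_add = (\<lambda>x y. Cell (cs_add G (cell x) (cell y)) (cs_add A (skel x) (skel y))),
       cs_mult = (\<lambda>x y. Cell (cs_mult G (cell x) (cell y)) (cs_mult A (skel x) (skel y))),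
       cs_scale = (\<lambda>c x. Cell (cs_scale G c (cell x)) (cs_scale A c (skel x))),
       cs_star = (\<lambda>x. Cell (cs_star G (cell x)) (cs_star A (skel x))),
       cs_norm = (\<lambda>x. max (cs_norm G (cell x)) (cs_norm A (skel x))) \<rparr>)"

text \<open>Only the entries \<open>A 0, \<dots>, A n\<close> of the sequence are meaningful.\<close>

definition nccw_complex :: "nat \<Rightarrow> (nat \<Rightarrow> nccw_elt cstar) \<Rightarrow> bool" where
  "nccw_complex n A \<longleftrightarrow>
     (\<exists>F. findim_cstar F \<and> A 0 = vertex_alg F) \<and>
     (\<forall>k\<in>{1..n}. \<exists>F \<sigma>. findim_cstar F \<and> star_hom (A (k - 1)) (S_alg k F) \<sigma> \<and>
        A k = pullback_alg k F \<sigma> (A (k - 1)))"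

section \<open>Cellular maps\<close>

definition skeleton_alg :: "nat \<Rightarrow> (nat \<Rightarrow> nccw_elt cstar) \<Rightarrow> nat \<Rightarrow> nccw_elt cstar" where
  "skeleton_alg n A p = (if p \<le> n then A p else A n)"

text \<open>
  \<open>skeleton_proj n p\<close> is the quotient map from \<open>A\<^sub>n\<close> to \<open>A\<^sub>p\<close>. By truncated subtraction it is the
  identity for \<open>p \<ge> n\<close>.
\<close>

definition skeleton_proj :: "nat \<Rightarrow> nat \<Rightarrow> nccw_elt \<Rightarrow> nccw_elt" where
  "skeleton_proj n p = skel ^^ (n - p)"

definition cellular ::
  "nat \<Rightarrow> (nat \<Rightarrow> nccw_elt cstar) \<Rightarrow> nat \<Rightarrow> (nat \<Rightarrow> nccw_elt cstar) \<Rightarrow> (nccw_elt \<Rightarrow> nccw_elt) \<Rightarrow> bool"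
where
  "cellular n A m B h \<longleftrightarrow>
     star_hom (A n) (B m) h \<and>
     (\<forall>p. \<exists>h\<^sub>p. star_hom (skeleton_alg n A p) (skeleton_alg m B p) h\<^sub>p \<and>
        (\<forall>a\<in>carrier (A n). skeleton_proj m p (h a) = h\<^sub>p (skeleton_proj n p a)))"

end

theory Submission
  imports Defs
begin

text \<open>
  As for CW complexes, induct on the dimension of \<open>B\<close>: a homotopy into \<open>B\<^sub>m\<^sub>-\<^sub>1\<close> extends to \<open>B\<^sub>m\<close>
  because \<open>[0,1] \<times> [0,1]\<^sup>m\<close> retracts onto \<open>{0} \<times> [0,1]\<^sup>m \<union> [0,1] \<times> \<partial>[0,1]\<^sup>m\<close>, and it remains to
  deform \<open>g : A\<^sub>N \<rightarrow> C([0,1]\<^sup>k, F)\<close> with \<open>k < N\<close>, relative to the points where it already kills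
  \<open>I\<^sub>0\<^sup>NF\<^sub>N\<close>, to a map that kills this ideal.

  At a point \<open>x\<close> the representation \<open>g\<^sub>x\<close> of the ideal has finite support, and over a neighbourhood of \<open>x\<close>
  the support stays in disjoint small balls around these points. Gluing the locally constant maps
  that collapse the balls to their centres by a Lipschitz partition of unity on \<open>[0,1]\<^sup>k\<close> gives a
  family of self-maps of the \<open>N\<close>-cube that moves the supports into finitely many Lipschitz images
  of \<open>[0,1]\<^sup>k\<close>. These miss a small ball, since \<open>k < N\<close>, and pushing radially from its centre moves all
  supports into the boundary of the \<open>N\<close>-cube. The required homotopy is composition with the
  straight line homotopy from the identity to the resulting self-maps, which fix the boundary.
\<close>

unbundle no vec_syntax

section \<open>Normed *-algebras\<close>

definition cs_zero :: "'a cstar \<Rightarrow> 'a" where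
  "cs_zero A = cs_scale A 0 (SOME x. x \<in> carrier A)"

text \<open>
  The last axiom replaces completeness: in a Banach algebra the Neumann series provides the
  quasi-inverse \<open>q\<close>, which satisfies \<open>(1 - x) (1 - q) = (1 - q) (1 - x) = 1\<close>.
  It passes to pullbacks and to algebras of functions by a pointwise construction.
\<close>

locale normed_star_algebra =
  fixes A :: "'a cstar"
  assumes carrier_nonempty: "carrier A \<noteq> {}"
    and add_closed [simp]: "x \<in> carrier A \<Longrightarrow> y \<in> carrier A \<Longrightarrow> cs_add A x y \<in> carrier A"
    and mult_closed [simp]: "x \<in> carrier A \<Longrightarrow> y \<in> carrier A \<Longrightarrow> cs_mult A x y \<in> carrier A"
    and scale_closed [simp]: "x \<in> carrier A \<Longrightarrow> cs_scale A c x \<in> carrier A"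
    and star_closed [simp]: "x \<in> carrier A \<Longrightarrow> cs_star A x \<in> carrier A"
    and add_assoc: "x \<in> carrier A \<Longrightarrow> y \<in> carrier A \<Longrightarrow> z \<in> carrier A \<Longrightarrow>
      cs_add A (cs_add A x y) z = cs_add A x (cs_add A y z)"
    and add_comm: "x \<in> carrier A \<Longrightarrow> y \<in> carrier A \<Longrightarrow> cs_add A x y = cs_add A y x"
    and add_scale_zero: "x \<in> carrier A \<Longrightarrow> y \<in> carrier A \<Longrightarrow> cs_add A x (cs_scale A 0 y) = x"
    and scale_one [simp]: "x \<in> carrier A \<Longrightarrow> cs_scale A 1 x = x"
    and scale_scale: "x \<in> carrier A \<Longrightarrow> cs_scale A c (cs_scale A d x) = cs_scale A (c * d) x"
    and scale_add_left: "x \<in> carrier A \<Longrightarrow>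
      cs_scale A (c + d) x = cs_add A (cs_scale A c x) (cs_scale A d x)"
    and scale_add_right: "x \<in> carrier A \<Longrightarrow> y \<in> carrier A \<Longrightarrow>
      cs_scale A c (cs_add A x y) = cs_add A (cs_scale A c x) (cs_scale A c y)"
    and mult_assoc: "x \<in> carrier A \<Longrightarrow> y \<in> carrier A \<Longrightarrow> z \<in> carrier A \<Longrightarrow>
      cs_mult A (cs_mult A x y) z = cs_mult A x (cs_mult A y z)"
    and distrib_left: "x \<in> carrier A \<Longrightarrow> y \<in> carrier A \<Longrightarrow> z \<in> carrier A \<Longrightarrow>
      cs_mult A x (cs_add A y z) = cs_add A (cs_mult A x y) (cs_mult A x z)"
    and distrib_right: "x \<in> carrier A \<Longrightarrow> y \<in> carrier A \<Longrightarrow> z \<in> carrier A \<Longrightarrow>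
      cs_mult A (cs_add A x y) z = cs_add A (cs_mult A x z) (cs_mult A y z)"
    and mult_scale_left: "x \<in> carrier A \<Longrightarrow> y \<in> carrier A \<Longrightarrow>
      cs_mult A (cs_scale A c x) y = cs_scale A c (cs_mult A x y)"
    and mult_scale_right: "x \<in> carrier A \<Longrightarrow> y \<in> carrier A \<Longrightarrow>
      cs_mult A x (cs_scale A c y) = cs_scale A c (cs_mult A x y)"
    and star_add: "x \<in> carrier A \<Longrightarrow> y \<in> carrier A \<Longrightarrow>
      cs_star A (cs_add A x y) = cs_add A (cs_star A x) (cs_star A y)"
    and star_scale: "x \<in> carrier A \<Longrightarrow> cs_star A (cs_scale A c x) = cs_scale A (cnj c) (cs_star A x)"
    and norm_ge_0 [simp]: "x \<in> carrier A \<Longrightarrow> 0 \<le> cs_norm A x"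
    and norm_eq_0D: "x \<in> carrier A \<Longrightarrow> cs_norm A x = 0 \<Longrightarrow> x = cs_scale A 0 x"
    and norm_triangle: "x \<in> carrier A \<Longrightarrow> y \<in> carrier A \<Longrightarrow>
      cs_norm A (cs_add A x y) \<le> cs_norm A x + cs_norm A y"
    and norm_scale: "x \<in> carrier A \<Longrightarrow> cs_norm A (cs_scale A c x) = cmod c * cs_norm A x"
    and norm_mult_le: "x \<in> carrier A \<Longrightarrow> y \<in> carrier A \<Longrightarrow>
      cs_norm A (cs_mult A x y) \<le> cs_norm A x * cs_norm A y"
    and norm_star: "x \<in> carrier A \<Longrightarrow> cs_norm A (cs_star A x) \<le> cs_norm A x"
    and quasi_inverse_exists: "x \<in> carrier A \<Longrightarrow> cs_norm A x < 1 \<Longrightarrow>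
      \<exists>q\<in>carrier A. cs_add A x q = cs_mult A x q \<and> cs_add A x q = cs_mult A q x"
begin

abbreviation add (infixl "+\<^sub>A" 65) where "x +\<^sub>A y \<equiv> cs_add A x y"
abbreviation mult (infixl "*\<^sub>A" 70) where "x *\<^sub>A y \<equiv> cs_mult A x y"
abbreviation scale (infixr "\<cdot>\<^sub>A" 75) where "c \<cdot>\<^sub>A x \<equiv> cs_scale A c x"
abbreviation zero ("0\<^sub>A") where "0\<^sub>A \<equiv> cs_zero A"

lemma some_in_carrier: "(SOME x. x \<in> carrier A) \<in> carrier A"
  using carrier_nonempty by (simp add: some_in_eq)

lemma zero_closed [simp]: "0\<^sub>A \<in> carrier A"
  by (simp add: cs_zero_def some_in_carrier)

lemma scale_zero_left [simp]: "x \<in> carrier A \<Longrightarrow> 0 \<cdot>\<^sub>A x = 0\<^sub>A"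
  unfolding cs_zero_def by (metis add_comm add_scale_zero scale_closed some_in_carrier)

lemma add_zero_right [simp]: "x \<in> carrier A \<Longrightarrow> x +\<^sub>A 0\<^sub>A = x"
  by (metis add_scale_zero scale_zero_left)

lemma add_zero_left [simp]: "x \<in> carrier A \<Longrightarrow> 0\<^sub>A +\<^sub>A x = x"
  by (metis add_comm add_zero_right zero_closed)

lemma scale_zero_right [simp]: "c \<cdot>\<^sub>A 0\<^sub>A = 0\<^sub>A"
  by (metis mult_zero_right scale_scale scale_zero_left zero_closed)

lemma add_minus [simp]: "x \<in> carrier A \<Longrightarrow> x +\<^sub>A (-1) \<cdot>\<^sub>A x = 0\<^sub>A"
  using scale_add_left[of x 1 "-1"] by simp

lemma minus_add [simp]: "x \<in> carrier A \<Longrightarrow> (-1) \<cdot>\<^sub>A x +\<^sub>A x = 0\<^sub>A"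
  by (metis add_comm add_minus scale_closed)

lemma add_left_cancel:
  assumes "x \<in> carrier A" "y \<in> carrier A" "z \<in> carrier A" "x +\<^sub>A y = x +\<^sub>A z"
  shows "y = z"
proof -
  have "(-1) \<cdot>\<^sub>A x +\<^sub>A x +\<^sub>A y = (-1) \<cdot>\<^sub>A x +\<^sub>A x +\<^sub>A z"
    using assms by (simp only: add_assoc scale_closed)
  then show ?thesis using assms by simp
qed

lemma add_right_cancel:
  assumes "x \<in> carrier A" "y \<in> carrier A" "z \<in> carrier A" "y +\<^sub>A x = z +\<^sub>A x"
  shows "y = z"
  by (metis assms add_comm add_left_cancel)

lemma add_left_comm:
  assumes "x \<in> carrier A" "y \<in> carrier A" "z \<in> carrier A"
  shows "x +\<^sub>A (y +\<^sub>A z) = y +\<^sub>A (x +\<^sub>A z)"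
  by (metis assms add_assoc add_comm)

lemma add_cancel_minus: "x \<in> carrier A \<Longrightarrow> y \<in> carrier A \<Longrightarrow> (x +\<^sub>A y) +\<^sub>A (-1) \<cdot>\<^sub>A x = y"
  by (simp add: add_comm[of x] add_assoc)

lemma add_minus_cancel: "x \<in> carrier A \<Longrightarrow> y \<in> carrier A \<Longrightarrow> y +\<^sub>A (x +\<^sub>A (-1) \<cdot>\<^sub>A y) = x"
  by (metis add_left_comm add_minus add_zero_right scale_closed)

lemma minus_eq_zeroD: "x \<in> carrier A \<Longrightarrow> y \<in> carrier A \<Longrightarrow> x +\<^sub>A (-1) \<cdot>\<^sub>A y = 0\<^sub>A \<Longrightarrow> x = y"
  by (metis add_minus_cancel add_zero_right)

lemma mult_zero_left [simp]: "x \<in> carrier A \<Longrightarrow> 0\<^sub>A *\<^sub>A x = 0\<^sub>A"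
  by (metis mult_closed mult_scale_left scale_zero_left zero_closed)

lemma mult_zero_right [simp]: "x \<in> carrier A \<Longrightarrow> x *\<^sub>A 0\<^sub>A = 0\<^sub>A"
  by (metis mult_closed mult_scale_right scale_zero_left zero_closed)

lemma star_zero [simp]: "cs_star A 0\<^sub>A = 0\<^sub>A"
  by (metis complex_cnj_zero scale_zero_left star_closed star_scale zero_closed)

lemma norm_zero [simp]: "cs_norm A 0\<^sub>A = 0"
  using norm_scale[of "0\<^sub>A" 0] by simp

lemma norm_eq_0_iff: "x \<in> carrier A \<Longrightarrow> cs_norm A x = 0 \<longleftrightarrow> x = 0\<^sub>A"
  using norm_eq_0D by auto

lemma quasi_inverse_unique:
  assumes "x \<in> carrier A" "q \<in> carrier A" "q' \<in> carrier A"
    and "x +\<^sub>A q = x *\<^sub>A q" "x +\<^sub>A q' = q' *\<^sub>A x"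
  shows "q = q'"
proof -
  have "q' *\<^sub>A (x *\<^sub>A q) = q' *\<^sub>A x +\<^sub>A q' *\<^sub>A q"
    using assms by (metis distrib_left)
  moreover have "(q' *\<^sub>A x) *\<^sub>A q = x *\<^sub>A q +\<^sub>A q' *\<^sub>A q"
    using assms by (metis distrib_right)
  ultimately have "q' *\<^sub>A x +\<^sub>A q' *\<^sub>A q = x *\<^sub>A q +\<^sub>A q' *\<^sub>A q"
    using assms by (simp add: mult_assoc)
  then have "q' *\<^sub>A x = x *\<^sub>A q"
    using add_right_cancel[of "q' *\<^sub>A q" "q' *\<^sub>A x" "x *\<^sub>A q"] assms by simp
  then show ?thesis using assms by (metis add_left_cancel)
qed

lemma eq_zero_if_mult_fixed:
  assumes "x \<in> carrier A" "u \<in> carrier A" "cs_norm A x < 1" "u = x *\<^sub>A u"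
  shows "u = 0\<^sub>A"
proof -
  have "cs_norm A u \<le> cs_norm A x * cs_norm A u"
    using assms norm_mult_le by metis
  then have "(1 - cs_norm A x) * cs_norm A u \<le> 0" by (simp add: algebra_simps)
  moreover have "0 \<le> cs_norm A u" using assms by simp
  ultimately have "cs_norm A u = 0"
    using assms(3) by (smt (verit) mult_pos_pos)
  then show ?thesis using assms norm_eq_0_iff by blast
qed

lemma dist_eq: "cs_dist A x y = cs_norm A (x +\<^sub>A (-1) \<cdot>\<^sub>A y)"
  by (simp add: cs_dist_def)

lemma dist_ge_0 [simp]: "x \<in> carrier A \<Longrightarrow> y \<in> carrier A \<Longrightarrow> 0 \<le> cs_dist A x y"
  by (simp add: dist_eq)

lemma dist_self [simp]: "x \<in> carrier A \<Longrightarrow> cs_dist A x x = 0"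
  by (simp add: dist_eq)

lemma dist_zero [simp]: "x \<in> carrier A \<Longrightarrow> cs_dist A x 0\<^sub>A = cs_norm A x"
  by (simp add: dist_eq)

lemma minus_swap: "x \<in> carrier A \<Longrightarrow> y \<in> carrier A \<Longrightarrow> (-1) \<cdot>\<^sub>A (x +\<^sub>A (-1) \<cdot>\<^sub>A y) = y +\<^sub>A (-1) \<cdot>\<^sub>A x"
  by (simp add: scale_add_right scale_scale add_comm)

lemma dist_commute: "x \<in> carrier A \<Longrightarrow> y \<in> carrier A \<Longrightarrow> cs_dist A x y = cs_dist A y x"
  unfolding dist_eq using norm_scale[of "x +\<^sub>A (-1) \<cdot>\<^sub>A y" "-1"] minus_swap[of x y] by simp

lemma minus_add_minus:
  assumes "x \<in> carrier A" "y \<in> carrier A" "z \<in> carrier A"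
  shows "(x +\<^sub>A (-1) \<cdot>\<^sub>A y) +\<^sub>A (y +\<^sub>A (-1) \<cdot>\<^sub>A z) = x +\<^sub>A (-1) \<cdot>\<^sub>A z"
proof -
  have "(x +\<^sub>A (-1) \<cdot>\<^sub>A y) +\<^sub>A (y +\<^sub>A (-1) \<cdot>\<^sub>A z) = x +\<^sub>A ((-1) \<cdot>\<^sub>A y +\<^sub>A y) +\<^sub>A (-1) \<cdot>\<^sub>A z"
    using assms by (simp only: add_assoc add_closed scale_closed)
  then show ?thesis using assms by simp
qed

lemma dist_triangle:
  assumes "x \<in> carrier A" "y \<in> carrier A" "z \<in> carrier A"
  shows "cs_dist A x z \<le> cs_dist A x y + cs_dist A y z"
  unfolding dist_eq using norm_triangle[of "x +\<^sub>A (-1) \<cdot>\<^sub>A y" "y +\<^sub>A (-1) \<cdot>\<^sub>A z"] assms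
  by (simp add: minus_add_minus)

lemma dist_add:
  assumes "x \<in> carrier A" "y \<in> carrier A" "x' \<in> carrier A" "y' \<in> carrier A"
  shows "cs_dist A (x +\<^sub>A y) (x' +\<^sub>A y') \<le> cs_dist A x x' + cs_dist A y y'"
proof -
  have "(x +\<^sub>A y) +\<^sub>A (-1) \<cdot>\<^sub>A (x' +\<^sub>A y') = (x +\<^sub>A (-1) \<cdot>\<^sub>A x') +\<^sub>A (y +\<^sub>A (-1) \<cdot>\<^sub>A y')"
    using assms by (simp add: scale_add_right add_assoc add_left_comm)
  then show ?thesis unfolding dist_eq using norm_triangle assms by simp
qed

lemma dist_scale_right:
  assumes "x \<in> carrier A" "y \<in> carrier A"
  shows "cs_dist A (c \<cdot>\<^sub>A x) (c \<cdot>\<^sub>A y) = cmod c * cs_dist A x y"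
proof -
  have "c \<cdot>\<^sub>A x +\<^sub>A (-1) \<cdot>\<^sub>A c \<cdot>\<^sub>A y = c \<cdot>\<^sub>A (x +\<^sub>A (-1) \<cdot>\<^sub>A y)"
    using assms by (simp add: scale_add_right scale_scale)
  then show ?thesis unfolding dist_eq using norm_scale assms by simp
qed

lemma dist_scale_left:
  assumes "x \<in> carrier A"
  shows "cs_dist A (c \<cdot>\<^sub>A x) (d \<cdot>\<^sub>A x) = cmod (c - d) * cs_norm A x"
proof -
  have "c \<cdot>\<^sub>A x +\<^sub>A (-1) \<cdot>\<^sub>A d \<cdot>\<^sub>A x = (c - d) \<cdot>\<^sub>A x"
    using assms scale_add_left[of x c "-d"] by (simp add: scale_scale)
  then show ?thesis unfolding dist_eq using norm_scale assms by simp
qed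

lemma dist_scale:
  assumes "x \<in> carrier A" "y \<in> carrier A"
  shows "cs_dist A (c \<cdot>\<^sub>A x) (d \<cdot>\<^sub>A y) \<le> cmod c * cs_dist A x y + cmod (c - d) * cs_norm A y"
  using dist_triangle[of "c \<cdot>\<^sub>A x" "c \<cdot>\<^sub>A y" "d \<cdot>\<^sub>A y"] dist_scale_right dist_scale_left assms by simp

lemma dist_mult_left:
  assumes "x \<in> carrier A" "y \<in> carrier A" "y' \<in> carrier A"
  shows "cs_dist A (x *\<^sub>A y) (x *\<^sub>A y') \<le> cs_norm A x * cs_dist A y y'"
proof -
  have "x *\<^sub>A y +\<^sub>A (-1) \<cdot>\<^sub>A (x *\<^sub>A y') = x *\<^sub>A (y +\<^sub>A (-1) \<cdot>\<^sub>A y')"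
    using assms by (simp add: distrib_left mult_scale_right)
  then show ?thesis unfolding dist_eq using norm_mult_le assms by simp
qed

lemma dist_mult_right:
  assumes "x \<in> carrier A" "x' \<in> carrier A" "y \<in> carrier A"
  shows "cs_dist A (x *\<^sub>A y) (x' *\<^sub>A y) \<le> cs_dist A x x' * cs_norm A y"
proof -
  have "x *\<^sub>A y +\<^sub>A (-1) \<cdot>\<^sub>A (x' *\<^sub>A y) = (x +\<^sub>A (-1) \<cdot>\<^sub>A x') *\<^sub>A y"
    using assms by (simp add: distrib_right mult_scale_left)
  then show ?thesis unfolding dist_eq using norm_mult_le assms by simp
qed

lemma dist_star:
  assumes "x \<in> carrier A" "y \<in> carrier A"
  shows "cs_dist A (cs_star A x) (cs_star A y) \<le> cs_dist A x y"
proof -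
  have "cs_star A x +\<^sub>A (-1) \<cdot>\<^sub>A cs_star A y = cs_star A (x +\<^sub>A (-1) \<cdot>\<^sub>A y)"
    using assms by (simp add: star_add star_scale)
  then show ?thesis unfolding dist_eq using norm_star assms by simp
qed

text \<open>Resolvent identity: \<open>q - q' = x (q - q') + (x - x') q' - (x - x')\<close>.\<close>

lemma dist_quasi_inverse:
  assumes "x \<in> carrier A" "q \<in> carrier A" "cs_norm A x < 1" "x +\<^sub>A q = x *\<^sub>A q"
    and "x' \<in> carrier A" "q' \<in> carrier A" "x' +\<^sub>A q' = x' *\<^sub>A q'"
  shows "cs_dist A q q' \<le> cs_dist A x x' * (1 + cs_norm A q') / (1 - cs_norm A x)"
proof -
  have q: "q = x *\<^sub>A q +\<^sub>A (-1) \<cdot>\<^sub>A x" and q': "q' = x' *\<^sub>A q' +\<^sub>A (-1) \<cdot>\<^sub>A x'"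
    using add_cancel_minus[of x q] add_cancel_minus[of x' q'] assms by simp_all
  have "cs_dist A q q' = cs_dist A (x *\<^sub>A q +\<^sub>A (-1) \<cdot>\<^sub>A x) (x' *\<^sub>A q' +\<^sub>A (-1) \<cdot>\<^sub>A x')"
    using q q' by simp
  also have "\<dots> \<le> cs_dist A (x *\<^sub>A q) (x' *\<^sub>A q') + cs_dist A x x'"
    using dist_add[of "x *\<^sub>A q" "(-1) \<cdot>\<^sub>A x" "x' *\<^sub>A q'" "(-1) \<cdot>\<^sub>A x'"] dist_scale_right[of x x' "-1"] assms
    by simp
  also have "cs_dist A (x *\<^sub>A q) (x' *\<^sub>A q') \<le> cs_dist A (x *\<^sub>A q) (x *\<^sub>A q') + cs_dist A (x *\<^sub>A q') (x' *\<^sub>A q')"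
    using dist_triangle assms by simp
  also have "\<dots> \<le> cs_norm A x * cs_dist A q q' + cs_dist A x x' * cs_norm A q'"
    using dist_mult_left[of x q q'] dist_mult_right[of x x' q'] assms by simp
  finally show ?thesis using assms(3) by (simp add: field_simps)
qed

end

section \<open>Star homomorphisms\<close>

lemma star_homI:
  assumes "\<And>x. x \<in> carrier A \<Longrightarrow> f x \<in> carrier B"
    and "\<And>x y. x \<in> carrier A \<Longrightarrow> y \<in> carrier A \<Longrightarrow> f (cs_add A x y) = cs_add B (f x) (f y)"
    and "\<And>x y. x \<in> carrier A \<Longrightarrow> y \<in> carrier A \<Longrightarrow> f (cs_mult A x y) = cs_mult B (f x) (f y)"
    and "\<And>c x. x \<in> carrier A \<Longrightarrow> f (cs_scale A c x) = cs_scale B c (f x)"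
    and "\<And>x. x \<in> carrier A \<Longrightarrow> f (cs_star A x) = cs_star B (f x)"
  shows "star_hom A B f"
  using assms unfolding star_hom_def by auto

lemma
  assumes "star_hom A B f" "x \<in> carrier A"
  shows star_hom_closed: "f x \<in> carrier B"
    and star_hom_scale: "f (cs_scale A c x) = cs_scale B c (f x)"
    and star_hom_star: "f (cs_star A x) = cs_star B (f x)"
  using assms unfolding star_hom_def by auto

lemma
  assumes "star_hom A B f" "x \<in> carrier A" "y \<in> carrier A"
  shows star_hom_add: "f (cs_add A x y) = cs_add B (f x) (f y)"
    and star_hom_mult: "f (cs_mult A x y) = cs_mult B (f x) (f y)"
  using assms unfolding star_hom_def by auto

lemma star_hom_id: "star_hom A A (\<lambda>x. x)"
  by (simp add: star_hom_def)

lemma star_hom_compose: "star_hom A B f \<Longrightarrow> star_hom B C g \<Longrightarrow> star_hom A C (\<lambda>x. g (f x))"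
  unfolding star_hom_def by (simp add: Pi_iff)

lemma star_hom_cong: "star_hom A B f \<Longrightarrow> (\<And>x. x \<in> carrier A \<Longrightarrow> f x = g x) \<Longrightarrow>
   normed_star_algebra A \<Longrightarrow> star_hom A B g"
  unfolding star_hom_def Pi_iff
  by (auto simp: normed_star_algebra.add_closed normed_star_algebra.mult_closed
      normed_star_algebra.scale_closed normed_star_algebra.star_closed)

lemma star_hom_zero:
  assumes "normed_star_algebra A" "normed_star_algebra B" "star_hom A B f"
  shows "f (cs_zero A) = cs_zero B"
  by (metis assms normed_star_algebra.scale_zero_left normed_star_algebra.zero_closed
      star_hom_closed star_hom_scale)

lemma star_hom_dist:
  assumes "normed_star_algebra A" "star_hom A B f" "x \<in> carrier A" "y \<in> carrier A"
  shows "cs_dist B (f x) (f y) = cs_norm B (f (cs_add A x (cs_scale A (-1) y)))"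
  using assms by (simp add: cs_dist_def star_hom_add star_hom_scale normed_star_algebra.scale_closed)

section \<open>Norm-continuous functions\<close>

lemma eventually_withinI: "(\<And>y. y \<in> X \<Longrightarrow> P y) \<Longrightarrow> eventually P (at x within X)"
  by (simp add: eventually_at_filter)

definition cs_continuous :: "'x::topological_space set \<Rightarrow> 'a cstar \<Rightarrow> ('x \<Rightarrow> 'a) \<Rightarrow> bool" where
  "cs_continuous X F g \<longleftrightarrow> g \<in> X \<rightarrow> carrier F \<and>
     (\<forall>x\<in>X. ((\<lambda>y. cs_dist F (g y) (g x)) \<longlongrightarrow> 0) (at x within X))"

lemma C_alg_carrier: "g \<in> carrier (C_alg X F) \<longleftrightarrow> g \<in> extensional X \<and> cs_continuous X F g"
  by (auto simp: C_alg_def cs_continuous_def PiE_def)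

lemma cs_continuous_closed: "cs_continuous X F g \<Longrightarrow> x \<in> X \<Longrightarrow> g x \<in> carrier F"
  by (auto simp: cs_continuous_def)

lemma C_alg_closed: "g \<in> carrier (C_alg X F) \<Longrightarrow> x \<in> X \<Longrightarrow> g x \<in> carrier F"
  by (auto simp: C_alg_carrier cs_continuous_closed)

lemma C_alg_apply [simp]:
  assumes "x \<in> X"
  shows "cs_add (C_alg X F) g h x = cs_add F (g x) (h x)"
    and "cs_mult (C_alg X F) g h x = cs_mult F (g x) (h x)"
    and "cs_scale (C_alg X F) c g x = cs_scale F c (g x)"
    and "cs_star (C_alg X F) g x = cs_star F (g x)"
  using assms by (simp_all add: C_alg_def)

lemma C_alg_extensional [simp]:
  "cs_add (C_alg X F) g h \<in> extensional X"
  "cs_mult (C_alg X F) g h \<in> extensional X"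
  "cs_scale (C_alg X F) c g \<in> extensional X"
  "cs_star (C_alg X F) g \<in> extensional X"
  by (simp_all add: C_alg_def)

lemma C_alg_norm: "cs_norm (C_alg X F) g = (SUP x\<in>X. cs_norm F (g x))"
  by (simp add: C_alg_def)

lemma cs_continuous_cong:
  assumes "\<And>x. x \<in> X \<Longrightarrow> g x = h x"
  shows "cs_continuous X F g \<longleftrightarrow> cs_continuous X F h"
proof -
  have "((\<lambda>y. cs_dist F (g y) (g x)) \<longlongrightarrow> 0) (at x within X) \<longleftrightarrow>
        ((\<lambda>y. cs_dist F (h y) (h x)) \<longlongrightarrow> 0) (at x within X)" if "x \<in> X" for x
    by (rule tendsto_cong) (use assms that in \<open>auto simp: eventually_at_filter\<close>)
  then show ?thesis unfolding cs_continuous_def using assms by (auto simp: Pi_iff)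
qed

lemma cs_continuous_restrict [simp]: "cs_continuous X F (restrict g X) \<longleftrightarrow> cs_continuous X F g"
  by (rule cs_continuous_cong) auto

lemma C_alg_eqI:
  "g \<in> extensional X \<Longrightarrow> h \<in> extensional X \<Longrightarrow> (\<And>x. x \<in> X \<Longrightarrow> g x = h x) \<Longrightarrow> g = h"
  by (rule extensionalityI)

lemma cs_continuous_Un:
  assumes "cs_continuous X F g" "cs_continuous Y F g" "closed X" "closed Y"
  shows "cs_continuous (X \<union> Y) F g"
proof -
  have "((\<lambda>y. cs_dist F (g y) (g x)) \<longlongrightarrow> 0) (at x within Z)"
    if "cs_continuous Z F g" "closed Z" for x Z
  proof (cases "x \<in> Z")
    case True
    then show ?thesis using that by (auto simp: cs_continuous_def)
  next
    case False
    then have "at x within Z = bot"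
      using that trivial_limit_within closed_limpt by blast
    then show ?thesis by simp
  qed
  then show ?thesis using assms unfolding cs_continuous_def by (auto intro!: Lim_Un)
qed

context normed_star_algebra
begin

lemma cs_continuousI:
  assumes "\<And>x. x \<in> X \<Longrightarrow> g x \<in> carrier A"
    and "\<And>x. x \<in> X \<Longrightarrow> \<exists>u. continuous_on X u \<and> u x = 0 \<and> (\<forall>y\<in>X. cs_dist A (g y) (g x) \<le> u y)"
  shows "cs_continuous X A g"
  unfolding cs_continuous_def
proof (intro conjI ballI)
  fix x assume x: "x \<in> X"
  obtain u where u: "continuous_on X u" "u x = 0" "\<forall>y\<in>X. cs_dist A (g y) (g x) \<le> u y"
    using assms(2)[OF x] by auto
  have "(u \<longlongrightarrow> 0) (at x within X)" using u x by (metis continuous_on_def)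
  moreover have "\<forall>\<^sub>F y in at x within X. norm (cs_dist A (g y) (g x)) \<le> u y"
    using u assms(1) x by (intro eventually_withinI) simp
  ultimately show "((\<lambda>y. cs_dist A (g y) (g x)) \<longlongrightarrow> 0) (at x within X)"
    by (rule Lim_null_comparison[rotated])
qed (use assms in auto)

lemma cs_continuous_const: "c \<in> carrier A \<Longrightarrow> cs_continuous X A (\<lambda>_. c)"
  by (auto simp: cs_continuous_def)

lemma continuous_on_cs_dist:
  assumes g: "cs_continuous X A g" and h: "cs_continuous X A h"
  shows "continuous_on X (\<lambda>x. cs_dist A (g x) (h x))"
  unfolding continuous_on_def
proof
  fix x assume x: "x \<in> X"
  let ?u = "\<lambda>y. cs_dist A (g y) (g x) + cs_dist A (h y) (h x)"
  have "(?u \<longlongrightarrow> 0 + 0) (at x within X)"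
    using g h x by (intro tendsto_add) (auto simp: cs_continuous_def)
  then have lim: "(?u \<longlongrightarrow> 0) (at x within X)" by (simp only: add_0_right)
  have "\<bar>cs_dist A (g y) (h y) - cs_dist A (g x) (h x)\<bar> \<le> ?u y" if y: "y \<in> X" for y
  proof -
    have c: "g x \<in> carrier A" "h x \<in> carrier A" "g y \<in> carrier A" "h y \<in> carrier A"
      using g h x y cs_continuous_closed by blast+
    show ?thesis
      using dist_triangle[of "g y" "g x" "h y"] dist_triangle[of "g x" "h x" "h y"]
        dist_triangle[of "g x" "g y" "h x"] dist_triangle[of "g y" "h y" "h x"]
        dist_commute[of "g x" "g y"] dist_commute[of "h x" "h y"] c
      by linarith
  qed
  then have "\<forall>\<^sub>F y in at x within X. norm (cs_dist A (g y) (h y) - cs_dist A (g x) (h x)) \<le> ?u y"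
    unfolding real_norm_def by (rule eventually_withinI)
  then have "((\<lambda>y. cs_dist A (g y) (h y) - cs_dist A (g x) (h x)) \<longlongrightarrow> 0) (at x within X)"
    using lim by (rule Lim_null_comparison)
  then show "((\<lambda>y. cs_dist A (g y) (h y)) \<longlongrightarrow> cs_dist A (g x) (h x)) (at x within X)"
    by (rule LIM_zero_cancel)
qed

lemma continuous_on_cs_dist_const:
  "cs_continuous X A g \<Longrightarrow> c \<in> carrier A \<Longrightarrow> continuous_on X (\<lambda>x. cs_dist A (g x) c)"
  by (intro continuous_on_cs_dist cs_continuous_const)

lemma continuous_on_cs_norm:
  assumes "cs_continuous X A g"
  shows "continuous_on X (\<lambda>x. cs_norm A (g x))"
proof -
  have "continuous_on X (\<lambda>x. cs_dist A (g x) 0\<^sub>A)"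
    using assms by (intro continuous_on_cs_dist_const) auto
  then show ?thesis
    using assms by (simp cong: continuous_on_cong_simp add: cs_continuous_closed)
qed

lemma cs_continuous_compose:
  assumes g: "cs_continuous X A g" and p: "continuous_on Y p" "\<And>y. y \<in> Y \<Longrightarrow> p y \<in> X"
  shows "cs_continuous Y A (\<lambda>y. g (p y))"
proof (rule cs_continuousI)
  fix y assume y: "y \<in> Y"
  have "continuous_on Y (\<lambda>z. cs_dist A (g (p z)) (g (p y)))"
    by (rule continuous_on_compose2[OF continuous_on_cs_dist_const[OF g]])
      (use p y g in \<open>auto intro: cs_continuous_closed\<close>)
  then show "\<exists>u. continuous_on Y u \<and> u y = 0 \<and> (\<forall>z\<in>Y. cs_dist A (g (p z)) (g (p y)) \<le> u z)"
    using y p g by (intro exI[of _ "\<lambda>z. cs_dist A (g (p z)) (g (p y))"]) (auto intro!: dist_self cs_continuous_closed)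
qed (use assms in \<open>auto intro: cs_continuous_closed\<close>)

lemma cs_continuous_add:
  assumes "cs_continuous X A g" "cs_continuous X A h"
  shows "cs_continuous X A (\<lambda>x. g x +\<^sub>A h x)"
proof -
  have [simp]: "g x \<in> carrier A" if "x \<in> X" for x
    using assms that cs_continuous_closed by blast
  have [simp]: "h x \<in> carrier A" if "x \<in> X" for x
    using assms that cs_continuous_closed by blast
  show ?thesis
  proof (rule cs_continuousI)
    fix x assume x: "x \<in> X"
    let ?u = "\<lambda>y. cs_dist A (g y) (g x) + cs_dist A (h y) (h x)"
    have "continuous_on X ?u"
      using assms x by (intro continuous_on_add continuous_on_cs_dist_const) simp_all
    then show "\<exists>u. continuous_on X u \<and> u x = 0 \<and> (\<forall>y\<in>X. cs_dist A (g y +\<^sub>A h y) (g x +\<^sub>A h x) \<le> u y)"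
      using x by (intro exI[of _ ?u]) (simp add: dist_add)
  qed simp
qed

lemma cs_continuous_mult:
  assumes "cs_continuous X A g" "cs_continuous X A h"
  shows "cs_continuous X A (\<lambda>x. g x *\<^sub>A h x)"
proof -
  have [simp]: "g x \<in> carrier A" if "x \<in> X" for x
    using assms that cs_continuous_closed by blast
  have [simp]: "h x \<in> carrier A" if "x \<in> X" for x
    using assms that cs_continuous_closed by blast
  show ?thesis
  proof (rule cs_continuousI)
    fix x assume x: "x \<in> X"
    let ?u = "\<lambda>y. cs_norm A (g y) * cs_dist A (h y) (h x) + cs_dist A (g y) (g x) * cs_norm A (h x)"
    have "continuous_on X ?u"
      using assms x by (intro continuous_on_add continuous_on_mult continuous_on_const
        continuous_on_cs_dist_const continuous_on_cs_norm) simp_all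
    moreover have "cs_dist A (g y *\<^sub>A h y) (g x *\<^sub>A h x) \<le> ?u y" if y: "y \<in> X" for y
    proof -
      have "cs_dist A (g y *\<^sub>A h y) (g x *\<^sub>A h x) \<le>
        cs_dist A (g y *\<^sub>A h y) (g y *\<^sub>A h x) + cs_dist A (g y *\<^sub>A h x) (g x *\<^sub>A h x)"
        using x y by (intro dist_triangle) simp_all
      also have "\<dots> \<le> ?u y"
        using x y by (intro add_mono dist_mult_left dist_mult_right) simp_all
      finally show ?thesis .
    qed
    ultimately show "\<exists>u. continuous_on X u \<and> u x = 0 \<and> (\<forall>y\<in>X. cs_dist A (g y *\<^sub>A h y) (g x *\<^sub>A h x) \<le> u y)"
      using x by (intro exI[of _ ?u]) simp
  qed simp
qed

lemma cs_continuous_scale: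
  assumes "continuous_on X c" "cs_continuous X A g"
  shows "cs_continuous X A (\<lambda>x. c x \<cdot>\<^sub>A g x)"
proof -
  have [simp]: "g x \<in> carrier A" if "x \<in> X" for x
    using assms that cs_continuous_closed by blast
  show ?thesis
  proof (rule cs_continuousI)
    fix x assume x: "x \<in> X"
    let ?u = "\<lambda>y. cmod (c y) * cs_dist A (g y) (g x) + cmod (c y - c x) * cs_norm A (g x)"
    have "continuous_on X ?u"
      using assms x by (intro continuous_on_add continuous_on_mult continuous_on_const continuous_on_norm
        continuous_on_diff continuous_on_cs_dist_const) simp_all
    then show "\<exists>u. continuous_on X u \<and> u x = 0 \<and> (\<forall>y\<in>X. cs_dist A (c y \<cdot>\<^sub>A g y) (c x \<cdot>\<^sub>A g x) \<le> u y)"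
      using x by (intro exI[of _ ?u]) (simp add: dist_scale)
  qed simp
qed

lemma cs_continuous_star:
  assumes "cs_continuous X A g"
  shows "cs_continuous X A (\<lambda>x. cs_star A (g x))"
proof -
  have [simp]: "g x \<in> carrier A" if "x \<in> X" for x
    using assms that cs_continuous_closed by blast
  show ?thesis
  proof (rule cs_continuousI)
    fix x assume x: "x \<in> X"
    have "continuous_on X (\<lambda>y. cs_dist A (g y) (g x))"
      using assms x by (intro continuous_on_cs_dist_const) simp_all
    then show "\<exists>u. continuous_on X u \<and> u x = 0 \<and> (\<forall>y\<in>X. cs_dist A (cs_star A (g y)) (cs_star A (g x)) \<le> u y)"
      using x by (intro exI[of _ "\<lambda>y. cs_dist A (g y) (g x)"]) (simp add: dist_star)
  qed simp
qed

section \<open>Algebras of functions on a compact space\<close>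

lemma norm_le_C_alg_norm:
  assumes "compact X" "g \<in> carrier (C_alg X A)" "x \<in> X"
  shows "cs_norm A (g x) \<le> cs_norm (C_alg X A) g"
  unfolding C_alg_norm
proof (rule cSUP_upper[OF assms(3)])
  have "compact ((\<lambda>x. cs_norm A (g x)) ` X)"
    using assms by (intro compact_continuous_image continuous_on_cs_norm) (auto simp: C_alg_carrier)
  then show "bdd_above ((\<lambda>x. cs_norm A (g x)) ` X)"
    by (intro bounded_imp_bdd_above compact_imp_bounded)
qed

lemma C_alg_norm_le:
  "X \<noteq> {} \<Longrightarrow> (\<And>x. x \<in> X \<Longrightarrow> cs_norm A (g x) \<le> b) \<Longrightarrow> cs_norm (C_alg X A) g \<le> b"
  unfolding C_alg_norm by (rule cSUP_least)

lemma C_alg_quasi_inverse: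
  assumes X: "compact X" and g: "g \<in> carrier (C_alg X A)" and n: "cs_norm (C_alg X A) g < 1"
  shows "\<exists>q\<in>carrier (C_alg X A). \<forall>x\<in>X. g x +\<^sub>A q x = g x *\<^sub>A q x \<and> g x +\<^sub>A q x = q x *\<^sub>A g x"
proof -
  let ?s = "cs_norm (C_alg X A) g"
  have gc: "g x \<in> carrier A" and gn: "cs_norm A (g x) \<le> ?s" if "x \<in> X" for x
    using that X g by (auto simp: C_alg_closed norm_le_C_alg_norm)
  have "\<forall>x\<in>X. \<exists>q. q \<in> carrier A \<and> g x +\<^sub>A q = g x *\<^sub>A q \<and> g x +\<^sub>A q = q *\<^sub>A g x"
    using quasi_inverse_exists gc gn n by (meson le_less_trans)
  then obtain q where q: "\<And>x. x \<in> X \<Longrightarrow> q x \<in> carrier A"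
    "\<And>x. x \<in> X \<Longrightarrow> g x +\<^sub>A q x = g x *\<^sub>A q x" "\<And>x. x \<in> X \<Longrightarrow> g x +\<^sub>A q x = q x *\<^sub>A g x"
    by metis
  have "cs_continuous X A q"
  proof (rule cs_continuousI)
    fix x assume x: "x \<in> X"
    let ?u = "\<lambda>y. cs_dist A (g y) (g x) * (1 + cs_norm A (q x)) / (1 - ?s)"
    have "continuous_on X ?u"
      using g n x gc
      by (intro continuous_on_divide continuous_on_mult continuous_on_const continuous_on_cs_dist_const)
        (simp_all add: C_alg_carrier)
    moreover have "cs_dist A (q y) (q x) \<le> ?u y" if y: "y \<in> X" for y
    proof -
      have "cs_dist A (q y) (q x) \<le> cs_dist A (g y) (g x) * (1 + cs_norm A (q x)) / (1 - cs_norm A (g y))"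
        using q gc gn[OF y] n x y by (intro dist_quasi_inverse) auto
      also have "\<dots> \<le> ?u y"
        using q gc gn[OF y] n x y by (intro divide_left_mono mult_nonneg_nonneg mult_pos_pos) auto
      finally show ?thesis .
    qed
    ultimately show "\<exists>u. continuous_on X u \<and> u x = 0 \<and> (\<forall>y\<in>X. cs_dist A (q y) (q x) \<le> u y)"
      using gc x by (intro exI[of _ ?u]) auto
  qed (use q in auto)
  then show ?thesis
    using q by (intro bexI[of _ "restrict q X"]) (auto simp: C_alg_carrier)
qed

lemma normed_star_algebra_C_alg:
  assumes X: "compact X" "X \<noteq> {}"
  shows "normed_star_algebra (C_alg X A)"
proof
  let ?C = "C_alg X A"
  have [simp]: "g t \<in> carrier A" if "g \<in> carrier ?C" "t \<in> X" for g t
    using that by (rule C_alg_closed)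
  have cont: "cs_continuous X A g" if "g \<in> carrier ?C" for g
    using that by (simp add: C_alg_carrier)
  have ext: "g \<in> extensional X" if "g \<in> carrier ?C" for g
    using that by (simp add: C_alg_carrier)
  have "(\<lambda>x\<in>X. 0\<^sub>A) \<in> carrier ?C"
    by (simp add: C_alg_carrier cs_continuous_const)
  then show "carrier ?C \<noteq> {}" by blast
  fix x y z assume x: "x \<in> carrier ?C" and y: "y \<in> carrier ?C"
    and z: "z \<in> carrier ?C"
  show "cs_add ?C x y \<in> carrier ?C"
    using cs_continuous_add[OF cont[OF x] cont[OF y]]
    by (simp add: C_alg_carrier cong: cs_continuous_cong)
  show "cs_mult ?C x y \<in> carrier ?C"
    using cs_continuous_mult[OF cont[OF x] cont[OF y]]
    by (simp add: C_alg_carrier cong: cs_continuous_cong)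
  show "cs_scale ?C c x \<in> carrier ?C" for c
    using cs_continuous_scale[OF continuous_on_const cont[OF x]] by (simp add: C_alg_carrier cong: cs_continuous_cong)
  show "cs_star ?C x \<in> carrier ?C"
    using cs_continuous_star[OF cont[OF x]] by (simp add: C_alg_carrier cong: cs_continuous_cong)
  show "cs_add ?C (cs_add ?C x y) z = cs_add ?C x (cs_add ?C y z)"
    by (rule C_alg_eqI[where X = X]) (use x y z in \<open>auto simp: add_assoc\<close>)
  show "cs_add ?C x y = cs_add ?C y x"
    by (rule C_alg_eqI[where X = X]) (use x y z in \<open>auto simp: add_comm\<close>)
  show "cs_add ?C x (cs_scale ?C 0 y) = x"
    by (rule C_alg_eqI[where X = X]) (use x y z ext in \<open>auto\<close>)
  show "cs_scale ?C 1 x = x"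
    by (rule C_alg_eqI[where X = X]) (use x y z ext in \<open>auto\<close>)
  show "cs_scale ?C c (cs_scale ?C d x) = cs_scale ?C (c * d) x" for c d
    by (rule C_alg_eqI[where X = X]) (use x y z in \<open>auto simp: scale_scale\<close>)
  show "cs_scale ?C (c + d) x = cs_add ?C (cs_scale ?C c x) (cs_scale ?C d x)" for c d
    by (rule C_alg_eqI[where X = X]) (use x y z in \<open>auto simp: scale_add_left\<close>)
  show "cs_scale ?C c (cs_add ?C x y) = cs_add ?C (cs_scale ?C c x) (cs_scale ?C c y)" for c
    by (rule C_alg_eqI[where X = X]) (use x y z in \<open>auto simp: scale_add_right\<close>)
  show "cs_mult ?C (cs_mult ?C x y) z = cs_mult ?C x (cs_mult ?C y z)"
    by (rule C_alg_eqI[where X = X]) (use x y z in \<open>auto simp: mult_assoc\<close>)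
  show "cs_mult ?C x (cs_add ?C y z) = cs_add ?C (cs_mult ?C x y) (cs_mult ?C x z)"
    by (rule C_alg_eqI[where X = X]) (use x y z in \<open>auto simp: distrib_left\<close>)
  show "cs_mult ?C (cs_add ?C x y) z = cs_add ?C (cs_mult ?C x z) (cs_mult ?C y z)"
    by (rule C_alg_eqI[where X = X]) (use x y z in \<open>auto simp: distrib_right\<close>)
  show "cs_mult ?C (cs_scale ?C c x) y = cs_scale ?C c (cs_mult ?C x y)" for c
    by (rule C_alg_eqI[where X = X]) (use x y z in \<open>auto simp: mult_scale_left\<close>)
  show "cs_mult ?C x (cs_scale ?C c y) = cs_scale ?C c (cs_mult ?C x y)" for c
    by (rule C_alg_eqI[where X = X]) (use x y z in \<open>auto simp: mult_scale_right\<close>)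
  show "cs_star ?C (cs_add ?C x y) = cs_add ?C (cs_star ?C x) (cs_star ?C y)"
    by (rule C_alg_eqI[where X = X]) (use x y z in \<open>auto simp: star_add\<close>)
  show "cs_star ?C (cs_scale ?C c x) = cs_scale ?C (cnj c) (cs_star ?C x)" for c
    by (rule C_alg_eqI[where X = X]) (use x y z in \<open>auto simp: star_scale\<close>)
  have up: "cs_norm A (g t) \<le> cs_norm ?C g" if "g \<in> carrier ?C" "t \<in> X" for g t
    using norm_le_C_alg_norm X that by blast
  have nn: "0 \<le> cs_norm ?C g" if "g \<in> carrier ?C" for g
  proof -
    obtain t where "t \<in> X" using X by auto
    then show ?thesis using order_trans[OF norm_ge_0[OF C_alg_closed[OF that]] up[OF that]] by blast
  qed
  show "0 \<le> cs_norm ?C x" using nn x .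
  show "x = cs_scale ?C 0 x" if "cs_norm ?C x = 0"
  proof (rule C_alg_eqI[where X = X])
    fix t assume "t \<in> X"
    moreover from this have "cs_norm A (x t) = 0"
      using up[OF x, of t] norm_ge_0[OF C_alg_closed[OF x, of t]] that by simp
    ultimately show "x t = cs_scale ?C 0 x t"
      using x norm_eq_0_iff[of "x t"] by simp
  qed (use ext x in auto)
  show "cs_norm ?C (cs_add ?C x y) \<le> cs_norm ?C x + cs_norm ?C y"
  proof (rule C_alg_norm_le[OF X(2)])
    fix t assume t: "t \<in> X"
    have "cs_norm A (cs_add ?C x y t) \<le> cs_norm A (x t) + cs_norm A (y t)"
      using t x y by (simp add: norm_triangle)
    also have "\<dots> \<le> cs_norm ?C x + cs_norm ?C y"
      using up x y t by (intro add_mono) blast+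
    finally show "cs_norm A (cs_add ?C x y t) \<le> cs_norm ?C x + cs_norm ?C y" .
  qed
  show "cs_norm ?C (cs_mult ?C x y) \<le> cs_norm ?C x * cs_norm ?C y"
  proof (rule C_alg_norm_le[OF X(2)])
    fix t assume t: "t \<in> X"
    have "cs_norm A (cs_mult ?C x y t) \<le> cs_norm A (x t) * cs_norm A (y t)"
      using t x y by (simp add: norm_mult_le)
    also have "\<dots> \<le> cs_norm ?C x * cs_norm ?C y"
      using up[OF x t] up[OF y t] nn[OF x] norm_ge_0[OF C_alg_closed[OF y t]] by (intro mult_mono)
    finally show "cs_norm A (cs_mult ?C x y t) \<le> cs_norm ?C x * cs_norm ?C y" .
  qed
  show "cs_norm ?C (cs_star ?C x) \<le> cs_norm ?C x"
  proof (rule C_alg_norm_le[OF X(2)])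
    fix t assume t: "t \<in> X"
    have "cs_norm A (cs_star ?C x t) \<le> cs_norm A (x t)"
      using t x by (simp add: norm_star)
    also have "\<dots> \<le> cs_norm ?C x" by (rule up[OF x t])
    finally show "cs_norm A (cs_star ?C x t) \<le> cs_norm ?C x" .
  qed
  show "cs_norm ?C (cs_scale ?C c x) = cmod c * cs_norm ?C x" for c
  proof -
    have "cs_norm ?C (cs_scale ?C c x) = (SUP t\<in>X. cmod c * cs_norm A (x t))"
      unfolding C_alg_norm by (rule SUP_cong) (use x in \<open>auto simp: norm_scale\<close>)
    also have "\<dots> = cmod c * (SUP t\<in>X. cs_norm A (x t))"
    proof (rule antisym)
      show "(SUP t\<in>X. cmod c * cs_norm A (x t)) \<le> cmod c * (SUP t\<in>X. cs_norm A (x t))"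
        using X up[OF x] by (intro cSUP_least) (auto simp: C_alg_norm intro!: mult_left_mono)
      show "cmod c * (SUP t\<in>X. cs_norm A (x t)) \<le> (SUP t\<in>X. cmod c * cs_norm A (x t))"
      proof (cases "c = 0")
        case True
        then show ?thesis using X by simp
      next
        case False
        have bdd: "bdd_above ((\<lambda>t. cmod c * cs_norm A (x t)) ` X)"
          using up[OF x] by (intro bdd_aboveI2[of _ _ "cmod c * cs_norm ?C x"]) (auto intro: mult_left_mono)
        have "(SUP t\<in>X. cs_norm A (x t)) \<le> (SUP t\<in>X. cmod c * cs_norm A (x t)) / cmod c"
        proof (rule cSUP_least[OF X(2)])
          fix t assume "t \<in> X"
          then show "cs_norm A (x t) \<le> (SUP t\<in>X. cmod c * cs_norm A (x t)) / cmod c"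
            using cSUP_upper[OF _ bdd, of t] False by (simp add: field_simps)
        qed
        then show ?thesis using False by (simp add: field_simps)
      qed
    qed
    finally show ?thesis by (simp add: C_alg_norm)
  qed
  show "\<exists>q\<in>carrier ?C. cs_add ?C x q = cs_mult ?C x q \<and>
      cs_add ?C x q = cs_mult ?C q x"
    if n: "cs_norm ?C x < 1"
  proof -
    obtain q where "q \<in> carrier ?C"
      "\<forall>t\<in>X. x t +\<^sub>A q t = x t *\<^sub>A q t \<and> x t +\<^sub>A q t = q t *\<^sub>A x t"
      using C_alg_quasi_inverse[OF X(1) x n] by blast
    then show ?thesis by (intro bexI[of _ q] conjI C_alg_eqI[where X = X]) auto
  qed
qed

lemma dist_le_C_alg_dist:
  assumes X: "compact X" "X \<noteq> {}" and "g \<in> carrier (C_alg X A)" "h \<in> carrier (C_alg X A)" "x \<in> X"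
  shows "cs_dist A (g x) (h x) \<le> cs_dist (C_alg X A) g h"
proof -
  interpret C: normed_star_algebra "C_alg X A" by (rule normed_star_algebra_C_alg[OF X])
  show ?thesis
    using norm_le_C_alg_norm[OF X(1), of "C.add g (C.scale (-1) h)"] assms
    by (simp add: dist_eq C.dist_eq)
qed

lemma C_alg_dist_le:
  assumes "X \<noteq> {}" "\<And>x. x \<in> X \<Longrightarrow> cs_dist A (g x) (h x) \<le> b"
  shows "cs_dist (C_alg X A) g h \<le> b"
  using C_alg_norm_le[of X "cs_add (C_alg X A) g (cs_scale (C_alg X A) (-1) h)" b] assms
  by (simp add: cs_dist_def)

lemma C_alg_zero:
  assumes X: "compact X" "X \<noteq> {}"
  shows "cs_zero (C_alg X A) = (\<lambda>x\<in>X. 0\<^sub>A)"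
proof -
  interpret C: normed_star_algebra "C_alg X A" by (rule normed_star_algebra_C_alg[OF X])
  show ?thesis
  proof (rule C_alg_eqI[where X = X])
    show "C.zero \<in> extensional X" using C.zero_closed C_alg_carrier by blast
    fix x assume x: "x \<in> X"
    have "C.zero x = C.scale 0 C.zero x" by simp
    also have "\<dots> = 0 \<cdot>\<^sub>A (C.zero x)" using x by (rule C_alg_apply)
    also have "\<dots> = 0\<^sub>A" using C_alg_closed[OF C.zero_closed x] by (rule scale_zero_left)
    finally show "C.zero x = (\<lambda>x\<in>X. 0\<^sub>A) x" using x by simp
  qed simp
qed

lemma cs_continuous_curry:
  assumes X: "compact X" "X \<noteq> {}" and g: "cs_continuous (U \<times> X) A (\<lambda>(u, x). g u x)"
  shows "cs_continuous U (C_alg X A) (\<lambda>u. \<lambda>x\<in>X. g u x)"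
proof -
  have gu: "cs_continuous X A (g u)" if "u \<in> U" for u
    using cs_continuous_compose[OF g continuous_on_Pair[OF continuous_on_const continuous_on_id], of X u] that
    by simp
  have gc: "(\<lambda>x\<in>X. g u x) \<in> carrier (C_alg X A)" if "u \<in> U" for u
    using gu that by (simp add: C_alg_carrier)
  interpret C: normed_star_algebra "C_alg X A" by (rule normed_star_algebra_C_alg[OF X])
  show ?thesis
    unfolding cs_continuous_def
  proof (intro conjI ballI)
    show "(\<lambda>u. \<lambda>x\<in>X. g u x) \<in> U \<rightarrow> carrier (C_alg X A)" using gc by auto
    fix u0 assume u0: "u0 \<in> U"
    have gi: "g u x \<in> carrier A" if "u \<in> U" "x \<in> X" for u x
      using gu that cs_continuous_closed by blast
    have "cs_continuous (U \<times> X) A (\<lambda>z. g u0 (snd z))"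
      by (rule cs_continuous_compose[OF gu[OF u0]]) (auto intro: continuous_on_snd continuous_on_id)
    then have cd: "continuous_on (U \<times> X) (\<lambda>z. cs_dist A ((\<lambda>(u, x). g u x) z) (g u0 (snd z)))"
      by (rule continuous_on_cs_dist[OF g])
    show "((\<lambda>u. cs_dist (C_alg X A) (\<lambda>x\<in>X. g u x) (\<lambda>x\<in>X. g u0 x)) \<longlongrightarrow> 0) (at u0 within U)"
    proof (rule tendstoI)
      fix e :: real assume e: "e > 0"
      obtain V where V: "u0 \<in> V" "open V"
        and V': "\<forall>u\<in>V \<inter> U. \<forall>x\<in>X. dist (cs_dist A (g u x) (g u0 x)) (cs_dist A (g u0 x) (g u0 x)) \<le> e / 2"
        using continuous_on_prod_compactE[OF cd X(1) u0, of "e/2"] e by auto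
      have "cs_dist (C_alg X A) (\<lambda>x\<in>X. g u x) (\<lambda>x\<in>X. g u0 x) \<le> e / 2" if "u \<in> V" "u \<in> U" for u
        by (rule C_alg_dist_le[OF X(2)]) (use V' that gi u0 in \<open>auto simp: dist_real_def\<close>)
      then have *: "dist (cs_dist (C_alg X A) (\<lambda>x\<in>X. g u x) (\<lambda>x\<in>X. g u0 x)) 0 < e" if "u \<in> V" "u \<in> U" for u
        using that C.dist_ge_0[OF gc gc, OF that(2) u0] e by (force simp: dist_real_def)
      then show "\<forall>\<^sub>F u in at u0 within U. dist (cs_dist (C_alg X A) (\<lambda>x\<in>X. g u x) (\<lambda>x\<in>X. g u0 x)) 0 < e"
        unfolding eventually_at_topological using V by blast
    qed
  qed
qed

lemma cs_continuous_uncurry: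
  assumes X: "compact X" "X \<noteq> {}" and G: "cs_continuous U (C_alg X A) G"
  shows "cs_continuous (U \<times> X) A (\<lambda>(u, x). G u x)"
proof -
  interpret C: normed_star_algebra "C_alg X A" by (rule normed_star_algebra_C_alg[OF X])
  have Gc: "G u \<in> carrier (C_alg X A)" if "u \<in> U" for u
    using G that cs_continuous_closed by blast
  have Gi: "G u x \<in> carrier A" if "u \<in> U" "x \<in> X" for u x
    using Gc that C_alg_closed by blast
  show ?thesis
  proof (rule cs_continuousI)
    fix z assume z: "z \<in> U \<times> X"
    let ?u = "\<lambda>w. cs_dist (C_alg X A) (G (fst w)) (G (fst z)) + cs_dist A (G (fst z) (snd w)) (G (fst z) (snd z))"
    have "continuous_on (U \<times> X) (\<lambda>w. cs_dist (C_alg X A) (G (fst w)) (G (fst z)))"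
      by (rule continuous_on_compose2[OF C.continuous_on_cs_dist_const[OF G]])
        (use z Gc in \<open>auto intro: continuous_on_fst continuous_on_id\<close>)
    moreover have "continuous_on (U \<times> X) (\<lambda>w. cs_dist A (G (fst z) (snd w)) (G (fst z) (snd z)))"
      by (rule continuous_on_compose2[OF continuous_on_cs_dist_const[of X "G (fst z)"]])
        (use z Gc[of "fst z"] Gi in \<open>auto intro: continuous_on_snd continuous_on_id simp: C_alg_carrier\<close>)
    ultimately have "continuous_on (U \<times> X) ?u" by (rule continuous_on_add)
    moreover have "?u z = 0" using z Gc Gi by auto
    moreover have "cs_dist A ((\<lambda>(u, x). G u x) w) ((\<lambda>(u, x). G u x) z) \<le> ?u w" if w: "w \<in> U \<times> X" for w
    proof -
      have "cs_dist A (G (fst w) (snd w)) (G (fst z) (snd z)) \<le>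
        cs_dist A (G (fst w) (snd w)) (G (fst z) (snd w)) + cs_dist A (G (fst z) (snd w)) (G (fst z) (snd z))"
        using w z Gi by (intro dist_triangle) auto
      also have "cs_dist A (G (fst w) (snd w)) (G (fst z) (snd w)) \<le> cs_dist (C_alg X A) (G (fst w)) (G (fst z))"
        using w z Gc by (intro dist_le_C_alg_dist[OF X]) auto
      finally show ?thesis by (simp add: case_prod_unfold)
    qed
    ultimately show "\<exists>u. continuous_on (U \<times> X) u \<and> u z = 0 \<and>
        (\<forall>w\<in>U \<times> X. cs_dist A ((\<lambda>(u, x). G u x) w) ((\<lambda>(u, x). G u x) z) \<le> u w)"
      by (intro exI[of _ ?u]) auto
  qed (use Gi in auto)
qed

end

lemma star_hom_C_alg_iff:
  assumes "normed_star_algebra A"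
  shows "star_hom A (C_alg X B) f \<longleftrightarrow>
    (\<forall>a\<in>carrier A. f a \<in> carrier (C_alg X B)) \<and> (\<forall>x\<in>X. star_hom A B (\<lambda>a. f a x))"
proof -
  interpret normed_star_algebra A by fact
  have ext: "f a \<in> extensional X" if "\<forall>a\<in>carrier A. f a \<in> carrier (C_alg X B)" "a \<in> carrier A" for a
    using that by (simp add: C_alg_carrier)
  show ?thesis
  proof (intro iffI conjI ballI)
    fix x assume "star_hom A (C_alg X B) f" "x \<in> X"
    then show "star_hom A B (\<lambda>a. f a x)"
      by (intro star_homI)
        (auto simp: star_hom_add star_hom_mult star_hom_scale star_hom_star intro: C_alg_closed star_hom_closed)
  next
    assume *: "(\<forall>a\<in>carrier A. f a \<in> carrier (C_alg X B)) \<and> (\<forall>x\<in>X. star_hom A B (\<lambda>a. f a x))"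
    then have **: "star_hom A B (\<lambda>a. f a x)" if "x \<in> X" for x using that by blast
    show "star_hom A (C_alg X B) f"
    proof (rule star_homI)
      fix x y assume "x \<in> carrier A" "y \<in> carrier A"
      then show "f (x +\<^sub>A y) = cs_add (C_alg X B) (f x) (f y)" "f (x *\<^sub>A y) = cs_mult (C_alg X B) (f x) (f y)"
        using * ext by (auto intro!: C_alg_eqI[where X = X] simp: star_hom_add[OF **] star_hom_mult[OF **])
    next
      fix c x assume "x \<in> carrier A"
      then show "f (c \<cdot>\<^sub>A x) = cs_scale (C_alg X B) c (f x)"
        using * ext by (auto intro!: C_alg_eqI[where X = X] simp: star_hom_scale[OF **])
    next
      fix x assume "x \<in> carrier A"
      then show "f (cs_star A x) = cs_star (C_alg X B) (f x)"
        using * ext by (auto intro!: C_alg_eqI[where X = X] simp: star_hom_star[OF **])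
    qed (use * in auto)
  qed (auto intro: star_hom_closed)
qed

section \<open>Full matrix algebras\<close>

lemma Re_cscalar_prod_self: "Re (v \<bullet>c v) = (\<Sum>i<dim_vec v. (cmod (v $ i))\<^sup>2)"
proof -
  have "Re (z * cnj z) = (cmod z)\<^sup>2" for z
    by (metis Re_complex_of_real complex_norm_square)
  then show ?thesis
    by (simp add: scalar_prod_def lessThan_atLeast0 del: times_complex.sel)
qed

lemma cvec_norm_eq: "cvec_norm v = L2_set (\<lambda>i. cmod (v $ i)) {..<dim_vec v}"
  by (simp add: cvec_norm_def L2_set_def Re_cscalar_prod_self)

lemma cvec_norm_ge_0 [simp]: "0 \<le> cvec_norm v"
  by (simp add: cvec_norm_eq)

lemma cvec_norm_smult: "cvec_norm (c \<cdot>\<^sub>v v) = cmod c * cvec_norm v"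
  unfolding cvec_norm_eq by (subst L2_set_right_distrib) (auto simp: norm_mult intro!: L2_set_cong)

lemma cvec_norm_triangle:
  assumes "v \<in> carrier_vec n" "w \<in> carrier_vec n"
  shows "cvec_norm (v + w) \<le> cvec_norm v + cvec_norm w"
proof -
  have "cvec_norm (v + w) \<le> L2_set (\<lambda>i. cmod (v $ i) + cmod (w $ i)) {..<n}"
    unfolding cvec_norm_eq using assms by (auto intro!: L2_set_mono norm_triangle_ineq)
  also have "\<dots> \<le> cvec_norm v + cvec_norm w"
    using L2_set_triangle_ineq[of "\<lambda>i. cmod (v $ i)" "\<lambda>i. cmod (w $ i)" "{..<n}"] assms
    by (simp add: cvec_norm_eq)
  finally show ?thesis .
qed

lemma cvec_norm_eq_0D:
  assumes "v \<in> carrier_vec n" "cvec_norm v = 0"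
  shows "v = 0\<^sub>v n"
  using assms by (intro eq_vecI) (auto simp: cvec_norm_eq L2_set_eq_0_iff)

lemma cvec_norm_zero [simp]: "cvec_norm (0\<^sub>v n) = 0"
  by (simp add: cvec_norm_eq L2_set_def)

lemma cmod_cscalar_prod_le:
  assumes "v \<in> carrier_vec n" "w \<in> carrier_vec n"
  shows "cmod (v \<bullet>c w) \<le> cvec_norm v * cvec_norm w"
proof -
  have "cmod (v \<bullet>c w) \<le> (\<Sum>i<n. \<bar>cmod (v $ i)\<bar> * \<bar>cmod (w $ i)\<bar>)"
    unfolding scalar_prod_def using assms
    by (auto simp: lessThan_atLeast0 norm_mult intro!: order_trans[OF norm_sum] sum_mono)
  also have "\<dots> \<le> cvec_norm v * cvec_norm w"
    using L2_set_mult_ineq[of "\<lambda>i. cmod (v $ i)" "\<lambda>i. cmod (w $ i)" "{..<n}"] assms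
    by (simp add: cvec_norm_eq)
  finally show ?thesis .
qed

lemma cvec_norm_mult_mat_vec_le_sum:
  assumes "M \<in> carrier_mat m n" "v \<in> carrier_vec n"
  shows "cvec_norm (M *\<^sub>v v) \<le> (\<Sum>i<m. \<Sum>j<n. cmod (M $$ (i, j))) * cvec_norm v"
proof -
  have v: "cmod (v $ j) \<le> cvec_norm v" if "j < n" for j
    unfolding cvec_norm_eq using assms that by (intro member_le_L2_set) auto
  have "cvec_norm (M *\<^sub>v v) \<le> (\<Sum>i<m. cmod ((M *\<^sub>v v) $ i))"
    unfolding cvec_norm_eq using assms by (simp add: L2_set_le_sum del: index_mult_mat_vec)
  also have "\<dots> \<le> (\<Sum>i<m. \<Sum>j<n. cmod (M $$ (i, j)) * cmod (v $ j))"
    using assms by (intro sum_mono)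
      (auto simp: scalar_prod_def lessThan_atLeast0 norm_mult intro!: order_trans[OF norm_sum] sum_mono)
  also have "\<dots> \<le> (\<Sum>i<m. \<Sum>j<n. cmod (M $$ (i, j)) * cvec_norm v)"
    using v by (intro sum_mono mult_left_mono) auto
  finally show ?thesis by (simp add: sum_distrib_right)
qed

lemma
  assumes M: "M \<in> carrier_mat m n"
  shows cvec_norm_mult_mat_vec_le: "v \<in> carrier_vec n \<Longrightarrow> cvec_norm (M *\<^sub>v v) \<le> mat_opnorm M * cvec_norm v"
    and mat_opnorm_le: "0 \<le> b \<Longrightarrow> (\<And>v. v \<in> carrier_vec n \<Longrightarrow> cvec_norm (M *\<^sub>v v) \<le> b * cvec_norm v) \<Longrightarrow>
      mat_opnorm M \<le> b"
    and mat_opnorm_ge_0: "0 \<le> mat_opnorm M"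
proof -
  let ?S = "{cvec_norm (M *\<^sub>v v) | v. v \<in> carrier_vec (dim_col M) \<and> cvec_norm v \<le> 1}"
  let ?K = "\<Sum>i<m. \<Sum>j<n. cmod (M $$ (i, j))"
  have d: "dim_col M = n" using M by simp
  have "x \<le> ?K" if x: "x \<in> ?S" for x
  proof -
    obtain v where v: "v \<in> carrier_vec n" "cvec_norm v \<le> 1" "x = cvec_norm (M *\<^sub>v v)"
      using x d by auto
    have "x \<le> ?K * cvec_norm v" using cvec_norm_mult_mat_vec_le_sum[OF M v(1)] v(3) by simp
    also have "\<dots> \<le> ?K * 1" using v(2) by (intro mult_left_mono sum_nonneg) auto
    finally show ?thesis by simp
  qed
  then have bdd: "bdd_above ?S" by (rule bdd_aboveI)
  have z: "cvec_norm (M *\<^sub>v 0\<^sub>v n) \<in> ?S" using d by force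
  have up: "cvec_norm (M *\<^sub>v v) \<le> mat_opnorm M" if "v \<in> carrier_vec n" "cvec_norm v \<le> 1" for v
    unfolding mat_opnorm_def by (rule cSup_upper[OF _ bdd]) (use that d in auto)
  show ge0: "0 \<le> mat_opnorm M"
    using up[of "0\<^sub>v n"] order_trans[OF cvec_norm_ge_0] by auto
  show "cvec_norm (M *\<^sub>v v) \<le> mat_opnorm M * cvec_norm v" if v: "v \<in> carrier_vec n" for v
  proof (cases "cvec_norm v = 0")
    case True
    then have "v = 0\<^sub>v n" using cvec_norm_eq_0D v by blast
    then have "M *\<^sub>v v = 0\<^sub>v m" using M by auto
    then show ?thesis using True by simp
  next
    case False
    then have pos: "cvec_norm v > 0" using cvec_norm_ge_0[of v] by linarith
    let ?c = "complex_of_real (1 / cvec_norm v)"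
    have "cvec_norm (M *\<^sub>v (?c \<cdot>\<^sub>v v)) \<le> mat_opnorm M"
      by (rule up) (use v pos in \<open>simp_all add: cvec_norm_smult norm_divide\<close>)
    moreover have "M *\<^sub>v (?c \<cdot>\<^sub>v v) = ?c \<cdot>\<^sub>v (M *\<^sub>v v)"
      using M v by (rule mult_mat_vec)
    ultimately show ?thesis using pos by (simp add: cvec_norm_smult norm_divide field_simps)
  qed
  show "mat_opnorm M \<le> b" if b: "0 \<le> b" "\<And>v. v \<in> carrier_vec n \<Longrightarrow> cvec_norm (M *\<^sub>v v) \<le> b * cvec_norm v" for b
    unfolding mat_opnorm_def
  proof (rule cSup_least)
    show "?S \<noteq> {}" using z by blast
    fix x assume "x \<in> ?S"
    then obtain v where v: "v \<in> carrier_vec n" "cvec_norm v \<le> 1" "x = cvec_norm (M *\<^sub>v v)"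
      using d by auto
    have "x \<le> b * cvec_norm v" using b(2) v by simp
    also have "\<dots> \<le> b * 1" using b(1) v(2) by (intro mult_left_mono)
    finally show "x \<le> b" by simp
  qed
qed

lemma mat_opnorm_le_sum:
  assumes "M \<in> carrier_mat m n"
  shows "mat_opnorm M \<le> (\<Sum>i<m. \<Sum>j<n. cmod (M $$ (i, j)))"
  using assms by (intro mat_opnorm_le cvec_norm_mult_mat_vec_le_sum sum_nonneg) auto

lemma mat_adjoint_eq:
  fixes M :: "complex mat"
  assumes "M \<in> carrier_mat n n"
  shows "mat_adjoint M = Matrix.mat n n (\<lambda>(i, j). cnj (M $$ (j, i)))"
  using assms unfolding mat_adjoint_def
  by (intro eq_matI) (auto simp: mat_of_rows_index conjugate_vec_def)

lemma mat_adjoint_closed [simp]: "(M :: complex mat) \<in> carrier_mat n n \<Longrightarrow> mat_adjoint M \<in> carrier_mat n n"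
  by (simp add: mat_adjoint_eq[of M n])

lemma mat_adjoint_cscalar_prod:
  fixes M :: "complex mat"
  assumes "M \<in> carrier_mat n n" "v \<in> carrier_vec n" "w \<in> carrier_vec n"
  shows "(mat_adjoint M *\<^sub>v v) \<bullet>c w = v \<bullet>c (M *\<^sub>v w)"
proof -
  have "(mat_adjoint M *\<^sub>v v) \<bullet>c w = (\<Sum>i<n. (\<Sum>j<n. cnj (M $$ (j, i)) * v $ j) * cnj (w $ i))"
    using assms by (auto simp: mat_adjoint_eq[of M n] scalar_prod_def lessThan_atLeast0)
  also have "\<dots> = (\<Sum>i<n. \<Sum>j<n. v $ j * (cnj (M $$ (j, i)) * cnj (w $ i)))"
    by (simp add: sum_distrib_left sum_distrib_right algebra_simps)
  also have "\<dots> = (\<Sum>j<n. v $ j * (\<Sum>i<n. cnj (M $$ (j, i)) * cnj (w $ i)))"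
    by (subst sum.swap) (simp add: sum_distrib_left)
  also have "\<dots> = v \<bullet>c (M *\<^sub>v w)"
    using assms by (auto simp: scalar_prod_def lessThan_atLeast0)
  finally show ?thesis .
qed

lemma mat_opnorm_adjoint_le:
  assumes M: "M \<in> carrier_mat n n"
  shows "mat_opnorm (mat_adjoint M) \<le> mat_opnorm M"
proof (rule mat_opnorm_le[OF mat_adjoint_closed[OF M] mat_opnorm_ge_0[OF M]])
  fix v :: "complex vec" assume v: "v \<in> carrier_vec n"
  let ?w = "mat_adjoint M *\<^sub>v v"
  have w: "?w \<in> carrier_vec n" using mat_adjoint_closed[OF M] v by (rule mult_mat_vec_carrier)
  have "?w \<bullet>c ?w = v \<bullet>c (M *\<^sub>v ?w)" by (rule mat_adjoint_cscalar_prod[OF M v w])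
  moreover have "cvec_norm ?w * cvec_norm ?w = Re (?w \<bullet>c ?w)"
    by (simp only: cvec_norm_def Re_cscalar_prod_self real_sqrt_mult_self abs_of_nonneg sum_nonneg zero_le_power2)
  ultimately have "cvec_norm ?w * cvec_norm ?w \<le> cmod (v \<bullet>c (M *\<^sub>v ?w))"
    by (simp add: complex_Re_le_cmod)
  also have "\<dots> \<le> cvec_norm v * cvec_norm (M *\<^sub>v ?w)"
    using M v w by (intro cmod_cscalar_prod_le[of _ n]) auto
  also have "\<dots> \<le> cvec_norm v * (mat_opnorm M * cvec_norm ?w)"
    using M w by (intro mult_left_mono cvec_norm_mult_mat_vec_le) auto
  finally have *: "cvec_norm ?w * cvec_norm ?w \<le> (mat_opnorm M * cvec_norm v) * cvec_norm ?w"
    by (simp add: algebra_simps)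
  show "cvec_norm ?w \<le> mat_opnorm M * cvec_norm v"
  proof (cases "cvec_norm ?w = 0")
    case True
    then show ?thesis using mat_opnorm_ge_0[OF M] by simp
  next
    case False
    then have "cvec_norm ?w > 0" using cvec_norm_ge_0[of ?w] by linarith
    with * show ?thesis by (rule mult_right_le_imp_le)
  qed
qed

lemma mat_opnorm_smult_le:
  assumes M: "M \<in> carrier_mat n n"
  shows "mat_opnorm (c \<cdot>\<^sub>m M) \<le> cmod c * mat_opnorm M"
proof (rule mat_opnorm_le)
  show "c \<cdot>\<^sub>m M \<in> carrier_mat n n" using M by simp
  show "0 \<le> cmod c * mat_opnorm M" using mat_opnorm_ge_0[OF M] by simp
  fix v :: "complex vec" assume v: "v \<in> carrier_vec n"
  have "(c \<cdot>\<^sub>m M) *\<^sub>v v = c \<cdot>\<^sub>v (M *\<^sub>v v)"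
    using M v by (intro eq_vecI) (auto simp: scalar_prod_def sum_distrib_left mult.assoc)
  then show "cvec_norm ((c \<cdot>\<^sub>m M) *\<^sub>v v) \<le> cmod c * mat_opnorm M * cvec_norm v"
    using mult_left_mono[OF cvec_norm_mult_mat_vec_le[OF M v], of "cmod c"]
    by (simp add: cvec_norm_smult mult.assoc)
qed

lemma mat_opnorm_add_le:
  assumes "M \<in> carrier_mat n n" "N \<in> carrier_mat n n"
  shows "mat_opnorm (M + N) \<le> mat_opnorm M + mat_opnorm N"
proof (rule mat_opnorm_le)
  show "M + N \<in> carrier_mat n n" using assms by simp
  show "0 \<le> mat_opnorm M + mat_opnorm N" using assms mat_opnorm_ge_0 by simp
  fix v :: "complex vec" assume v: "v \<in> carrier_vec n"
  have "cvec_norm ((M + N) *\<^sub>v v) \<le> cvec_norm (M *\<^sub>v v) + cvec_norm (N *\<^sub>v v)"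
    using assms v by (simp add: add_mult_distrib_mat_vec[of _ n n] cvec_norm_triangle[of _ n])
  also have "\<dots> \<le> mat_opnorm M * cvec_norm v + mat_opnorm N * cvec_norm v"
    using assms v by (intro add_mono cvec_norm_mult_mat_vec_le)
  finally show "cvec_norm ((M + N) *\<^sub>v v) \<le> (mat_opnorm M + mat_opnorm N) * cvec_norm v"
    by (simp add: algebra_simps)
qed

lemma mat_opnorm_mult_le:
  assumes M: "M \<in> carrier_mat n n" and N: "N \<in> carrier_mat n n"
  shows "mat_opnorm (M * N) \<le> mat_opnorm M * mat_opnorm N"
proof (rule mat_opnorm_le)
  show "M * N \<in> carrier_mat n n" using assms by simp
  show "0 \<le> mat_opnorm M * mat_opnorm N" using assms mat_opnorm_ge_0 by simp
  fix v :: "complex vec" assume v: "v \<in> carrier_vec n"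
  have "cvec_norm ((M * N) *\<^sub>v v) = cvec_norm (M *\<^sub>v (N *\<^sub>v v))"
    using assms v by (simp add: assoc_mult_mat_vec[of _ n n])
  also have "\<dots> \<le> mat_opnorm M * cvec_norm (N *\<^sub>v v)"
    using N v by (intro cvec_norm_mult_mat_vec_le[OF M]) auto
  also have "\<dots> \<le> mat_opnorm M * (mat_opnorm N * cvec_norm v)"
    by (intro mult_left_mono cvec_norm_mult_mat_vec_le[OF N v] mat_opnorm_ge_0[OF M])
  finally show "cvec_norm ((M * N) *\<^sub>v v) \<le> mat_opnorm M * mat_opnorm N * cvec_norm v"
    by (simp add: algebra_simps)
qed

lemma mat_opnorm_eq_0D:
  assumes M: "M \<in> carrier_mat n n" and z: "mat_opnorm M = 0"
  shows "M = 0 \<cdot>\<^sub>m M"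
proof -
  have "M $$ (i, j) = 0" if ij: "i < n" "j < n" for i j
  proof -
    have "cvec_norm (M *\<^sub>v unit_vec n j) \<le> 0"
      using cvec_norm_mult_mat_vec_le[OF M, of "unit_vec n j"] z by simp
    then have "cvec_norm (M *\<^sub>v unit_vec n j) = 0" using cvec_norm_ge_0 by (rule order_antisym)
    moreover have "M *\<^sub>v unit_vec n j \<in> carrier_vec n" using M by simp
    ultimately have "M *\<^sub>v unit_vec n j = 0\<^sub>v n" using cvec_norm_eq_0D by blast
    moreover have "(M *\<^sub>v unit_vec n j) $ i = M $$ (i, j)"
      using M ij by simp
    ultimately show ?thesis using ij by simp
  qed
  then show ?thesis using M by (intro eq_matI) auto
qed

lemma mat_minus_eq_swap:
  fixes X Y Z :: "complex mat"
  assumes "X \<in> carrier_mat n n" "Y \<in> carrier_mat n n" "Z \<in> carrier_mat n n" "X - Y = Z"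
  shows "Y = X - Z"
  using assms by (intro eq_matI) auto

lemma mat_quasi_inverse:
  assumes M: "M \<in> carrier_mat n n" and lt: "mat_opnorm M < 1"
  shows "\<exists>Q\<in>carrier_mat n n. M + Q = M * Q \<and> M + Q = Q * M"
proof -
  let ?N = "1\<^sub>m n - M"
  have N: "?N \<in> carrier_mat n n" using M by (rule minus_carrier_mat)
  have "Determinant.det ?N \<noteq> 0"
  proof
    assume "Determinant.det ?N = 0"
    then obtain v where v: "v \<in> carrier_vec n" "v \<noteq> 0\<^sub>v n" "?N *\<^sub>v v = 0\<^sub>v n"
      using det_0_iff_vec_prod_zero[OF N] by blast
    have "v - M *\<^sub>v v = 0\<^sub>v n"
      using v(1,3) M minus_mult_distrib_mat_vec[of "1\<^sub>m n" n n M v] by simp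
    then have "v $ i = (M *\<^sub>v v) $ i" if "i < n" for i
      using that v(1) M by (metis carrier_matD(1) dim_mult_mat_vec eq_iff_diff_eq_0 index_minus_vec(1) index_zero_vec(1))
    then have "v = M *\<^sub>v v" using v(1) M by (intro eq_vecI) auto
    then have "cvec_norm v \<le> mat_opnorm M * cvec_norm v"
      using cvec_norm_mult_mat_vec_le[OF M v(1)] by simp
    moreover have "cvec_norm v > 0"
      using cvec_norm_eq_0D[OF v(1)] v(2) cvec_norm_ge_0[of v] by linarith
    ultimately show False using lt by simp
  qed
  then obtain B where B: "B \<in> carrier_mat n n" "?N * B = 1\<^sub>m n" "B * ?N = 1\<^sub>m n"
    using det_non_zero_imp_unit[OF N, of "()"] unfolding Units_def ring_mat_def by auto
  have "B - M * B = 1\<^sub>m n" "B - B * M = 1\<^sub>m n"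
    using B M minus_mult_distrib_mat[of "1\<^sub>m n" n n M B n] mult_minus_distrib_mat[of B n n "1\<^sub>m n" n M]
    by simp_all
  then have 1: "M * B = B - 1\<^sub>m n" and 2: "B * M = B - 1\<^sub>m n"
    using B M by (auto intro!: mat_minus_eq_swap[where n = n])
  have "M * (1\<^sub>m n - B) = M - (B - 1\<^sub>m n)" "(1\<^sub>m n - B) * M = M - (B - 1\<^sub>m n)"
    using 1 2 M B mult_minus_distrib_mat[of M n n "1\<^sub>m n" n B] minus_mult_distrib_mat[of "1\<^sub>m n" n n B M n]
    by simp_all
  moreover have "M + (1\<^sub>m n - B) = M - (B - 1\<^sub>m n)"
    using M B by (intro eq_matI) auto
  ultimately show ?thesis using B by (intro bexI[of _ "1\<^sub>m n - B"]) auto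
qed

lemma normed_star_algebra_matrix: "normed_star_algebra (matrix_algebra r)"
proof
  let ?M = "matrix_algebra r"
  show "carrier ?M \<noteq> {}"
    unfolding matrix_algebra_def by (auto intro: zero_carrier_mat)
  fix x y z assume "x \<in> carrier ?M" "y \<in> carrier ?M"
    "z \<in> carrier ?M"
  then have x: "x \<in> carrier_mat r r" and y: "y \<in> carrier_mat r r" and z: "z \<in> carrier_mat r r"
    by (simp_all add: matrix_algebra_def)
  note [simp] = matrix_algebra_def
  show "cs_add ?M x y \<in> carrier ?M"
    "cs_mult ?M x y \<in> carrier ?M"
    "cs_star ?M x \<in> carrier ?M"
    using x y by simp_all
  show "cs_scale ?M c x \<in> carrier ?M" for c
    using x by simp
  show "cs_add ?M (cs_add ?M x y) z =
      cs_add ?M x (cs_add ?M y z)"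
    "cs_add ?M x y = cs_add ?M y x"
    "cs_add ?M x (cs_scale ?M 0 y) = x"
    "cs_scale ?M 1 x = x"
    using x y z by (auto intro!: eq_matI)
  show "cs_scale ?M c (cs_scale ?M d x) = cs_scale ?M (c * d) x"
    "cs_scale ?M (c + d) x =
      cs_add ?M (cs_scale ?M c x) (cs_scale ?M d x)" for c d
    using x by (auto intro!: eq_matI simp: algebra_simps)
  show "cs_scale ?M c (cs_add ?M x y) =
      cs_add ?M (cs_scale ?M c x) (cs_scale ?M c y)" for c
    using x y by (auto intro!: eq_matI simp: algebra_simps)
  show "cs_mult ?M (cs_mult ?M x y) z =
      cs_mult ?M x (cs_mult ?M y z)"
    using assoc_mult_mat[OF x y z] by simp
  show "cs_mult ?M x (cs_add ?M y z) =
      cs_add ?M (cs_mult ?M x y) (cs_mult ?M x z)"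
    using mult_add_distrib_mat[OF x y z] by simp
  show "cs_mult ?M (cs_add ?M x y) z =
      cs_add ?M (cs_mult ?M x z) (cs_mult ?M y z)"
    using add_mult_distrib_mat[OF x y z] by simp
  show "cs_mult ?M (cs_scale ?M c x) y =
      cs_scale ?M c (cs_mult ?M x y)" for c
    using mult_smult_assoc_mat[OF x y] by simp
  show "cs_mult ?M x (cs_scale ?M c y) =
      cs_scale ?M c (cs_mult ?M x y)" for c
    using mult_smult_distrib[OF x y] by simp
  show "cs_star ?M (cs_add ?M x y) =
      cs_add ?M (cs_star ?M x) (cs_star ?M y)"
    using x y by (auto simp: mat_adjoint_eq[of _ r] intro!: eq_matI)
  show "cs_star ?M (cs_scale ?M c x) =
      cs_scale ?M (cnj c) (cs_star ?M x)" for c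
    using x by (auto simp: mat_adjoint_eq[of _ r] intro!: eq_matI)
  show "0 \<le> cs_norm ?M x"
    using mat_opnorm_ge_0[OF x] by simp
  show "x = cs_scale ?M 0 x" if "cs_norm ?M x = 0"
    using mat_opnorm_eq_0D[OF x] that by simp
  show "cs_norm ?M (cs_add ?M x y) \<le>
      cs_norm ?M x + cs_norm ?M y"
    using mat_opnorm_add_le[OF x y] by simp
  show "cs_norm ?M (cs_scale ?M c x) = cmod c * cs_norm ?M x" for c
  proof (cases "c = 0")
    case True
    then show ?thesis
      using mat_opnorm_smult_le[OF x, of 0] mat_opnorm_ge_0[of "0 \<cdot>\<^sub>m x" r r] x by simp
  next
    case False
    have "mat_opnorm x = mat_opnorm ((1 / c) \<cdot>\<^sub>m (c \<cdot>\<^sub>m x))"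
      using False by (auto intro!: arg_cong[where f = mat_opnorm])
    also have "\<dots> \<le> cmod (1 / c) * mat_opnorm (c \<cdot>\<^sub>m x)"
      by (rule mat_opnorm_smult_le[of _ r]) (use x in simp)
    finally have "cmod c * mat_opnorm x \<le> mat_opnorm (c \<cdot>\<^sub>m x)"
      using False by (simp add: norm_divide field_simps)
    then show ?thesis using mat_opnorm_smult_le[OF x, of c] by simp
  qed
  show "cs_norm ?M (cs_mult ?M x y) \<le>
      cs_norm ?M x * cs_norm ?M y"
    using mat_opnorm_mult_le[OF x y] by simp
  show "cs_norm ?M (cs_star ?M x) \<le> cs_norm ?M x"
    using mat_opnorm_adjoint_le[OF x] by simp
  show "\<exists>q\<in>carrier ?M. cs_add ?M x q = cs_mult ?M x q \<and>
      cs_add ?M x q = cs_mult ?M q x"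
    if "cs_norm ?M x < 1"
    using mat_quasi_inverse[OF x] that by simp
qed

section \<open>Finite-dimensional algebras\<close>

lemma findim_carrier:
  "x \<in> carrier (findim ns) \<longleftrightarrow>
    x \<in> extensional {..<length ns} \<and> (\<forall>i<length ns. x i \<in> carrier (matrix_algebra (ns ! i)))"
  by (auto simp: findim_def Let_def PiE_iff)

lemma findim_apply [simp]:
  assumes "i < length ns"
  shows "cs_add (findim ns) x y i = cs_add (matrix_algebra (ns ! i)) (x i) (y i)"
    and "cs_mult (findim ns) x y i = cs_mult (matrix_algebra (ns ! i)) (x i) (y i)"
    and "cs_scale (findim ns) c x i = cs_scale (matrix_algebra (ns ! i)) c (x i)"
    and "cs_star (findim ns) x i = cs_star (matrix_algebra (ns ! i)) (x i)"
  using assms by (simp_all add: findim_def Let_def)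

lemma findim_extensional [simp]:
  "cs_add (findim ns) x y \<in> extensional {..<length ns}"
  "cs_mult (findim ns) x y \<in> extensional {..<length ns}"
  "cs_scale (findim ns) c x \<in> extensional {..<length ns}"
  "cs_star (findim ns) x \<in> extensional {..<length ns}"
  by (simp_all add: findim_def Let_def)

lemma findim_norm_le_iff:
  "cs_norm (findim ns) x \<le> b \<longleftrightarrow> 0 \<le> b \<and> (\<forall>i<length ns. cs_norm (matrix_algebra (ns ! i)) (x i) \<le> b)"
  by (auto simp: findim_def Let_def)

lemma findim_eqI:
  "x \<in> extensional {..<length ns} \<Longrightarrow> y \<in> extensional {..<length ns} \<Longrightarrow>
    (\<And>i. i < length ns \<Longrightarrow> x i = y i) \<Longrightarrow> x = y"
  by (rule extensionalityI) auto

lemma normed_star_algebra_findim: "normed_star_algebra (findim ns)"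
proof
  let ?F = "findim ns" and ?M = "\<lambda>i. matrix_algebra (ns ! i)"
  interpret M: normed_star_algebra "matrix_algebra (ns ! i)" for i
    by (rule normed_star_algebra_matrix)
  have "(\<lambda>i\<in>{..<length ns}. cs_zero (?M i)) \<in> carrier ?F"
    by (simp add: findim_carrier)
  then show "carrier ?F \<noteq> {}" by blast
  fix x y z assume xyz: "x \<in> carrier ?F" "y \<in> carrier ?F" "z \<in> carrier ?F"
  have [simp]: "x \<in> extensional {..<length ns}" using xyz by (simp add: findim_carrier)
  have [simp]: "x i \<in> carrier (?M i)" "y i \<in> carrier (?M i)" "z i \<in> carrier (?M i)"
    if "i < length ns" for i
    using xyz that by (simp_all add: findim_carrier)
  have up: "cs_norm (?M i) (w i) \<le> cs_norm ?F w" if "i < length ns" for i w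
    using findim_norm_le_iff[of ns w "cs_norm ?F w"] that by simp
  have nn: "0 \<le> cs_norm ?F w" for w
    using findim_norm_le_iff[of ns w "cs_norm ?F w"] by simp
  show "cs_add ?F x y \<in> carrier ?F" "cs_mult ?F x y \<in> carrier ?F" "cs_star ?F x \<in> carrier ?F"
    by (simp_all add: findim_carrier)
  show "cs_scale ?F c x \<in> carrier ?F" for c
    by (simp add: findim_carrier)
  show "cs_add ?F (cs_add ?F x y) z = cs_add ?F x (cs_add ?F y z)"
    by (rule findim_eqI[where ns = ns]) (simp_all add: M.add_assoc)
  show "cs_add ?F x y = cs_add ?F y x"
    by (rule findim_eqI[where ns = ns]) (simp_all add: M.add_comm)
  show "cs_add ?F x (cs_scale ?F 0 y) = x"
    by (rule findim_eqI[where ns = ns]) simp_all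
  show "cs_scale ?F 1 x = x"
    by (rule findim_eqI[where ns = ns]) simp_all
  show scale2: "cs_scale ?F c (cs_scale ?F d x) = cs_scale ?F (c * d) x" for c d
    by (rule findim_eqI[where ns = ns]) (simp_all add: M.scale_scale)
  show "cs_scale ?F (c + d) x = cs_add ?F (cs_scale ?F c x) (cs_scale ?F d x)" for c d
    by (rule findim_eqI[where ns = ns]) (simp_all add: M.scale_add_left)
  show "cs_scale ?F c (cs_add ?F x y) = cs_add ?F (cs_scale ?F c x) (cs_scale ?F c y)" for c
    by (rule findim_eqI[where ns = ns]) (simp_all add: M.scale_add_right)
  show "cs_mult ?F (cs_mult ?F x y) z = cs_mult ?F x (cs_mult ?F y z)"
    by (rule findim_eqI[where ns = ns]) (simp_all add: M.mult_assoc)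
  show "cs_mult ?F x (cs_add ?F y z) = cs_add ?F (cs_mult ?F x y) (cs_mult ?F x z)"
    by (rule findim_eqI[where ns = ns]) (simp_all add: M.distrib_left)
  show "cs_mult ?F (cs_add ?F x y) z = cs_add ?F (cs_mult ?F x z) (cs_mult ?F y z)"
    by (rule findim_eqI[where ns = ns]) (simp_all add: M.distrib_right)
  show "cs_mult ?F (cs_scale ?F c x) y = cs_scale ?F c (cs_mult ?F x y)" for c
    by (rule findim_eqI[where ns = ns]) (simp_all add: M.mult_scale_left)
  show "cs_mult ?F x (cs_scale ?F c y) = cs_scale ?F c (cs_mult ?F x y)" for c
    by (rule findim_eqI[where ns = ns]) (simp_all add: M.mult_scale_right)
  show "cs_star ?F (cs_add ?F x y) = cs_add ?F (cs_star ?F x) (cs_star ?F y)"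
    by (rule findim_eqI[where ns = ns]) (simp_all add: M.star_add)
  show "cs_star ?F (cs_scale ?F c x) = cs_scale ?F (cnj c) (cs_star ?F x)" for c
    by (rule findim_eqI[where ns = ns]) (simp_all add: M.star_scale)
  show "0 \<le> cs_norm ?F x" by (rule nn)
  show "x = cs_scale ?F 0 x" if z: "cs_norm ?F x = 0"
  proof (rule findim_eqI[where ns = ns])
    fix i assume i: "i < length ns"
    then have "cs_norm (?M i) (x i) = 0" using up[OF i, of x] z by (intro order_antisym) simp_all
    then show "x i = cs_scale ?F 0 x i" using i M.norm_eq_0_iff[of "x i" i] by simp
  qed simp_all
  show "cs_norm ?F (cs_add ?F x y) \<le> cs_norm ?F x + cs_norm ?F y"
    unfolding findim_norm_le_iff
  proof (intro conjI allI impI)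
    fix i assume i: "i < length ns"
    have "cs_norm (?M i) (cs_add ?F x y i) \<le> cs_norm (?M i) (x i) + cs_norm (?M i) (y i)"
      using i by (simp add: M.norm_triangle)
    also have "\<dots> \<le> cs_norm ?F x + cs_norm ?F y" by (intro add_mono up i)
    finally show "cs_norm (?M i) (cs_add ?F x y i) \<le> cs_norm ?F x + cs_norm ?F y" .
  qed (simp add: nn)
  have sc: "cs_norm ?F (cs_scale ?F c w) \<le> cmod c * cs_norm ?F w" if "w \<in> carrier ?F" for c w
    unfolding findim_norm_le_iff using that
    by (auto simp: M.norm_scale nn findim_carrier intro!: mult_left_mono up)
  show "cs_norm ?F (cs_scale ?F c x) = cmod c * cs_norm ?F x" for c
  proof (cases "c = 0")
    case True
    then show ?thesis using sc[OF xyz(1), of 0] nn[of "cs_scale ?F 0 x"] by simp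
  next
    case False
    have "cs_norm ?F x = cs_norm ?F (cs_scale ?F (1 / c) (cs_scale ?F c x))"
      using False scale2[of "1/c" c] \<open>cs_scale ?F 1 x = x\<close> by simp
    also have "\<dots> \<le> cmod (1 / c) * cs_norm ?F (cs_scale ?F c x)"
      by (rule sc) (simp add: findim_carrier)
    finally have "cmod c * cs_norm ?F x \<le> cs_norm ?F (cs_scale ?F c x)"
      using False by (simp add: norm_divide field_simps)
    then show ?thesis using sc[OF xyz(1), of c] by simp
  qed
  show "cs_norm ?F (cs_mult ?F x y) \<le> cs_norm ?F x * cs_norm ?F y"
    unfolding findim_norm_le_iff
  proof (intro conjI allI impI)
    fix i assume i: "i < length ns"
    have "cs_norm (?M i) (cs_mult ?F x y i) \<le> cs_norm (?M i) (x i) * cs_norm (?M i) (y i)"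
      using i by (simp add: M.norm_mult_le)
    also have "\<dots> \<le> cs_norm ?F x * cs_norm ?F y" using i by (intro mult_mono up nn) simp_all
    finally show "cs_norm (?M i) (cs_mult ?F x y i) \<le> cs_norm ?F x * cs_norm ?F y" .
  qed (simp add: nn)
  show "cs_norm ?F (cs_star ?F x) \<le> cs_norm ?F x"
    unfolding findim_norm_le_iff
  proof (intro conjI allI impI)
    fix i assume i: "i < length ns"
    have "cs_norm (?M i) (cs_star ?F x i) \<le> cs_norm (?M i) (x i)"
      using i by (simp add: M.norm_star)
    also have "\<dots> \<le> cs_norm ?F x" by (intro up i)
    finally show "cs_norm (?M i) (cs_star ?F x i) \<le> cs_norm ?F x" .
  qed (simp add: nn)
  show "\<exists>q\<in>carrier ?F. cs_add ?F x q = cs_mult ?F x q \<and> cs_add ?F x q = cs_mult ?F q x"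
    if n: "cs_norm ?F x < 1"
  proof -
    have "\<forall>i. i < length ns \<longrightarrow> (\<exists>q. q \<in> carrier (?M i) \<and> cs_add (?M i) (x i) q = cs_mult (?M i) (x i) q \<and>
        cs_add (?M i) (x i) q = cs_mult (?M i) q (x i))"
    proof (intro allI impI)
      fix i assume i: "i < length ns"
      then show "\<exists>q. q \<in> carrier (?M i) \<and> cs_add (?M i) (x i) q = cs_mult (?M i) (x i) q \<and>
        cs_add (?M i) (x i) q = cs_mult (?M i) q (x i)"
        using M.quasi_inverse_exists[of "x i" i] le_less_trans[OF up[OF i] n] by auto
    qed
    then obtain q where q: "\<And>i. i < length ns \<Longrightarrow> q i \<in> carrier (?M i)"
      "\<And>i. i < length ns \<Longrightarrow> cs_add (?M i) (x i) (q i) = cs_mult (?M i) (x i) (q i)"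
      "\<And>i. i < length ns \<Longrightarrow> cs_add (?M i) (x i) (q i) = cs_mult (?M i) (q i) (x i)"
      by metis
    show ?thesis
    proof (intro bexI conjI)
      show "restrict q {..<length ns} \<in> carrier ?F" using q by (simp add: findim_carrier)
      show "cs_add ?F x (restrict q {..<length ns}) = cs_mult ?F x (restrict q {..<length ns})"
        by (rule findim_eqI[where ns = ns]) (simp_all add: q(2))
      show "cs_add ?F x (restrict q {..<length ns}) = cs_mult ?F (restrict q {..<length ns}) x"
        by (rule findim_eqI[where ns = ns]) (simp_all add: q(3))
    qed
  qed
qed

lemma mat_trace_commute:
  fixes X Y :: "complex mat"
  assumes "X \<in> carrier_mat n n" "Y \<in> carrier_mat n n"
  shows "(\<Sum>i<n. (X * Y) $$ (i, i)) = (\<Sum>i<n. (Y * X) $$ (i, i))"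
proof -
  have "(\<Sum>i<n. (X * Y) $$ (i, i)) = (\<Sum>i<n. \<Sum>j<n. X $$ (i, j) * Y $$ (j, i))"
    using assms by (simp add: scalar_prod_def lessThan_atLeast0)
  also have "\<dots> = (\<Sum>j<n. \<Sum>i<n. Y $$ (j, i) * X $$ (i, j))"
    by (subst sum.swap) (simp add: mult.commute)
  also have "\<dots> = (\<Sum>i<n. (Y * X) $$ (i, i))"
    using assms by (simp add: scalar_prod_def lessThan_atLeast0)
  finally show ?thesis .
qed

lemma cmod_trace_le:
  fixes H :: "complex mat"
  assumes H: "H \<in> carrier_mat n n" and ev: "\<And>k. eigenvalue H k \<Longrightarrow> cmod k \<le> 1"
  shows "cmod (\<Sum>i<n. H $$ (i, i)) \<le> n"
proof -
  obtain as where "char_poly H = (\<Prod>a\<leftarrow>as. [:- a, 1:])"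
    using char_poly_factorized[OF H] by blast
  then obtain B where B: "B \<in> carrier_mat n n" "upper_triangular B" "similar_mat H B"
    using schur_decomposition_exists[OF H] by blast
  obtain n' P Q where PQ: "{H, B, P, Q} \<subseteq> carrier_mat n' n'" "Q * P = 1\<^sub>m n'" "H = P * B * Q"
    using similar_matD[OF B(3)] by blast
  then have n: "n' = n" using H by auto
  then have c: "P \<in> carrier_mat n n" "Q \<in> carrier_mat n n" using PQ by auto
  have "H = P * (B * Q)" using PQ c B by (simp add: assoc_mult_mat[of _ n n])
  then have "(\<Sum>i<n. H $$ (i, i)) = (\<Sum>i<n. ((B * Q) * P) $$ (i, i))"
    using mat_trace_commute[of P n "B * Q"] c B by simp
  also have "(B * Q) * P = B"
    using PQ c B n by (simp add: assoc_mult_mat[of _ n n _ n _ n])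
  finally have tr: "(\<Sum>i<n. H $$ (i, i)) = (\<Sum>i<n. B $$ (i, i))" .
  have "cmod (B $$ (i, i)) \<le> 1" if i: "i < n" for i
  proof (rule ev)
    have "char_poly H = (\<Prod>a\<leftarrow>diag_mat B. [:- a, 1:])"
      using char_poly_similar[OF B(3)] char_poly_upper_triangular[OF B(1,2)] by simp
    moreover have "B $$ (i, i) \<in> set (diag_mat B)" using i B(1) by (auto simp: diag_mat_def)
    ultimately have "poly (char_poly H) (B $$ (i, i)) = 0"
      by (auto simp: poly_prod_list prod_list_zero_iff o_def image_iff)
    then show "eigenvalue H (B $$ (i, i))" using eigenvalue_root_char_poly[OF H] by simp
  qed
  then have "(\<Sum>i<n. cmod (B $$ (i, i))) \<le> (\<Sum>i<n. 1)" by (intro sum_mono) auto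
  then show ?thesis unfolding tr using norm_sum[of "\<lambda>i. B $$ (i, i)" "{..<n}"] by simp
qed

lemma star_hom_eigenvalue_lt_1:
  assumes A: "normed_star_algebra A" and r: "star_hom A (findim ns) r"
    and h: "h \<in> carrier A" "cs_norm A h < 1" and i: "i < length ns" and ev: "eigenvalue (r h i) k"
  shows "cmod k < 1"
proof (rule ccontr)
  assume "\<not> cmod k < 1"
  then have k: "cmod k \<ge> 1" "k \<noteq> 0" by auto
  interpret normed_star_algebra A by (rule A)
  let ?n = "ns ! i"
  have c: "r x i \<in> carrier_mat ?n ?n" if "x \<in> carrier A" for x
    using star_hom_closed[OF r that] i by (simp add: findim_carrier matrix_algebra_def)
  have "cs_norm A ((1 / k) \<cdot>\<^sub>A h) = cs_norm A h / cmod k"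
    using h by (simp add: norm_scale norm_divide)
  also have "\<dots> \<le> cs_norm A h / 1" using h k by (intro divide_left_mono) auto
  finally have "cs_norm A ((1 / k) \<cdot>\<^sub>A h) < 1" using h by simp
  then obtain q where q: "q \<in> carrier A" "(1 / k) \<cdot>\<^sub>A h +\<^sub>A q = q *\<^sub>A ((1 / k) \<cdot>\<^sub>A h)"
    using quasi_inverse_exists[of "(1 / k) \<cdot>\<^sub>A h"] h by auto
  define H where "H = r h i"
  define Q where "Q = r q i"
  have H: "H \<in> carrier_mat ?n ?n" and Q: "Q \<in> carrier_mat ?n ?n"
    using c h q by (auto simp: H_def Q_def)
  have "r ((1 / k) \<cdot>\<^sub>A h +\<^sub>A q) i = r (q *\<^sub>A ((1 / k) \<cdot>\<^sub>A h)) i" using q by simp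
  then have eq: "(1 / k) \<cdot>\<^sub>m H + Q = Q * ((1 / k) \<cdot>\<^sub>m H)"
    using i h q(1) by (simp add: star_hom_add[OF r] star_hom_mult[OF r] star_hom_scale[OF r]
      H_def Q_def matrix_algebra_def)
  obtain v where v: "v \<in> carrier_vec ?n" "v \<noteq> 0\<^sub>v ?n" "H *\<^sub>v v = k \<cdot>\<^sub>v v"
    using ev H unfolding eigenvalue_def eigenvector_def H_def[symmetric] by auto
  have kH: "((1 / k) \<cdot>\<^sub>m H) *\<^sub>v v = v"
  proof -
    have "((1 / k) \<cdot>\<^sub>m H) *\<^sub>v v = (1 / k) \<cdot>\<^sub>v (H *\<^sub>v v)"
      using H v(1) by (intro eq_vecI) (auto simp: scalar_prod_def sum_distrib_left mult.assoc)
    then show ?thesis using v k by (auto intro!: eq_vecI)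
  qed
  have kHc: "(1 / k) \<cdot>\<^sub>m H \<in> carrier_mat ?n ?n" using H by simp
  have "v + Q *\<^sub>v v = ((1 / k) \<cdot>\<^sub>m H + Q) *\<^sub>v v"
    using add_mult_distrib_mat_vec[OF kHc Q v(1)] kH by simp
  also have "\<dots> = Q *\<^sub>v (((1 / k) \<cdot>\<^sub>m H) *\<^sub>v v)"
    unfolding eq by (rule assoc_mult_mat_vec[OF Q kHc v(1)])
  finally have eq': "v + Q *\<^sub>v v = Q *\<^sub>v v" unfolding kH .
  have "v $ j = 0" if "j < ?n" for j
    using arg_cong[OF eq', of "\<lambda>w. w $ j"] that v(1) Q by simp
  then have "v = 0\<^sub>v ?n" using v(1) by (intro eq_vecI) auto
  then show False using v by simp
qed

text \<open>
  The bound is far from the optimal constant \<open>1\<close>; only its independence of \<open>r\<close> matters.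
\<close>

definition findim_hom_bound :: "nat list \<Rightarrow> real" where
  "findim_hom_bound ns = 2 * (\<Sum>i<length ns. real (ns ! i) ^ 3)"

lemma star_hom_findim_bounded:
  assumes A: "normed_star_algebra A" and r: "star_hom A (findim ns) r" and a: "a \<in> carrier A"
  shows "cs_norm (findim ns) (r a) \<le> findim_hom_bound ns * cs_norm A a"
proof -
  interpret normed_star_algebra A by (rule A)
  interpret F: normed_star_algebra "findim ns" by (rule normed_star_algebra_findim)
  let ?C = "\<Sum>i<length ns. real (ns ! i) ^ 3"
  have unit: "cs_norm (findim ns) (r b) \<le> ?C" if b: "b \<in> carrier A" "cs_norm A b < 1" for b
    unfolding findim_norm_le_iff
  proof (intro conjI allI impI)
    fix i assume i: "i < length ns"
    let ?n = "ns ! i"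
    define T where "T = r b i"
    have T: "T \<in> carrier_mat ?n ?n"
      using star_hom_closed[OF r b(1)] i by (simp add: findim_carrier matrix_algebra_def T_def)
    let ?h = "cs_mult A (cs_star A b) b"
    have "cs_norm A ?h \<le> cs_norm A b * cs_norm A b"
      using b norm_mult_le[of "cs_star A b" b] norm_star[of b]
      by (meson mult_right_mono norm_ge_0 order_trans star_closed)
    also have "\<dots> < 1" using b mult_strict_mono[of "cs_norm A b" 1 "cs_norm A b" 1] by simp
    finally have hn: "cs_norm A ?h < 1" .
    have H: "r ?h i = mat_adjoint T * T"
      using i b by (simp add: star_hom_mult[OF r] star_hom_star[OF r] matrix_algebra_def T_def)
    have tr: "cmod (\<Sum>j<?n. (mat_adjoint T * T) $$ (j, j)) \<le> ?n"
    proof (rule cmod_trace_le)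
      show "mat_adjoint T * T \<in> carrier_mat ?n ?n"
        using mat_adjoint_closed[OF T] T by (rule mult_carrier_mat)
      show "cmod k \<le> 1" if "eigenvalue (mat_adjoint T * T) k" for k
        using star_hom_eigenvalue_lt_1[OF A r _ hn i, of k] that b H by simp
    qed
    have d: "(mat_adjoint T * T) $$ (j, j) = of_real (\<Sum>l<?n. (cmod (T $$ (l, j)))\<^sup>2)" if "j < ?n" for j
      using that T by (simp add: mat_adjoint_eq[OF T] scalar_prod_def lessThan_atLeast0
        complex_norm_square mult.commute del: of_real_power)
    have "(\<Sum>j<?n. (mat_adjoint T * T) $$ (j, j)) = of_real (\<Sum>j<?n. \<Sum>l<?n. (cmod (T $$ (l, j)))\<^sup>2)"
      using d by simp
    then have s: "(\<Sum>j<?n. \<Sum>l<?n. (cmod (T $$ (l, j)))\<^sup>2) \<le> ?n"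
      using tr by (simp add: sum_nonneg del: of_real_sum)
    have e: "cmod (T $$ (l, j)) \<le> ?n" if lj: "l < ?n" "j < ?n" for l j
    proof -
      have "(cmod (T $$ (l, j)))\<^sup>2 \<le> (\<Sum>l<?n. (cmod (T $$ (l, j)))\<^sup>2)"
        using lj by (intro member_le_sum) auto
      also have "\<dots> \<le> (\<Sum>j<?n. \<Sum>l<?n. (cmod (T $$ (l, j)))\<^sup>2)"
        using lj by (intro member_le_sum[of j _ "\<lambda>j. \<Sum>l<?n. (cmod (T $$ (l, j)))\<^sup>2"]) (auto intro: sum_nonneg)
      finally have sq: "(cmod (T $$ (l, j)))\<^sup>2 \<le> ?n" using s by linarith
      show ?thesis
      proof (cases "cmod (T $$ (l, j)) \<le> 1")
        case True
        then show ?thesis using lj by linarith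
      next
        case False
        then have "cmod (T $$ (l, j)) * 1 \<le> cmod (T $$ (l, j)) * cmod (T $$ (l, j))"
          by (intro mult_left_mono) auto
        then show ?thesis using sq by (simp add: power2_eq_square)
      qed
    qed
    have "mat_opnorm T \<le> (\<Sum>l<?n. \<Sum>j<?n. cmod (T $$ (l, j)))" by (rule mat_opnorm_le_sum[OF T])
    also have "\<dots> \<le> (\<Sum>l<?n. \<Sum>j<?n. real ?n)" using e by (intro sum_mono) auto
    also have "\<dots> = real ?n ^ 3" by (simp add: power3_eq_cube)
    also have "\<dots> \<le> ?C" using i by (intro member_le_sum[of i _ "\<lambda>i. real (ns ! i) ^ 3"]) auto
    finally show "cs_norm (matrix_algebra (ns ! i)) (r b i) \<le> ?C"
      by (simp add: matrix_algebra_def T_def)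
  qed (simp add: sum_nonneg)
  show ?thesis
  proof (cases "cs_norm A a = 0")
    case True
    then have "a = 0\<^sub>A" using a norm_eq_0_iff by simp
    then have "r a = cs_zero (findim ns)"
      using star_hom_zero[OF A F.normed_star_algebra_axioms r] by simp
    then show ?thesis using True by simp
  next
    case False
    then have pos: "cs_norm A a > 0" using norm_ge_0[OF a] by linarith
    define s where "s = 2 * cs_norm A a"
    have s: "s > 0" using pos by (simp add: s_def)
    have "cs_norm (findim ns) (r (of_real (1 / s) \<cdot>\<^sub>A a)) \<le> ?C"
      by (rule unit) (use a pos in \<open>simp_all add: norm_scale s_def norm_divide\<close>)
    then have "cs_norm (findim ns) (r a) / s \<le> ?C"
      using a s star_hom_closed[OF r a]
      by (simp add: star_hom_scale[OF r] F.norm_scale norm_divide)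
    then show ?thesis using s by (simp add: s_def findim_hom_bound_def field_simps)
  qed
qed

lemma star_hom_findim_dist:
  assumes A: "normed_star_algebra A" and r: "star_hom A (findim ns) r"
    and "a \<in> carrier A" "b \<in> carrier A"
  shows "cs_dist (findim ns) (r a) (r b) \<le> findim_hom_bound ns * cs_dist A a b"
proof -
  interpret normed_star_algebra A by (rule A)
  show ?thesis
    using star_hom_findim_bounded[OF A r, of "cs_add A a (cs_scale A (-1) b)"] assms
    by (simp add: star_hom_dist[OF A r] dist_eq)
qed

text \<open>Bessel's inequality for the normalised family, summed over the coordinate vectors.\<close>

lemma card_orthogonal_le:
  fixes u :: "'v \<Rightarrow> 'e \<Rightarrow> complex"
  assumes E: "finite E" and T: "finite T"
    and nz: "\<And>v. v \<in> T \<Longrightarrow> \<exists>e\<in>E. u v e \<noteq> 0"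
    and orth: "\<And>v w. v \<in> T \<Longrightarrow> w \<in> T \<Longrightarrow> v \<noteq> w \<Longrightarrow> (\<Sum>e\<in>E. u v e * cnj (u w e)) = 0"
  shows "card T \<le> card E"
proof -
  define N where "N v = (\<Sum>e\<in>E. (cmod (u v e))\<^sup>2)" for v
  have N: "N v > 0" if v: "v \<in> T" for v
  proof -
    obtain e where "e \<in> E" "u v e \<noteq> 0" using nz[OF v] by blast
    then show ?thesis unfolding N_def by (intro sum_pos2[OF E, of e]) auto
  qed
  have NN: "(\<Sum>e\<in>E. u v e * cnj (u v e)) = of_real (N v)" for v
    by (simp add: N_def flip: complex_norm_square)
  have bessel: "(\<Sum>v\<in>T. (cmod (u v e0))\<^sup>2 / N v) \<le> 1" if e0: "e0 \<in> E" for e0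
  proof -
    define c where "c v = cnj (u v e0) / of_real (N v)" for v
    define d where "d e = (if e = e0 then 1 else 0 :: complex)" for e
    define g where "g e = (\<Sum>v\<in>T. c v * u v e)" for e
    let ?S = "\<Sum>v\<in>T. (cmod (u v e0))\<^sup>2 / N v"
    have g0: "g e0 = of_real ?S"
      unfolding g_def c_def of_real_sum of_real_divide
      by (rule sum.cong) (simp_all add: complex_norm_square mult.commute del: of_real_power)
    have gg: "(\<Sum>e\<in>E. g e * cnj (g e)) = of_real ?S"
    proof -
      have "(\<Sum>e\<in>E. g e * cnj (g e)) = (\<Sum>e\<in>E. \<Sum>v\<in>T. \<Sum>w\<in>T. c v * cnj (c w) * (u v e * cnj (u w e)))"
        unfolding g_def cnj_sum sum_product by (intro sum.cong refl) (simp add: mult_ac)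
      also have "\<dots> = (\<Sum>v\<in>T. \<Sum>w\<in>T. \<Sum>e\<in>E. c v * cnj (c w) * (u v e * cnj (u w e)))"
        by (subst sum.swap, rule sum.cong[OF refl], rule sum.swap)
      also have "\<dots> = (\<Sum>v\<in>T. \<Sum>w\<in>T. if w = v then c v * cnj (c v) * of_real (N v) else 0)"
      proof (intro sum.cong refl)
        fix v w assume "v \<in> T" "w \<in> T"
        then show "(\<Sum>e\<in>E. c v * cnj (c w) * (u v e * cnj (u w e))) =
            (if w = v then c v * cnj (c v) * of_real (N v) else 0)"
          using orth[of v w] NN[of v] by (auto simp: sum_distrib_left[symmetric])
      qed
      also have "\<dots> = (\<Sum>v\<in>T. c v * cnj (c v) * of_real (N v))"
        using T by simp
      also have "\<dots> = of_real ?S"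
        unfolding c_def of_real_sum of_real_divide
        by (rule sum.cong) (use N in \<open>auto simp: complex_norm_square field_simps simp del: of_real_power\<close>)
      finally show ?thesis .
    qed
    have "of_real (\<Sum>e\<in>E. (cmod (d e - g e))\<^sup>2) = (\<Sum>e\<in>E. (d e - g e) * cnj (d e - g e))"
      by (simp add: complex_norm_square del: of_real_power)
    also have "\<dots> = (\<Sum>e\<in>E. d e * cnj (d e)) - (\<Sum>e\<in>E. d e * cnj (g e)) - (\<Sum>e\<in>E. cnj (d e) * g e)
        + (\<Sum>e\<in>E. g e * cnj (g e))"
      by (simp add: algebra_simps sum.distrib sum_subtractf)
    also have "(\<Sum>e\<in>E. d e * cnj (d e)) = 1"
      using E e0 by (simp add: d_def if_distrib cong: if_cong)
    also have "(\<Sum>e\<in>E. d e * cnj (g e)) = cnj (g e0)"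
    proof -
      have "(\<Sum>e\<in>E. d e * cnj (g e)) = (\<Sum>e\<in>E. if e = e0 then cnj (g e) else 0)"
        by (rule sum.cong) (auto simp: d_def)
      then show ?thesis using E e0 by simp
    qed
    also have "(\<Sum>e\<in>E. cnj (d e) * g e) = g e0"
    proof -
      have "(\<Sum>e\<in>E. cnj (d e) * g e) = (\<Sum>e\<in>E. if e = e0 then g e else 0)"
        by (rule sum.cong) (auto simp: d_def)
      then show ?thesis using E e0 by simp
    qed
    finally have "complex_of_real (\<Sum>e\<in>E. (cmod (d e - g e))\<^sup>2) = of_real (1 - ?S)"
      unfolding g0 gg by simp
    then have "(\<Sum>e\<in>E. (cmod (d e - g e))\<^sup>2) = 1 - ?S" by (simp only: of_real_eq_iff)
    moreover have "0 \<le> (\<Sum>e\<in>E. (cmod (d e - g e))\<^sup>2)" by (intro sum_nonneg) auto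
    ultimately show ?thesis by linarith
  qed
  have "real (card T) = (\<Sum>v\<in>T. N v / N v)"
  proof -
    have "N v / N v = 1" if "v \<in> T" for v using N[OF that] by simp
    then show ?thesis by simp
  qed
  also have "\<dots> = (\<Sum>v\<in>T. \<Sum>e\<in>E. (cmod (u v e))\<^sup>2 / N v)"
    by (simp only: N_def sum_divide_distrib[symmetric])
  also have "\<dots> = (\<Sum>e\<in>E. \<Sum>v\<in>T. (cmod (u v e))\<^sup>2 / N v)" by (rule sum.swap)
  also have "\<dots> \<le> (\<Sum>e\<in>E. 1)" using bessel by (intro sum_mono) auto
  finally show ?thesis by simp
qed

lemma findim_zero_apply:
  assumes "i < length ns"
  shows "cs_zero (findim ns) i = 0\<^sub>m (ns ! i) (ns ! i)"
proof -
  interpret F: normed_star_algebra "findim ns" by (rule normed_star_algebra_findim)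
  have "F.zero i \<in> carrier_mat (ns ! i) (ns ! i)"
    using F.zero_closed assms by (simp add: findim_carrier matrix_algebra_def del: F.zero_closed)
  then have "0 \<cdot>\<^sub>m F.zero i = 0\<^sub>m (ns ! i) (ns ! i)" by (intro eq_matI) auto
  then show ?thesis
    using findim_apply(3)[OF assms, of 0 F.zero] by (simp add: matrix_algebra_def)
qed

lemma findim_orthogonal_card_le:
  assumes T: "finite T" and x: "\<And>v. v \<in> T \<Longrightarrow> x v \<in> carrier (findim ns)"
    and nz: "\<And>v. v \<in> T \<Longrightarrow> x v \<noteq> cs_zero (findim ns)"
    and orth: "\<And>v w. v \<in> T \<Longrightarrow> w \<in> T \<Longrightarrow> v \<noteq> w \<Longrightarrow>
      cs_mult (findim ns) (cs_star (findim ns) (x v)) (x w) = cs_zero (findim ns)"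
  shows "card T \<le> (\<Sum>i<length ns. ns ! i * ns ! i)"
proof -
  interpret F: normed_star_algebra "findim ns" by (rule normed_star_algebra_findim)
  let ?E = "SIGMA i:{..<length ns}. {..<ns ! i} \<times> {..<ns ! i}"
  define u where "u = (\<lambda>v (i, j, l). x v i $$ (j, l))"
  have c: "x v i \<in> carrier_mat (ns ! i) (ns ! i)" if "v \<in> T" "i < length ns" for v i
    using x[OF that(1)] that by (simp add: findim_carrier matrix_algebra_def)
  have "card T \<le> card ?E"
  proof (rule card_orthogonal_le[where u = u])
    fix v assume v: "v \<in> T"
    show "\<exists>e\<in>?E. u v e \<noteq> 0"
    proof (rule ccontr)
      assume "\<not> (\<exists>e\<in>?E. u v e \<noteq> 0)"
      then have *: "x v i $$ (j, l) = 0" if "i < length ns" "j < ns ! i" "l < ns ! i" for i j l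
        using that by (force simp: u_def)
      have "x v = cs_zero (findim ns)"
      proof (rule findim_eqI[where ns = ns])
        show "x v \<in> extensional {..<length ns}" using x[OF v] by (simp add: findim_carrier)
        show "F.zero \<in> extensional {..<length ns}" using F.zero_closed findim_carrier by blast
        fix i assume i: "i < length ns"
        show "x v i = F.zero i"
          using c[OF v i] * i by (auto simp: findim_zero_apply intro!: eq_matI)
      qed
      then show False using nz v by blast
    qed
    fix w assume w: "w \<in> T" "v \<noteq> w"
    have "(\<Sum>j<ns ! i. x v i $$ (j, l) * cnj (x w i $$ (j, l))) = 0" if "i < length ns" "l < ns ! i" for i l
    proof -
      have "cs_mult (findim ns) (cs_star (findim ns) (x w)) (x v) i $$ (l, l) = 0"
        using orth[OF w(1) v] w that by (simp add: findim_zero_apply)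
      moreover have "cs_mult (findim ns) (cs_star (findim ns) (x w)) (x v) i $$ (l, l) =
          (\<Sum>j<ns ! i. cnj (x w i $$ (j, l)) * x v i $$ (j, l))"
        using that c[OF v that(1)] c[OF w(1) that(1)]
        by (simp add: matrix_algebra_def mat_adjoint_eq[of "x w i" "ns ! i"] scalar_prod_def lessThan_atLeast0)
      ultimately show ?thesis by (simp add: mult.commute)
    qed
    then have z: "(\<Sum>j<ns ! i. \<Sum>l<ns ! i. x v i $$ (j, l) * cnj (x w i $$ (j, l))) = 0" if "i < length ns" for i
      using that by (subst sum.swap) simp
    have "(\<Sum>e\<in>?E. u v e * cnj (u w e)) =
        (\<Sum>i<length ns. \<Sum>(j, l)\<in>{..<ns ! i} \<times> {..<ns ! i}. x v i $$ (j, l) * cnj (x w i $$ (j, l)))"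
      by (subst sum.Sigma) (auto simp: u_def split_def intro!: sum.cong)
    also have "\<dots> = (\<Sum>i<length ns. \<Sum>j<ns ! i. \<Sum>l<ns ! i. x v i $$ (j, l) * cnj (x w i $$ (j, l)))"
      by (simp only: sum.cartesian_product)
    also have "\<dots> = 0" using z by simp
    finally show "(\<Sum>e\<in>?E. u v e * cnj (u w e)) = 0" .
  qed (use T in auto)
  also have "card ?E = (\<Sum>i<length ns. ns ! i * ns ! i)"
    by (simp add: card_SigmaI card_cartesian_product)
  finally show ?thesis .
qed

lemma findim_unit_exists:
  "\<exists>e\<in>carrier (findim ns). \<forall>x\<in>carrier (findim ns). cs_mult (findim ns) e x = x"
proof (intro bexI ballI)
  let ?e = "\<lambda>i\<in>{..<length ns}. 1\<^sub>m (ns ! i) :: complex mat"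
  show "?e \<in> carrier (findim ns)" by (simp add: findim_carrier matrix_algebra_def)
  fix x assume x: "x \<in> carrier (findim ns)"
  have "1\<^sub>m (ns ! i) * x i = x i" if "i < length ns" for i
    by (rule left_mult_one_mat[of _ _ "ns ! i"]) (use x that in \<open>simp add: findim_carrier matrix_algebra_def\<close>)
  then show "cs_mult (findim ns) ?e x = x"
    by (intro findim_eqI[where ns = ns]) (use x in \<open>simp_all add: findim_carrier matrix_algebra_def\<close>)
qed

section \<open>Cubes\<close>

lemma compact_cube: "compact (cube k)"
proof -
  have "x \<in> cube k \<longleftrightarrow> (\<forall>i. x i \<in> (if i < k then {0..1} else {0}))" for x
    unfolding cube_def mem_Collect_eq by (metis atLeastAtMost_iff not_le singleton_iff)
  then have "cube k = PiE UNIV (\<lambda>i. if i < k then {0..1} else {0})"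
    by (auto simp: PiE_iff)
  moreover have "compactin (product_topology (\<lambda>i. euclidean) UNIV) (PiE UNIV (\<lambda>i::nat. if i < k then {0..1::real} else {0}))"
    by (simp add: compactin_PiE)
  ultimately show ?thesis by (simp add: euclidean_product_topology)
qed

lemma cube_nonempty: "cube k \<noteq> {}"
  by (auto simp: cube_def intro!: exI[of _ "\<lambda>_. 0"])

lemma continuous_on_coordinate: "continuous_on S (\<lambda>x. x i :: real)"
  by (rule continuous_on_subset[OF continuous_on_product_coordinates]) simp

lemma closed_cube: "closed (cube k)"
  using compact_cube by (rule compact_imp_closed)

lemma cube_boundary_subset: "cube_boundary k \<subseteq> cube k"
  by (auto simp: cube_boundary_def)

lemma closed_cube_boundary: "closed (cube_boundary k)"
proof -
  have "cube_boundary k = cube k \<inter> (\<Union>i<k. {x. x i = 0} \<union> {x. x i = 1})"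
    by (auto simp: cube_boundary_def)
  moreover have "closed {x :: nat \<Rightarrow> real. x i = c}" for i c
    by (intro closed_Collect_eq continuous_on_coordinate continuous_on_const)
  ultimately show ?thesis by (auto intro!: closed_Int closed_cube closed_UN closed_Un)
qed

lemma compact_cube_boundary: "compact (cube_boundary k)"
  using compact_Int_closed[OF compact_cube closed_cube_boundary, of k k] cube_boundary_subset[of k]
  by (simp add: Int_absorb1)

lemma cube_boundary_nonempty:
  assumes "1 \<le> k"
  shows "cube_boundary k \<noteq> {}"
proof -
  have "(\<lambda>_. 0) \<in> cube_boundary k"
    using assms by (auto simp: cube_boundary_def cube_def intro: exI[of _ 0])
  then show ?thesis by blast
qed

section \<open>Noncommutative CW complexes\<close>

lemma pullback_carrier:
  "Cell g a \<in> carrier (pullback_alg k F \<sigma> A) \<longleftrightarrow>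
     g \<in> carrier (C_alg (cube k) F) \<and> a \<in> carrier A \<and> restrict g (cube_boundary k) = \<sigma> a"
  by (simp add: pullback_alg_def Let_def I_alg_def bdry_def)

lemma pullback_cases:
  assumes "x \<in> carrier (pullback_alg k F \<sigma> A)"
  obtains g a where "x = Cell g a" "g \<in> carrier (C_alg (cube k) F)" "a \<in> carrier A"
    "restrict g (cube_boundary k) = \<sigma> a"
  using assms by (auto simp: pullback_alg_def Let_def I_alg_def bdry_def)

lemma pullback_simps [simp]:
  "cs_add (pullback_alg k F \<sigma> A) x y =
    Cell (cs_add (C_alg (cube k) F) (cell x) (cell y)) (cs_add A (skel x) (skel y))"
  "cs_mult (pullback_alg k F \<sigma> A) x y =
    Cell (cs_mult (C_alg (cube k) F) (cell x) (cell y)) (cs_mult A (skel x) (skel y))"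
  "cs_scale (pullback_alg k F \<sigma> A) c x =
    Cell (cs_scale (C_alg (cube k) F) c (cell x)) (cs_scale A c (skel x))"
  "cs_star (pullback_alg k F \<sigma> A) x = Cell (cs_star (C_alg (cube k) F) (cell x)) (cs_star A (skel x))"
  "cs_norm (pullback_alg k F \<sigma> A) x = max (cs_norm (C_alg (cube k) F) (cell x)) (cs_norm A (skel x))"
  by (simp_all add: pullback_alg_def Let_def I_alg_def)

lemma normed_star_algebra_pullback:
  assumes F: "normed_star_algebra F" and A: "normed_star_algebra A" and s: "star_hom A (S_alg k F) \<sigma>"
  shows "normed_star_algebra (pullback_alg k F \<sigma> A)"
proof
  interpret F: normed_star_algebra F by (rule F)
  interpret A: normed_star_algebra A by (rule A)
  interpret C: normed_star_algebra "C_alg (cube k) F"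
    by (rule F.normed_star_algebra_C_alg[OF compact_cube cube_nonempty])
  let ?P = "pullback_alg k F \<sigma> A" and ?B = "cube_boundary k"
  have sc: "\<sigma> a \<in> carrier (C_alg ?B F)" if "a \<in> carrier A" for a
    using star_hom_closed[OF s that] by (simp add: S_alg_def)
  have se: "\<sigma> a \<in> extensional ?B" if "a \<in> carrier A" for a
    using sc[OF that] by (simp add: C_alg_carrier)
  have B: "x \<in> cube k" if "x \<in> ?B" for x using that cube_boundary_subset by blast
  have point: "g x = \<sigma> a x" if "restrict g ?B = \<sigma> a" "x \<in> ?B" for g a x
    using that by (metis restrict_apply)
  note s' = s[unfolded S_alg_def]
  have "restrict C.zero ?B = \<sigma> A.zero"
  proof (rule C_alg_eqI[where X = ?B])
    fix x assume x: "x \<in> ?B"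
    have "\<sigma> A.zero x = cs_scale F 0 (\<sigma> A.zero x)"
      using x star_hom_scale[OF s' A.zero_closed, of 0] C_alg_apply(3)[OF x, of F 0 "\<sigma> A.zero"] by simp
    then have "\<sigma> A.zero x = F.zero"
      using x C_alg_closed[OF sc[OF A.zero_closed] x] by simp
    then show "restrict C.zero ?B x = \<sigma> A.zero x"
      using x B[OF x] F.C_alg_zero[OF compact_cube cube_nonempty, of k] by simp
  qed (use se[of A.zero] in simp_all)
  then have "Cell C.zero A.zero \<in> carrier ?P" by (simp add: pullback_carrier)
  then show "carrier ?P \<noteq> {}" by blast
  fix x y z assume xP: "x \<in> carrier ?P" and yP: "y \<in> carrier ?P" and zP: "z \<in> carrier ?P"
  from xP obtain gx ax where x: "x = Cell gx ax"
    and cx: "gx \<in> carrier (C_alg (cube k) F)" "ax \<in> carrier A" "restrict gx ?B = \<sigma> ax"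
    by (rule pullback_cases)
  from yP obtain gy ay where y: "y = Cell gy ay"
    and cy: "gy \<in> carrier (C_alg (cube k) F)" "ay \<in> carrier A" "restrict gy ?B = \<sigma> ay"
    by (rule pullback_cases)
  from zP obtain gz az where z: "z = Cell gz az"
    and cz: "gz \<in> carrier (C_alg (cube k) F)" "az \<in> carrier A" "restrict gz ?B = \<sigma> az"
    by (rule pullback_cases)
  note [simp] = cx(1,2) cy(1,2) cz(1,2)
  have "restrict (cs_add (C_alg (cube k) F) gx gy) ?B = \<sigma> (A.add ax ay)"
    by (rule C_alg_eqI[where X = ?B])
      (simp_all add: se B star_hom_add[OF s'] point[OF cx(3)] point[OF cy(3)])
  then show "cs_add ?P x y \<in> carrier ?P" by (simp add: x y pullback_carrier)
  have "restrict (cs_mult (C_alg (cube k) F) gx gy) ?B = \<sigma> (A.mult ax ay)"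
    by (rule C_alg_eqI[where X = ?B])
      (simp_all add: se B star_hom_mult[OF s'] point[OF cx(3)] point[OF cy(3)])
  then show "cs_mult ?P x y \<in> carrier ?P" by (simp add: x y pullback_carrier)
  have "restrict (cs_star (C_alg (cube k) F) gx) ?B = \<sigma> (cs_star A ax)"
    by (rule C_alg_eqI[where X = ?B]) (simp_all add: se B star_hom_star[OF s'] point[OF cx(3)])
  then show "cs_star ?P x \<in> carrier ?P" by (simp add: x y pullback_carrier)
  show "cs_scale ?P c x \<in> carrier ?P" for c
  proof -
    have "restrict (cs_scale (C_alg (cube k) F) c gx) ?B = \<sigma> (cs_scale A c ax)"
      by (rule C_alg_eqI[where X = ?B]) (simp_all add: se B star_hom_scale[OF s'] point[OF cx(3)])
    then show ?thesis by (simp add: x pullback_carrier)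
  qed
  show "cs_add ?P (cs_add ?P x y) z = cs_add ?P x (cs_add ?P y z)"
    "cs_mult ?P (cs_mult ?P x y) z = cs_mult ?P x (cs_mult ?P y z)"
    by (simp_all add: x y z C.add_assoc A.add_assoc C.mult_assoc A.mult_assoc)
  show "cs_add ?P x y = cs_add ?P y x"
    by (simp add: x y C.add_comm A.add_comm)
  show "cs_add ?P x (cs_scale ?P 0 y) = x" "cs_scale ?P 1 x = x"
    by (simp_all add: x y)
  show "cs_scale ?P c (cs_scale ?P d x) = cs_scale ?P (c * d) x"
    "cs_scale ?P (c + d) x = cs_add ?P (cs_scale ?P c x) (cs_scale ?P d x)" for c d
    by (simp_all add: x C.scale_scale A.scale_scale C.scale_add_left A.scale_add_left)
  show "cs_scale ?P c (cs_add ?P x y) = cs_add ?P (cs_scale ?P c x) (cs_scale ?P c y)"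
    "cs_mult ?P (cs_scale ?P c x) y = cs_scale ?P c (cs_mult ?P x y)"
    "cs_mult ?P x (cs_scale ?P c y) = cs_scale ?P c (cs_mult ?P x y)"
    "cs_star ?P (cs_scale ?P c x) = cs_scale ?P (cnj c) (cs_star ?P x)" for c
    by (simp_all add: x y C.scale_add_right A.scale_add_right C.mult_scale_left A.mult_scale_left
        C.mult_scale_right A.mult_scale_right C.star_scale A.star_scale)
  show "cs_mult ?P x (cs_add ?P y z) = cs_add ?P (cs_mult ?P x y) (cs_mult ?P x z)"
    "cs_mult ?P (cs_add ?P x y) z = cs_add ?P (cs_mult ?P x z) (cs_mult ?P y z)"
    "cs_star ?P (cs_add ?P x y) = cs_add ?P (cs_star ?P x) (cs_star ?P y)"
    by (simp_all add: x y z C.distrib_left A.distrib_left C.distrib_right A.distrib_right C.star_add A.star_add)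
  show "0 \<le> cs_norm ?P x" by (simp add: x le_max_iff_disj)
  show "x = cs_scale ?P 0 x" if "cs_norm ?P x = 0"
  proof -
    have "cs_norm (C_alg (cube k) F) gx \<le> cs_norm ?P x" "cs_norm A ax \<le> cs_norm ?P x"
      by (simp_all add: x)
    then have "cs_norm (C_alg (cube k) F) gx = 0" "cs_norm A ax = 0"
      unfolding that using cx(1,2) by (intro order_antisym; simp)+
    then show ?thesis using C.norm_eq_0D[OF cx(1)] A.norm_eq_0D[OF cx(2)] by (simp add: x)
  qed
  show "cs_norm ?P (cs_add ?P x y) \<le> cs_norm ?P x + cs_norm ?P y"
    using C.norm_triangle[OF cx(1) cy(1)] A.norm_triangle[OF cx(2) cy(2)] by (simp add: x y; linarith)
  show "cs_norm ?P (cs_scale ?P c x) = cmod c * cs_norm ?P x" for c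
    by (simp add: x C.norm_scale A.norm_scale max_mult_distrib_left)
  show "cs_norm ?P (cs_mult ?P x y) \<le> cs_norm ?P x * cs_norm ?P y"
  proof -
    have "cs_norm (C_alg (cube k) F) (C.mult gx gy) \<le> cs_norm ?P x * cs_norm ?P y"
      by (rule order_trans[OF C.norm_mult_le[OF cx(1) cy(1)]])
        (auto simp: x y le_max_iff_disj intro!: mult_mono)
    moreover have "cs_norm A (A.mult ax ay) \<le> cs_norm ?P x * cs_norm ?P y"
      by (rule order_trans[OF A.norm_mult_le[OF cx(2) cy(2)]])
        (auto simp: x y le_max_iff_disj intro!: mult_mono)
    ultimately show ?thesis by (simp add: x y)
  qed
  show "cs_norm ?P (cs_star ?P x) \<le> cs_norm ?P x"
    using C.norm_star[OF cx(1)] A.norm_star[OF cx(2)] by (simp add: x; linarith)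
  show "\<exists>q\<in>carrier ?P. cs_add ?P x q = cs_mult ?P x q \<and> cs_add ?P x q = cs_mult ?P q x"
    if n: "cs_norm ?P x < 1"
  proof -
    obtain g where g: "g \<in> carrier (C_alg (cube k) F)" "C.add gx g = C.mult gx g" "C.add gx g = C.mult g gx"
      using C.quasi_inverse_exists[OF cx(1)] n by (auto simp: x)
    obtain a where a: "a \<in> carrier A" "A.add ax a = A.mult ax a" "A.add ax a = A.mult a ax"
      using A.quasi_inverse_exists[OF cx(2)] n by (auto simp: x)
    have "restrict g ?B = \<sigma> a"
    proof (rule C_alg_eqI[where X = ?B])
      fix t assume t: "t \<in> ?B"
      have "g t = \<sigma> a t"
      proof (rule F.quasi_inverse_unique[of "gx t"])
        show "gx t \<in> carrier F" "g t \<in> carrier F" "\<sigma> a t \<in> carrier F"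
          using C_alg_closed[OF cx(1) B[OF t]] C_alg_closed[OF g(1) B[OF t]] C_alg_closed[OF sc[OF a(1)] t] by simp_all
        show "F.add (gx t) (g t) = F.mult (gx t) (g t)"
          using arg_cong[OF g(2), of "\<lambda>h. h t"] B[OF t] by simp
        have "\<sigma> (A.add ax a) t = \<sigma> (A.mult a ax) t" using a by simp
        then show "F.add (gx t) (\<sigma> a t) = F.mult (\<sigma> a t) (gx t)"
          using t a(1) by (simp add: star_hom_add[OF s'] star_hom_mult[OF s'] point[OF cx(3)])
      qed
      then show "restrict g ?B t = \<sigma> a t" using t by simp
    qed (use se a in simp_all)
    then show ?thesis using g a by (intro bexI[of _ "Cell g a"]) (auto simp: x pullback_carrier)
  qed
qed

lemma normed_star_algebra_vertex:
  assumes F: "normed_star_algebra F"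
  shows "normed_star_algebra (vertex_alg F)"
proof -
  interpret normed_star_algebra F by (rule F)
  show ?thesis
    by unfold_locales
      (auto simp: vertex_alg_def carrier_nonempty add_assoc scale_scale scale_add_left scale_add_right
        mult_assoc distrib_left distrib_right mult_scale_left mult_scale_right star_add star_scale
        norm_triangle norm_scale norm_mult_le norm_star norm_eq_0_iff
        intro: add_comm quasi_inverse_exists)
qed

section \<open>Geometry of the cube\<close>

definition l1dist :: "nat \<Rightarrow> (nat \<Rightarrow> real) \<Rightarrow> (nat \<Rightarrow> real) \<Rightarrow> real" where
  "l1dist k x y = (\<Sum>i<k. \<bar>x i - y i\<bar>)"

lemma l1dist_ge_0 [simp]: "0 \<le> l1dist k x y"
  by (simp add: l1dist_def sum_nonneg)

lemma l1dist_self [simp]: "l1dist k x x = 0"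
  by (simp add: l1dist_def)

lemma l1dist_commute: "l1dist k x y = l1dist k y x"
  by (simp add: l1dist_def abs_minus_commute)

lemma l1dist_triangle: "l1dist k x z \<le> l1dist k x y + l1dist k y z"
  unfolding l1dist_def sum.distrib[symmetric] by (rule sum_mono) linarith

lemma abs_diff_le_l1dist: "i < k \<Longrightarrow> \<bar>x i - y i\<bar> \<le> l1dist k x y"
  unfolding l1dist_def by (rule member_le_sum) auto

lemma l1dist_eq_0D:
  assumes "x \<in> cube k" "y \<in> cube k" "l1dist k x y = 0"
  shows "x = y"
proof
  fix i
  show "x i = y i"
  proof (cases "i < k")
    case True
    then show ?thesis using abs_diff_le_l1dist[of i k x y] assms(3) by simp
  next
    case False
    then show ?thesis using assms by (simp add: cube_def)
  qed
qed

lemma continuous_on_l1dist: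
  assumes "\<And>i. continuous_on S (\<lambda>z. f z i)" "\<And>i. continuous_on S (\<lambda>z. g z i)"
  shows "continuous_on S (\<lambda>z. l1dist k (f z) (g z))"
  unfolding l1dist_def
  by (intro continuous_on_sum continuous_on_rabs continuous_on_diff assms)

lemma continuous_on_l1dist_const: "continuous_on S (l1dist k x)"
  by (rule continuous_on_l1dist[of S "\<lambda>_. x" "\<lambda>y. y"]) (auto intro: continuous_on_coordinate continuous_on_const)

lemma open_l1ball: "open {y. l1dist k x y < d}"
  by (intro open_Collect_less continuous_on_l1dist_const continuous_on_const)

lemma l1ball_subset_open:
  assumes x: "x \<in> cube k" and U: "open U" "x \<in> U"
  shows "\<exists>d>0. \<forall>y\<in>cube k. l1dist k x y < d \<longrightarrow> y \<in> U"
proof (cases "cube k \<subseteq> U")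
  case True
  then show ?thesis by (intro exI[of _ 1]) auto
next
  case False
  have "compact (cube k \<inter> - U)"
    using compact_cube U by (intro compact_Int_closed) auto
  moreover have "cube k \<inter> - U \<noteq> {}" using False by auto
  ultimately obtain z where z: "z \<in> cube k \<inter> - U" "\<forall>y\<in>cube k \<inter> - U. l1dist k x z \<le> l1dist k x y"
    using continuous_attains_inf[OF _ _ continuous_on_l1dist_const] by blast
  have "l1dist k x z \<noteq> 0" using l1dist_eq_0D[OF x] z U by blast
  then have "l1dist k x z > 0" using l1dist_ge_0[of k x z] by linarith
  then show ?thesis using z by (intro exI[of _ "l1dist k x z"]) force
qed

lemma finite_separated:
  assumes S: "finite S" "S \<subseteq> cube k" and e: "e > 0"
  shows "\<exists>r>0. r \<le> e \<and> (\<forall>s\<in>S. \<forall>t\<in>S. s \<noteq> t \<longrightarrow> 2 * r \<le> l1dist k s t)"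
proof -
  define D where "D = (\<lambda>(s, t). l1dist k s t / 2) ` {(s, t) \<in> S \<times> S. s \<noteq> t}"
  have fin: "finite (insert e D)"
    unfolding D_def using S by (auto intro: finite_subset[of _ "S \<times> S"])
  have "l1dist k s t > 0" if "s \<in> S" "t \<in> S" "s \<noteq> t" for s t
  proof -
    have "l1dist k s t \<noteq> 0" using that S l1dist_eq_0D by blast
    then show ?thesis using l1dist_ge_0[of k s t] by linarith
  qed
  then have pos: "d > 0" if "d \<in> insert e D" for d
    using that e unfolding D_def by auto
  have "Min (insert e D) > 0" using fin pos by (subst Min_gr_iff) auto
  moreover have "Min (insert e D) \<le> e" using fin by (intro Min_le) auto
  moreover have "2 * Min (insert e D) \<le> l1dist k s t" if "s \<in> S" "t \<in> S" "s \<noteq> t" for s t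
  proof -
    have "l1dist k s t / 2 \<in> insert e D" using that unfolding D_def by force
    then have "Min (insert e D) \<le> l1dist k s t / 2" using fin by (intro Min_le)
    then show ?thesis by simp
  qed
  ultimately show ?thesis by blast
qed

lemma cube_convex:
  assumes "x \<in> cube k" "y \<in> cube k" "0 \<le> t" "t \<le> 1"
  shows "(\<lambda>i. x i + t * (y i - x i)) \<in> cube k"
proof -
  have "0 \<le> x i + t * (y i - x i) \<and> x i + t * (y i - x i) \<le> 1" if i: "i < k" for i
  proof -
    have "x i + t * (y i - x i) = (1 - t) * x i + t * y i" by (simp add: algebra_simps)
    moreover have "0 \<le> (1 - t) * x i + t * y i"
      using assms i by (intro add_nonneg_nonneg mult_nonneg_nonneg) (auto simp: cube_def)
    moreover have "(1 - t) * x i + t * y i \<le> (1 - t) * 1 + t * 1"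
      using assms i by (intro add_mono mult_left_mono) (auto simp: cube_def)
    ultimately show ?thesis by simp
  qed
  then show ?thesis using assms by (auto simp: cube_def)
qed

text \<open>The Minkowski functional of the cube with respect to an interior point \<open>p\<close>.\<close>

primrec cube_gauge :: "nat \<Rightarrow> (nat \<Rightarrow> real) \<Rightarrow> (nat \<Rightarrow> real) \<Rightarrow> real" where
  "cube_gauge 0 p y = 0"
| "cube_gauge (Suc k) p y =
     max (cube_gauge k p y) (max ((y k - p k) / (1 - p k)) ((p k - y k) / p k))"

lemma continuous_on_cube_gauge:
  assumes "\<And>i. i < k \<Longrightarrow> 0 < p i \<and> p i < 1" "\<And>i. continuous_on S (\<lambda>z. f z i)"
  shows "continuous_on S (\<lambda>z. cube_gauge k p (f z))"
  using assms(1)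
proof (induction k)
  case (Suc k)
  have "p k \<noteq> 0" "1 - p k \<noteq> 0" using Suc.prems[of k] by auto
  moreover have "continuous_on S (\<lambda>z. cube_gauge k p (f z))" using Suc by simp
  ultimately show ?case
    unfolding cube_gauge.simps using assms(2)
    by (intro continuous_on_max continuous_on_divide continuous_on_diff continuous_on_const ballI)
qed simp

lemma cube_gauge_ge_0: "0 \<le> cube_gauge k p y"
  by (induction k) auto

lemma cube_gauge_le_iff:
  assumes "\<And>i. i < k \<Longrightarrow> 0 < p i \<and> p i < 1"
  shows "cube_gauge k p y \<le> b \<longleftrightarrow>
    0 \<le> b \<and> (\<forall>i<k. y i - p i \<le> b * (1 - p i) \<and> p i - y i \<le> b * p i)"
  using assms
proof (induction k)
  case (Suc k)
  have "0 < p k" "0 < 1 - p k" using Suc.prems[of k] by auto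
  then have "(y k - p k) / (1 - p k) \<le> b \<longleftrightarrow> y k - p k \<le> b * (1 - p k)"
    "(p k - y k) / p k \<le> b \<longleftrightarrow> p k - y k \<le> b * p k"
    by (simp_all add: pos_divide_le_eq)
  then show ?case using Suc by (auto simp: less_Suc_eq)
qed auto

lemma cube_gauge_attained:
  assumes "\<And>i. i < k \<Longrightarrow> 0 < p i \<and> p i < 1" "cube_gauge k p y > 0"
  shows "\<exists>i<k. y i - p i = cube_gauge k p y * (1 - p i) \<or> p i - y i = cube_gauge k p y * p i"
  using assms
proof (induction k)
  case (Suc k)
  have p: "0 < p k" "0 < 1 - p k" using Suc.prems(1)[of k] by auto
  consider "cube_gauge (Suc k) p y = cube_gauge k p y" | "cube_gauge (Suc k) p y = (y k - p k) / (1 - p k)"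
    | "cube_gauge (Suc k) p y = (p k - y k) / p k"
  proof -
    have "max a (max b c) = a \<or> max a (max b c) = b \<or> max a (max b c) = c" for a b c :: real
      by linarith
    then show ?thesis using that unfolding cube_gauge.simps by blast
  qed
  then show ?case
  proof cases
    case 1
    then have "cube_gauge k p y > 0" using Suc.prems(2) by simp
    then obtain i where "i < k" "y i - p i = cube_gauge k p y * (1 - p i) \<or> p i - y i = cube_gauge k p y * p i"
      using Suc.IH Suc.prems(1) by auto
    then show ?thesis unfolding 1 by (intro exI[of _ i]) simp
  next
    case 2
    then show ?thesis using p by (intro exI[of _ k]) (simp add: field_simps)
  next
    case 3
    then show ?thesis using p by (intro exI[of _ k]) (simp add: field_simps)
  qed
qed simp

lemma cube_gauge_le_1:
  assumes "\<And>i. i < k \<Longrightarrow> 0 < p i \<and> p i < 1" "y \<in> cube k"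
  shows "cube_gauge k p y \<le> 1"
  using assms(2) by (subst cube_gauge_le_iff[OF assms(1)]) (auto simp: cube_def)

lemma cube_gauge_boundary:
  assumes p: "\<And>i. i < k \<Longrightarrow> 0 < p i \<and> p i < 1" and y: "y \<in> cube_boundary k"
  shows "cube_gauge k p y = 1"
proof -
  obtain i where i: "i < k" "y i = 0 \<or> y i = 1" using y by (auto simp: cube_boundary_def)
  have "y i - p i \<le> cube_gauge k p y * (1 - p i)" "p i - y i \<le> cube_gauge k p y * p i"
    using cube_gauge_le_iff[of k p y "cube_gauge k p y", OF p] i by auto
  moreover have "0 < p i" "0 < 1 - p i" using p[OF i(1)] by auto
  ultimately have "1 \<le> cube_gauge k p y" using i by auto
  moreover have "cube_gauge k p y \<le> 1"
    using cube_gauge_le_1[of k p y] p y cube_boundary_subset by blast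
  ultimately show ?thesis by simp
qed

definition push_from :: "(nat \<Rightarrow> real) \<Rightarrow> real \<Rightarrow> (nat \<Rightarrow> real) \<Rightarrow> nat \<Rightarrow> real" where
  "push_from p c y = (\<lambda>i. p i + (y i - p i) / c)"

lemma push_from_1 [simp]: "push_from p 1 y = y"
  by (simp add: push_from_def)

lemma push_from_in_cube:
  assumes p: "\<And>i. i < k \<Longrightarrow> 0 < p i \<and> p i < 1" "\<And>i. k \<le> i \<Longrightarrow> p i = 0"
    and y: "y \<in> cube k" and c: "cube_gauge k p y \<le> c" "0 < c"
  shows "push_from p c y \<in> cube k"
proof -
  have "0 \<le> push_from p c y i \<and> push_from p c y i \<le> 1" if i: "i < k" for i
  proof -
    have "y i - p i \<le> c * (1 - p i)" "p i - y i \<le> c * p i"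
      using cube_gauge_le_iff[of k p y c, OF p(1)] c i by auto
    then have "(y i - p i) / c \<le> 1 - p i" "(p i - y i) / c \<le> p i"
      using c(2) by (simp_all add: pos_divide_le_eq mult.commute)
    moreover have "(p i - y i) / c = - ((y i - p i) / c)" by (simp add: diff_divide_distrib)
    ultimately show ?thesis unfolding push_from_def by linarith
  qed
  moreover have "push_from p c y i = 0" if "k \<le> i" for i
    using p(2)[OF that] y that by (simp add: push_from_def cube_def)
  ultimately show ?thesis by (simp add: cube_def)
qed

lemma push_from_in_boundary:
  assumes p: "\<And>i. i < k \<Longrightarrow> 0 < p i \<and> p i < 1" "\<And>i. k \<le> i \<Longrightarrow> p i = 0"
    and y: "y \<in> cube k" and c: "cube_gauge k p y = c" "0 < c"
  shows "push_from p c y \<in> cube_boundary k"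
proof -
  obtain i where i: "i < k" "y i - p i = c * (1 - p i) \<or> p i - y i = c * p i"
    using cube_gauge_attained[of k p y] p(1) c by auto
  have "push_from p c y i = 1 \<or> push_from p c y i = 0"
    using i(2)
  proof
    assume "p i - y i = c * p i"
    then have "y i - p i = - (c * p i)" by simp
    then show ?thesis using c(2) by (simp add: push_from_def)
  qed (use c(2) in \<open>simp add: push_from_def\<close>)
  moreover have "push_from p c y \<in> cube k"
    by (rule push_from_in_cube) (use p y c in auto)
  ultimately show ?thesis using i(1) by (auto simp: cube_boundary_def)
qed

lemma continuous_on_push_from:
  assumes "\<And>i. continuous_on S (\<lambda>z. f z i)" "continuous_on S c" "\<And>z. z \<in> S \<Longrightarrow> c z \<noteq> 0"
  shows "continuous_on S (\<lambda>z. push_from p (c z) (f z) i)"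
  unfolding push_from_def using assms
  by (auto intro!: continuous_on_add continuous_on_divide continuous_on_diff continuous_on_const)

definition cube_center :: "nat \<Rightarrow> nat \<Rightarrow> real" where
  "cube_center k i = (if i < k then 1 / 2 else 0)"

lemma cube_center_simps [simp]:
  "i < k \<Longrightarrow> 0 < cube_center k i \<and> cube_center k i < 1" "k \<le> i \<Longrightarrow> cube_center k i = 0"
  by (simp_all add: cube_center_def)

lemma localisation_near_finite_set:
  assumes S: "finite S" "S \<subseteq> cube k" and e: "e > 0"
  shows "\<exists>h c r. continuous_on (cube k) h \<and> (\<forall>y\<in>cube_boundary k. h y = (0::real)) \<and> r > 0 \<and>
    (\<forall>s\<in>S. \<forall>y\<in>cube k. l1dist k s y < r \<longrightarrow> h y = 0) \<and>
    (\<forall>i. continuous_on (cube k) (\<lambda>y. c y i)) \<and>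
    (\<forall>y\<in>cube k. c y \<in> cube k \<and> (\<forall>i. \<bar>c y i - y i\<bar> \<le> e)) \<and>
    (\<forall>y\<in>cube k. (\<forall>i<k. 1 / 4 \<le> y i \<and> y i \<le> 3 / 4) \<longrightarrow> h y \<noteq> 1 \<longrightarrow> c y \<in> S)"
proof -
  obtain r where r: "r > 0" "r \<le> e" "\<And>s t. s \<in> S \<Longrightarrow> t \<in> S \<Longrightarrow> s \<noteq> t \<Longrightarrow> 2 * r \<le> l1dist k s t"
    using finite_separated[OF S e] by blast
  define g where "g s y = max 0 (min 1 (3 * l1dist k s y / r - 1))" for s y
  define b where "b s y = max 0 (min 1 (3 - 3 * l1dist k s y / r))" for s y
  define h where "h y = min 1 (2 - 2 * cube_gauge k (cube_center k) y) * (\<Prod>s\<in>S. g s y)" for y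
  define c where "c y i = y i + (\<Sum>s\<in>S. b s y * (s i - y i))" for y i
  have c1: "c y = (\<lambda>i. y i + b s y * (s i - y i))" if s: "s \<in> S" "l1dist k s y < r" for s y
  proof
    fix i
    have "b t y = 0" if t: "t \<in> S - {s}" for t
    proof -
      have "2 * r \<le> l1dist k s y + l1dist k y t"
        using r(3)[of s t] s t l1dist_triangle[of k s t y] by force
      then have "r \<le> l1dist k t y" using s l1dist_commute[of k y t] by simp
      then have "3 - 3 * l1dist k t y / r \<le> 0" using r(1) by (simp add: field_simps)
      then show ?thesis by (simp add: b_def)
    qed
    then show "c y i = y i + b s y * (s i - y i)"
      unfolding c_def using s S by (subst sum.remove[OF S(1) s(1)]) simp
  qed
  have c0: "c y = y" if "\<And>s. s \<in> S \<Longrightarrow> r \<le> l1dist k s y" for y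
  proof
    fix i
    have "b s y = 0" if "s \<in> S" for s
    proof -
      have "3 - 3 * l1dist k s y / r \<le> 0" using r(1) \<open>\<And>s. s \<in> S \<Longrightarrow> r \<le> l1dist k s y\<close>[OF that] by (simp add: field_simps)
      then show ?thesis by (simp add: b_def)
    qed
    then show "c y i = y i" by (simp add: c_def)
  qed
  have "continuous_on (cube k) h"
    unfolding h_def g_def
    by (intro continuous_on_mult continuous_on_min continuous_on_diff continuous_on_const
        continuous_on_cube_gauge continuous_on_coordinate continuous_on_prod continuous_on_max
        continuous_on_divide continuous_on_l1dist_const) (use r in auto)
  moreover have "h y = 0" if "y \<in> cube_boundary k" for y
    using cube_gauge_boundary[of k "cube_center k" y] that by (simp add: h_def)
  moreover have "h y = 0" if "s \<in> S" "y \<in> cube k" "l1dist k s y < r / 3" for s y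
  proof -
    have "3 * l1dist k s y / r - 1 \<le> 0" using that(3) r(1) by (simp add: field_simps)
    then have "g s y = 0" by (simp add: g_def)
    then show ?thesis using that(1) S(1) by (auto simp: h_def prod_zero_iff)
  qed
  moreover have "continuous_on (cube k) (\<lambda>y. c y i)" for i
    unfolding c_def b_def
    by (intro continuous_on_add continuous_on_mult continuous_on_min continuous_on_diff continuous_on_const
        continuous_on_coordinate continuous_on_sum continuous_on_max
        continuous_on_divide continuous_on_l1dist_const) (use r in auto)
  moreover have "c y \<in> cube k \<and> (\<forall>i. \<bar>c y i - y i\<bar> \<le> e)" if y: "y \<in> cube k" for y
  proof (cases "\<exists>s\<in>S. l1dist k s y < r")
    case True
    then obtain s where s: "s \<in> S" "l1dist k s y < r" by blast
    have b01: "0 \<le> b s y" "b s y \<le> 1" by (auto simp: b_def)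
    have "\<bar>c y i - y i\<bar> \<le> e" for i
    proof (cases "i < k")
      case True
      have "\<bar>c y i - y i\<bar> = b s y * \<bar>s i - y i\<bar>" using b01 by (simp add: c1[OF s] abs_mult)
      also have "\<dots> \<le> 1 * \<bar>s i - y i\<bar>" using b01 by (intro mult_right_mono) auto
      also have "\<dots> \<le> l1dist k s y" using abs_diff_le_l1dist[OF True] by simp
      finally show ?thesis using s r by linarith
    next
      case False
      then have "s i = 0" "y i = 0" using s S y by (auto simp: cube_def)
      then show ?thesis using e by (simp add: c1[OF s])
    qed
    then show ?thesis using cube_convex[OF y, of s "b s y"] s S b01 by (auto simp: c1[OF s])
  next
    case False
    then have "c y = y" by (intro c0) force
    then show ?thesis using y e by simp
  qed
  moreover have "c y \<in> S" if y: "y \<in> cube k" "\<forall>i<k. 1 / 4 \<le> y i \<and> y i \<le> 3 / 4" and h1: "h y \<noteq> 1" for y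
  proof -
    have "cube_gauge k (cube_center k) y \<le> 1 / 2"
      using y(2) by (subst cube_gauge_le_iff) (auto simp: cube_center_def)
    then have "h y = (\<Prod>s\<in>S. g s y)" by (simp add: h_def)
    then obtain s where s: "s \<in> S" "g s y \<noteq> 1" using h1 by (metis prod.neutral)
    have "3 * l1dist k s y / r - 1 < 1"
      using s(2) unfolding g_def by (auto simp: max_def min_def split: if_splits)
    then have lt: "l1dist k s y < 2 / 3 * r" using r(1) by (simp add: field_simps)
    then have "1 \<le> 3 - 3 * l1dist k s y / r" using r(1) by (simp add: field_simps)
    then have "b s y = 1" by (simp add: b_def)
    moreover have "l1dist k s y < r" using lt r(1) by linarith
    ultimately have "c y = s" using c1[OF s(1)] by (auto simp: fun_eq_iff)
    then show ?thesis using s by simp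
  qed
  ultimately show ?thesis using r(1) by (intro exI[of _ h] exI[of _ c] exI[of _ "r / 3"]) auto
qed

text \<open>
  A grid of \<open>q\<^sup>N\<close> candidates for \<open>p\<close> is compared with the \<open>O(q\<^sup>k)\<close> images of the cells of a grid in
  the \<open>k\<close>-cube, each of which is close to at most one candidate.
\<close>

lemma lipschitz_images_avoid_point:
  assumes T: "finite T" and kN: "k < N"
    and L: "\<And>f x y i. f \<in> T \<Longrightarrow> x \<in> cube k \<Longrightarrow> y \<in> cube k \<Longrightarrow> i < N \<Longrightarrow> \<bar>f x i - f y i\<bar> \<le> L * l1dist k x y"
    and L0: "0 \<le> L"
  shows "\<exists>p e. e > 0 \<and> (\<forall>i<N. 3 / 8 \<le> p i \<and> p i \<le> 5 / 8) \<and> (\<forall>i\<ge>N. p i = 0) \<and>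
    (\<forall>f\<in>T. \<forall>x\<in>cube k. \<exists>i<N. e \<le> \<bar>f x i - p i\<bar>)"
proof (rule ccontr)
  assume neg: "\<not> ?thesis"
  have neg': "\<exists>f\<in>T. \<exists>x\<in>cube k. \<forall>i<N. \<bar>f x i - p i\<bar> < e"
    if "e > 0" "\<forall>i<N. 3 / 8 \<le> p i \<and> p i \<le> 5 / 8" "\<forall>i\<ge>N. p i = 0" for p :: "nat \<Rightarrow> real" and e
  proof (rule ccontr)
    assume "\<not> ?thesis"
    then have "\<forall>f\<in>T. \<forall>x\<in>cube k. \<exists>i<N. e \<le> \<bar>f x i - p i\<bar>"
      by (simp add: not_less)
    then show False using neg that by blast
  qed
  obtain c :: nat where c: "4 * (2 + L * k) \<le> real c" using real_arch_simple by blast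
  have "0 \<le> L * k" using L0 by simp
  moreover have "8 + 4 * (L * k) \<le> c" using c by (simp add: distrib_left)
  ultimately have "0 < real c" by linarith
  then have c0: "c > 0" by simp
  define q where "q = card T * (c + 1) ^ k + 1"
  define M where "M = c * q"
  have q0: "q > 0" and M0: "M > 0" using c0 by (auto simp: q_def M_def)
  define p where "p v i = (if i < N then 3 / 8 + real (v i) / (4 * q) else 0)" for v :: "nat \<Rightarrow> nat" and i
  define V where "V = PiE {..<N} (\<lambda>_. {..<q})"
  define Q where "Q = PiE {..<k} (\<lambda>_. {..M})"
  define Z where "Z x = (\<lambda>i\<in>{..<k}. nat \<lfloor>M * x i\<rfloor>)" for x :: "nat \<Rightarrow> real"
  have "\<exists>f x. f \<in> T \<and> x \<in> cube k \<and> (\<forall>i<N. \<bar>f x i - p v i\<bar> < 1 / M)" if v: "v \<in> V" for v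
  proof -
    have "3 / 8 \<le> p v i \<and> p v i \<le> 5 / 8" if "i < N" for i
    proof -
      have "v i < q" using v that by (auto simp: V_def)
      then have "real (v i) / (4 * q) \<le> 1 / 4" using q0 by (simp add: field_simps)
      then show ?thesis using that by (simp add: p_def)
    qed
    moreover have "\<forall>i\<ge>N. p v i = 0" by (simp add: p_def)
    moreover have "1 / real M > 0" using M0 by simp
    ultimately have "\<exists>f\<in>T. \<exists>x\<in>cube k. \<forall>i<N. \<bar>f x i - p v i\<bar> < 1 / M"
      by (intro neg') auto
    then show ?thesis by blast
  qed
  then obtain f x where fx: "\<And>v. v \<in> V \<Longrightarrow> f v \<in> T" "\<And>v. v \<in> V \<Longrightarrow> x v \<in> cube k"
    "\<And>v i. v \<in> V \<Longrightarrow> i < N \<Longrightarrow> \<bar>f v (x v) i - p v i\<bar> < 1 / M"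
    by metis
  have "inj_on (\<lambda>v. (f v, Z (x v))) V"
  proof (rule inj_onI, rule ccontr)
    fix v w assume v: "v \<in> V" and w: "w \<in> V" and eq: "(f v, Z (x v)) = (f w, Z (x w))" and ne: "v \<noteq> w"
    have "\<exists>i<N. v i \<noteq> w i"
    proof (rule ccontr)
      assume "\<not> (\<exists>i<N. v i \<noteq> w i)"
      then have "v = w" by (intro PiE_ext[OF v[unfolded V_def] w[unfolded V_def]]) auto
      then show False using ne by simp
    qed
    then obtain i where i: "i < N" "v i \<noteq> w i" by blast
    have "l1dist k (x v) (x w) \<le> (\<Sum>j<k. 1 / M)"
      unfolding l1dist_def
    proof (rule sum_mono)
      fix j assume j: "j \<in> {..<k}"
      have "x v j \<ge> 0" "x w j \<ge> 0" using fx(2)[OF v] fx(2)[OF w] j by (auto simp: cube_def)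
      moreover have "nat \<lfloor>M * x v j\<rfloor> = nat \<lfloor>M * x w j\<rfloor>"
        using eq j by (auto simp: Z_def fun_eq_iff dest!: spec[of _ j])
      ultimately have "\<lfloor>M * x v j\<rfloor> = \<lfloor>M * x w j\<rfloor>" using M0 by (simp add: nat_eq_iff)
      then have "\<bar>M * x v j - M * x w j\<bar> < 1" by linarith
      then have "M * \<bar>x v j - x w j\<bar> < 1"
        using M0 by (simp add: abs_mult flip: right_diff_distrib)
      then show "\<bar>x v j - x w j\<bar> \<le> 1 / M" using M0 by (simp add: field_simps)
    qed
    then have "L * l1dist k (x v) (x w) \<le> L * (k / M)" using L0 by (intro mult_left_mono) auto
    then have "\<bar>f v (x v) i - f v (x w) i\<bar> \<le> L * k / M"
      using L[OF fx(1)[OF v] fx(2)[OF v] fx(2)[OF w] i(1)] by simp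
    moreover have "\<bar>f v (x v) i - p v i\<bar> < 1 / M" "\<bar>f v (x w) i - p w i\<bar> < 1 / M"
      using fx(3)[OF v i(1)] fx(3)[OF w i(1)] eq by auto
    ultimately have "\<bar>p v i - p w i\<bar> < 1 / M + 1 / M + L * k / M" by linarith
    also have "\<dots> = (2 + L * k) / M" by (simp add: add_divide_distrib)
    also have "\<dots> \<le> (c / 4) / M" using c by (intro divide_right_mono) auto
    also have "\<dots> = 1 / (4 * q)" using c0 by (simp add: M_def)
    finally have "\<bar>p v i - p w i\<bar> < 1 / (4 * q)" .
    moreover have "p v i - p w i = (real (v i) - real (w i)) / (4 * q)"
      using i(1) by (simp add: p_def diff_divide_distrib)
    ultimately have "\<bar>real (v i) - real (w i)\<bar> / (4 * q) < 1 / (4 * q)" by (simp add: abs_divide)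
    then have "\<bar>real (v i) - real (w i)\<bar> < 1" using q0 by (simp add: divide_less_cancel)
    then show False using i(2) by linarith
  qed
  moreover have "(\<lambda>v. (f v, Z (x v))) ` V \<subseteq> T \<times> Q"
  proof (intro subsetI, elim imageE, simp, intro conjI)
    fix v assume v: "v \<in> V"
    show "f v \<in> T" using fx(1)[OF v] .
    show "Z (x v) \<in> Q"
      unfolding Q_def
    proof (rule PiE_I)
      fix j assume j: "j \<in> {..<k}"
      have "x v j \<le> 1" using fx(2)[OF v] j by (auto simp: cube_def)
      then have "M * x v j \<le> M" using M0 by simp
      then have "nat \<lfloor>M * x v j\<rfloor> \<le> M" by linarith
      then show "Z (x v) j \<in> {..M}" using j by (simp add: Z_def)
    qed (simp add: Z_def)
  qed
  moreover have "finite (T \<times> Q)" unfolding Q_def using T by (auto intro!: finite_PiE)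
  ultimately have "card V \<le> card (T \<times> Q)" by (rule card_inj_on_le)
  moreover have "card V = q ^ N" by (simp add: V_def card_PiE)
  moreover have "card Q = (M + 1) ^ k" by (simp add: Q_def card_PiE)
  ultimately have "q ^ N \<le> card T * (M + 1) ^ k" by (simp add: card_cartesian_product)
  also have "\<dots> \<le> card T * ((c + 1) * q) ^ k"
    using q0 by (intro mult_left_mono power_mono) (auto simp: M_def)
  also have "\<dots> = (card T * (c + 1) ^ k) * q ^ k" by (simp only: power_mult_distrib mult.assoc)
  also have "\<dots> < q * q ^ k" using q0 by (intro mult_strict_right_mono) (auto simp: q_def)
  also have "\<dots> = q ^ Suc k" by simp
  also have "\<dots> \<le> q ^ N" using kN q0 by (intro power_increasing) auto
  finally show False by simp
qed

lemma lipschitz_partition_of_unity: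
  assumes X: "finite X" and d: "\<And>a. a \<in> X \<Longrightarrow> d a > 0"
    and cover: "\<And>x. x \<in> cube k \<Longrightarrow> \<exists>a\<in>X. l1dist k a x < d a"
  shows "\<exists>\<phi> L. 0 \<le> L \<and> (\<forall>x\<in>cube k. (\<Sum>a\<in>X. \<phi> a x) = (1::real)) \<and>
    (\<forall>a\<in>X. continuous_on (cube k) (\<phi> a)) \<and>
    (\<forall>a\<in>X. \<forall>x\<in>cube k. 0 \<le> \<phi> a x \<and> (\<phi> a x \<noteq> 0 \<longrightarrow> l1dist k a x < d a)) \<and>
    (\<forall>a\<in>X. \<forall>x\<in>cube k. \<forall>y\<in>cube k. \<bar>\<phi> a x - \<phi> a y\<bar> \<le> L * l1dist k x y)"
proof -
  define \<psi> where "\<psi> a x = max 0 (d a - l1dist k a x)" for a x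
  define \<Psi> where "\<Psi> x = (\<Sum>a\<in>X. \<psi> a x)" for x
  have c\<psi>: "continuous_on (cube k) (\<psi> a)" for a
    unfolding \<psi>_def by (intro continuous_on_max continuous_on_diff continuous_on_const continuous_on_l1dist_const)
  have c\<Psi>: "continuous_on (cube k) \<Psi>"
    unfolding \<Psi>_def by (intro continuous_on_sum c\<psi>)
  have \<psi>0: "0 \<le> \<psi> a x" for a x by (simp add: \<psi>_def)
  have le: "\<psi> a x \<le> \<Psi> x" if "a \<in> X" for a x
    unfolding \<Psi>_def using that X \<psi>0 by (intro member_le_sum) auto
  have pos: "\<Psi> x > 0" if x: "x \<in> cube k" for x
  proof -
    obtain a where a: "a \<in> X" "l1dist k a x < d a" using cover[OF x] by blast
    then have "\<psi> a x > 0" by (simp add: \<psi>_def)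
    then show ?thesis using le[OF a(1), of x] by linarith
  qed
  obtain z where z: "z \<in> cube k" "\<And>x. x \<in> cube k \<Longrightarrow> \<Psi> z \<le> \<Psi> x"
    using continuous_attains_inf[OF compact_cube cube_nonempty c\<Psi>] by blast
  define L where "L = (1 + card X) / \<Psi> z"
  have L0: "0 \<le> L" unfolding L_def using pos[OF z(1)] by simp
  have lip: "\<bar>\<psi> a x - \<psi> a y\<bar> \<le> l1dist k x y" for a x y
    using l1dist_triangle[of k a x y] l1dist_triangle[of k a y x] l1dist_commute[of k x y]
    unfolding \<psi>_def by (auto simp: max_def)
  have lip\<Psi>: "\<bar>\<Psi> x - \<Psi> y\<bar> \<le> card X * l1dist k x y" for x y
  proof -
    have "\<bar>\<Psi> x - \<Psi> y\<bar> \<le> (\<Sum>a\<in>X. \<bar>\<psi> a x - \<psi> a y\<bar>)"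
      unfolding \<Psi>_def sum_subtractf[symmetric] by (rule sum_abs)
    also have "\<dots> \<le> (\<Sum>a\<in>X. l1dist k x y)" using lip by (intro sum_mono)
    finally show ?thesis by simp
  qed
  have "\<bar>\<psi> a x / \<Psi> x - \<psi> a y / \<Psi> y\<bar> \<le> L * l1dist k x y" if a: "a \<in> X" and x: "x \<in> cube k" and y: "y \<in> cube k" for a x y
  proof -
    have "\<psi> a x / \<Psi> x - \<psi> a y / \<Psi> y = ((\<psi> a x - \<psi> a y) + (\<psi> a y / \<Psi> y) * (\<Psi> y - \<Psi> x)) / \<Psi> x"
      using pos[OF x] pos[OF y] by (simp add: field_simps)
    also have "\<bar>\<dots>\<bar> \<le> (l1dist k x y + 1 * (card X * l1dist k x y)) / \<Psi> z"
    proof -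
      have "\<bar>(\<psi> a y / \<Psi> y) * (\<Psi> y - \<Psi> x)\<bar> \<le> 1 * (card X * l1dist k x y)"
        unfolding abs_mult
        using le[OF a, of y] pos[OF y] \<psi>0[of a y] lip\<Psi>[of y x] l1dist_commute[of k x y]
        by (intro mult_mono) (auto simp: abs_divide)
      then have "\<bar>(\<psi> a x - \<psi> a y) + (\<psi> a y / \<Psi> y) * (\<Psi> y - \<Psi> x)\<bar> \<le> l1dist k x y + 1 * (card X * l1dist k x y)"
        using lip[of a x y] by linarith
      then show ?thesis
        unfolding abs_divide using pos[OF x] pos[OF z(1)] z(2)[OF x]
        by (intro frac_le) auto
    qed
    also have "\<dots> = L * l1dist k x y" by (simp add: L_def algebra_simps)
    finally show ?thesis .
  qed
  moreover have "(\<Sum>a\<in>X. \<psi> a x / \<Psi> x) = 1" if "x \<in> cube k" for x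
    using pos[OF that] by (simp add: \<Psi>_def flip: sum_divide_distrib)
  moreover have "continuous_on (cube k) (\<lambda>x. \<psi> a x / \<Psi> x)" for a
    using pos by (intro continuous_on_divide c\<psi> c\<Psi>) force
  moreover have "0 \<le> \<psi> a x / \<Psi> x \<and> (\<psi> a x / \<Psi> x \<noteq> 0 \<longrightarrow> l1dist k a x < d a)" if "x \<in> cube k" for a x
    using pos[OF that] \<psi>0[of a x] by (auto simp: \<psi>_def max_def split: if_splits)
  ultimately show ?thesis using L0
    by (intro exI[of _ "\<lambda>a x. \<psi> a x / \<Psi> x"] exI[of _ L]) auto
qed

section \<open>Representations of an open cell\<close>

definition I0_alg :: "nat \<Rightarrow> 'a cstar \<Rightarrow> ((nat \<Rightarrow> real) \<Rightarrow> 'a) cstar" where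
  "I0_alg k F = (C_alg (cube k) F)
     \<lparr> carrier := {g \<in> carrier (C_alg (cube k) F). \<forall>y\<in>cube_boundary k. g y = cs_zero F} \<rparr>"

lemma I0_carrier: "g \<in> carrier (I0_alg k F) \<longleftrightarrow>
    g \<in> carrier (C_alg (cube k) F) \<and> (\<forall>y\<in>cube_boundary k. g y = cs_zero F)"
  by (simp add: I0_alg_def)

lemma I0_simps [simp]:
  "cs_add (I0_alg k F) = cs_add (C_alg (cube k) F)"
  "cs_mult (I0_alg k F) = cs_mult (C_alg (cube k) F)"
  "cs_scale (I0_alg k F) = cs_scale (C_alg (cube k) F)"
  "cs_star (I0_alg k F) = cs_star (C_alg (cube k) F)"
  by (simp_all add: I0_alg_def)

definition fun_scale :: "'x set \<Rightarrow> 'a cstar \<Rightarrow> ('x \<Rightarrow> real) \<Rightarrow> ('x \<Rightarrow> 'a) \<Rightarrow> 'x \<Rightarrow> 'a" where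
  "fun_scale X F h b = (\<lambda>y\<in>X. cs_scale F (of_real (h y)) (b y))"

context normed_star_algebra
begin

lemma I0_closed: "b \<in> carrier (I0_alg k A) \<Longrightarrow> y \<in> cube k \<Longrightarrow> b y \<in> carrier A"
  using C_alg_closed[of b "cube k" A y] by (simp add: I0_carrier)

lemma I0_extensional: "b \<in> carrier (I0_alg k A) \<Longrightarrow> b \<in> extensional (cube k)"
  by (simp add: I0_carrier C_alg_carrier)

lemma fun_scale_closed:
  assumes b: "b \<in> carrier (C_alg (cube k) A)" and h: "continuous_on (cube k) h"
    and z: "\<And>y. y \<in> cube_boundary k \<Longrightarrow> h y = 0 \<or> b y = 0\<^sub>A"
  shows "fun_scale (cube k) A h b \<in> carrier (I0_alg k A)"
proof -
  have "cs_continuous (cube k) A (\<lambda>y. complex_of_real (h y) \<cdot>\<^sub>A b y)"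
    using b h by (intro cs_continuous_scale continuous_on_of_real) (auto simp: C_alg_carrier)
  moreover have "complex_of_real (h y) \<cdot>\<^sub>A b y = 0\<^sub>A" if "y \<in> cube_boundary k" for y
    using z[OF that] C_alg_closed[OF b] that cube_boundary_subset[of k] by auto
  ultimately show ?thesis
    using cube_boundary_subset[of k] by (auto simp: I0_carrier C_alg_carrier fun_scale_def)
qed

lemma fun_scale_I0:
  "b \<in> carrier (I0_alg k A) \<Longrightarrow> continuous_on (cube k) h \<Longrightarrow> fun_scale (cube k) A h b \<in> carrier (I0_alg k A)"
  by (rule fun_scale_closed) (auto simp: I0_carrier)

lemma fun_scale_split:
  assumes b: "b \<in> carrier (I0_alg k A)"
  shows "cs_add (C_alg (cube k) A) (fun_scale (cube k) A (\<lambda>y. 1 - h y) b) (fun_scale (cube k) A h b) = b"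
proof (rule C_alg_eqI[where X = "cube k"])
  fix y assume y: "y \<in> cube k"
  have "b y = complex_of_real (1 - h y) \<cdot>\<^sub>A b y +\<^sub>A complex_of_real (h y) \<cdot>\<^sub>A b y"
    using I0_closed[OF b y] by (simp add: scale_add_left[symmetric])
  then show "cs_add (C_alg (cube k) A) (fun_scale (cube k) A (\<lambda>y. 1 - h y) b) (fun_scale (cube k) A h b) y = b y"
    using y by (simp add: fun_scale_def)
qed (use I0_extensional[OF b] in simp_all)

end

locale cell_rep = F: normed_star_algebra F + B: normed_star_algebra B
  for F :: "'a cstar" and B :: "'b cstar" +
  fixes k :: nat and \<rho> :: "((nat \<Rightarrow> real) \<Rightarrow> 'a) \<Rightarrow> 'b"
  assumes hom: "star_hom (I0_alg k F) B \<rho>"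
begin

lemma rho_closed: "b \<in> carrier (I0_alg k F) \<Longrightarrow> \<rho> b \<in> carrier B"
  using hom by (rule star_hom_closed)

lemma rho_vanish_zero:
  assumes b: "b \<in> carrier (I0_alg k F)" and z: "\<And>y. y \<in> cube k \<Longrightarrow> b y = F.zero"
  shows "\<rho> b = B.zero"
proof -
  have "b = cs_scale (C_alg (cube k) F) 0 b"
    by (rule C_alg_eqI[where X = "cube k"]) (use F.I0_extensional[OF b] z in simp_all)
  then have "\<rho> b = \<rho> (cs_scale (I0_alg k F) 0 b)" by simp
  also have "\<dots> = cs_scale B 0 (\<rho> b)" using hom b by (rule star_hom_scale)
  also have "\<dots> = B.zero" using rho_closed[OF b] by simp
  finally show ?thesis .
qed

lemma rho_fun_scale_split:
  assumes b: "b \<in> carrier (I0_alg k F)" and h: "continuous_on (cube k) h"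
  shows "\<rho> b = cs_add B (\<rho> (fun_scale (cube k) F (\<lambda>y. 1 - h y) b)) (\<rho> (fun_scale (cube k) F h b))"
proof -
  have "fun_scale (cube k) F (\<lambda>y. 1 - h y) b \<in> carrier (I0_alg k F)"
    "fun_scale (cube k) F h b \<in> carrier (I0_alg k F)"
    using b h by (auto intro!: F.fun_scale_I0 continuous_on_diff continuous_on_const)
  from star_hom_add[OF hom this] show ?thesis using F.fun_scale_split[OF b, of h] by simp
qed

text \<open>
  The functions \<open>1 - h\<close> with \<open>h \<in> T\<close> act injectively, but their product annihilates \<open>b\<close>.
\<close>

lemma rho_vanish:
  assumes "finite T" "\<And>h. h \<in> T \<Longrightarrow> continuous_on (cube k) h"
    and inj: "\<And>h b. h \<in> T \<Longrightarrow> b \<in> carrier (I0_alg k F) \<Longrightarrow>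
      \<rho> (fun_scale (cube k) F (\<lambda>y. 1 - h y) b) = B.zero \<Longrightarrow> \<rho> b = B.zero"
    and b: "b \<in> carrier (I0_alg k F)"
    and cover: "\<And>y. y \<in> cube k \<Longrightarrow> b y \<noteq> F.zero \<Longrightarrow> \<exists>h\<in>T. h y = 1"
  shows "\<rho> b = B.zero"
  using assms
proof (induction T arbitrary: b rule: finite_induct)
  case empty
  then show ?case by (intro rho_vanish_zero) auto
next
  case (insert h T)
  let ?b = "fun_scale (cube k) F (\<lambda>y. 1 - h y) b"
  have b: "?b \<in> carrier (I0_alg k F)"
    using insert.prems by (intro F.fun_scale_I0 continuous_on_diff continuous_on_const) auto
  have "\<rho> ?b = B.zero"
  proof (rule insert.IH[OF _ _ b])
    fix y assume y: "y \<in> cube k" "?b y \<noteq> F.zero"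
    have "h y \<noteq> 1" "b y \<noteq> F.zero"
      using y F.I0_closed[OF insert.prems(3) y(1)] by (auto simp: fun_scale_def)
    then show "\<exists>h\<in>T. h y = 1" using insert.prems(4)[OF y(1)] by auto
  qed (use insert.prems in auto)
  then show ?case using insert.prems by blast
qed

definition support :: "(nat \<Rightarrow> real) set" where
  "support = {y \<in> cube k. \<forall>r>0. \<exists>b\<in>carrier (I0_alg k F).
     (\<forall>z\<in>cube k. r \<le> l1dist k y z \<longrightarrow> b z = F.zero) \<and> \<rho> b \<noteq> B.zero}"

lemma rho_vanish_near_support:
  assumes b: "b \<in> carrier (I0_alg k F)" and r: "r > 0"
    and z: "\<And>s y. s \<in> support \<Longrightarrow> y \<in> cube k \<Longrightarrow> l1dist k s y < r \<Longrightarrow> b y = F.zero"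
  shows "\<rho> b = B.zero"
proof -
  define K where "K = cube k \<inter> (\<Inter>s\<in>support. {y. r \<le> l1dist k s y})"
  have "closed (\<Inter>s\<in>support. {y. r \<le> l1dist k s y})"
    by (intro closed_INT ballI closed_Collect_le continuous_on_const continuous_on_l1dist_const)
  then have K: "compact K" unfolding K_def by (rule compact_Int_closed[OF compact_cube])
  have "\<exists>d>0. \<forall>b\<in>carrier (I0_alg k F). (\<forall>z\<in>cube k. d \<le> l1dist k y z \<longrightarrow> b z = F.zero) \<longrightarrow> \<rho> b = B.zero"
    if "y \<in> K" for y
  proof -
    have "y \<notin> support" "y \<in> cube k" using that r unfolding K_def by force+
    then show ?thesis unfolding support_def by blast
  qed
  then obtain d where d: "\<And>y. y \<in> K \<Longrightarrow> d y > 0"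
    "\<And>y b. y \<in> K \<Longrightarrow> b \<in> carrier (I0_alg k F) \<Longrightarrow> (\<forall>z\<in>cube k. d y \<le> l1dist k y z \<longrightarrow> b z = F.zero) \<Longrightarrow>
      \<rho> b = B.zero"
    by metis
  obtain Y where Y: "Y \<subseteq> K" "finite Y" "K \<subseteq> (\<Union>y\<in>Y. {z. l1dist k y z < d y / 2})"
  proof (rule compactE_image[OF K, of K "\<lambda>y. {z. l1dist k y z < d y / 2}"])
    show "K \<subseteq> (\<Union>y\<in>K. {z. l1dist k y z < d y / 2})" using d(1) by force
    show "open {z. l1dist k y z < d y / 2}" for y by (rule open_l1ball)
  qed (use that in auto)
  define h where "h y z = max 0 (min 1 (2 - 2 * l1dist k y z / d y))" for y z
  have hc: "continuous_on (cube k) (h y)" if "y \<in> K" for y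
    unfolding h_def using d(1)[OF that]
    by (intro continuous_on_max continuous_on_min continuous_on_diff continuous_on_divide
        continuous_on_mult continuous_on_const continuous_on_l1dist_const) auto
  show ?thesis
  proof (rule rho_vanish[of "h ` Y"])
    fix g b assume g: "g \<in> h ` Y" and b: "b \<in> carrier (I0_alg k F)"
      and 0: "\<rho> (fun_scale (cube k) F (\<lambda>y. 1 - g y) b) = B.zero"
    obtain y where y: "y \<in> K" "g = h y" using g Y by auto
    have fb: "fun_scale (cube k) F g b \<in> carrier (I0_alg k F)"
      using hc[OF y(1)] y(2) b by (simp add: F.fun_scale_I0)
    have "\<rho> (fun_scale (cube k) F g b) = B.zero"
    proof (rule d(2)[OF y(1) fb], intro ballI impI)
      fix z assume "z \<in> cube k" "d y \<le> l1dist k y z"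
      moreover from this have "2 - 2 * l1dist k y z / d y \<le> 0" using d(1)[OF y(1)] by (simp add: field_simps)
      ultimately show "fun_scale (cube k) F g b z = F.zero"
        using F.I0_closed[OF b, of z] y(2) by (simp add: fun_scale_def h_def)
    qed
    then show "\<rho> b = B.zero" using rho_fun_scale_split[OF b, of g] hc y 0 by simp
  next
    fix z assume zc: "z \<in> cube k" "b z \<noteq> F.zero"
    then have "z \<in> K" using z unfolding K_def by force
    then obtain y where y: "y \<in> Y" "l1dist k y z < d y / 2" using Y(3) by auto
    then have "1 \<le> 2 - 2 * l1dist k y z / d y" using d(1)[of y] Y(1) by (auto simp: field_simps)
    then show "\<exists>g\<in>h ` Y. g z = 1" using y(1) by (force simp: h_def)
  qed (use Y hc b in auto)
qed

lemma rho_fun_scale_unit: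
  assumes e: "e \<in> carrier F" "\<And>x. x \<in> carrier F \<Longrightarrow> cs_mult F e x = x"
    and h: "continuous_on (cube k) h" "\<And>y. y \<in> cube_boundary k \<Longrightarrow> h y = 0"
    and b: "b \<in> carrier (I0_alg k F)"
    and lt: "cs_norm B (\<rho> (fun_scale (cube k) F h (\<lambda>y\<in>cube k. e))) < 1"
    and 0: "\<rho> (fun_scale (cube k) F (\<lambda>y. 1 - h y) b) = B.zero"
  shows "\<rho> b = B.zero"
proof -
  let ?u = "fun_scale (cube k) F h (\<lambda>y\<in>cube k. e)"
  have "(\<lambda>y\<in>cube k. e) \<in> carrier (C_alg (cube k) F)"
    using e(1) by (simp add: C_alg_carrier F.cs_continuous_const)
  then have u: "?u \<in> carrier (I0_alg k F)" using h by (intro F.fun_scale_closed) auto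
  have "fun_scale (cube k) F h b = cs_mult (C_alg (cube k) F) ?u b"
    by (rule C_alg_eqI[where X = "cube k"])
      (use F.I0_closed[OF b] e in \<open>simp_all add: fun_scale_def F.mult_scale_left\<close>)
  then have "\<rho> (fun_scale (cube k) F h b) = cs_mult B (\<rho> ?u) (\<rho> b)"
    using star_hom_mult[OF hom u b] by simp
  moreover have "\<rho> b = \<rho> (fun_scale (cube k) F h b)"
    using rho_fun_scale_split[OF b h(1)] 0 rho_closed[OF F.fun_scale_I0[OF b h(1)]] by simp
  ultimately show ?thesis
    using B.eq_zero_if_mult_fixed[OF rho_closed[OF u] rho_closed[OF b] lt] by simp
qed

end

lemma finite_support:
  assumes "cell_rep F (findim ns) k \<rho>"
  shows "finite (cell_rep.support F (findim ns) k \<rho>)"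
proof (rule ccontr)
  interpret cell_rep F "findim ns" k \<rho> by fact
  assume "infinite (cell_rep.support F (findim ns) k \<rho>)"
  then obtain T where T: "finite T" "card T = Suc (\<Sum>i<length ns. ns ! i * ns ! i)" "T \<subseteq> support"
    using infinite_arbitrarily_large by blast
  then have "T \<subseteq> cube k" by (auto simp: support_def)
  then obtain r where r: "r > 0" "\<And>s t. s \<in> T \<Longrightarrow> t \<in> T \<Longrightarrow> s \<noteq> t \<Longrightarrow> 2 * r \<le> l1dist k s t"
    using finite_separated[OF T(1), of k 1] by auto
  have "\<exists>b. b \<in> carrier (I0_alg k F) \<and> (\<forall>z\<in>cube k. r \<le> l1dist k s z \<longrightarrow> b z = F.zero) \<and> \<rho> b \<noteq> B.zero"
    if "s \<in> T" for s
    using that T(3) r(1) unfolding support_def by blast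
  then obtain b where b: "\<And>s. s \<in> T \<Longrightarrow> b s \<in> carrier (I0_alg k F)"
    "\<And>s z. s \<in> T \<Longrightarrow> z \<in> cube k \<Longrightarrow> r \<le> l1dist k s z \<Longrightarrow> b s z = F.zero" "\<And>s. s \<in> T \<Longrightarrow> \<rho> (b s) \<noteq> B.zero"
    by metis
  interpret C: normed_star_algebra "C_alg (cube k) F"
    by (rule F.normed_star_algebra_C_alg[OF compact_cube cube_nonempty])
  have cb: "y \<in> cube k" if "y \<in> cube_boundary k" for y
    using that cube_boundary_subset by blast
  have bs: "cs_star (C_alg (cube k) F) (b s) \<in> carrier (I0_alg k F)" if "s \<in> T" for s
    using b(1)[OF that] by (simp add: I0_carrier cb)
  have "card T \<le> (\<Sum>i<length ns. ns ! i * ns ! i)"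
  proof (rule findim_orthogonal_card_le[where x = "\<lambda>s. \<rho> (b s)"])
    fix s t assume st: "s \<in> T" "t \<in> T" "s \<noteq> t"
    let ?m = "cs_mult (C_alg (cube k) F) (cs_star (C_alg (cube k) F) (b s)) (b t)"
    have m: "?m \<in> carrier (I0_alg k F)"
      using b(1)[OF st(1)] b(1)[OF st(2)] by (simp add: I0_carrier cb)
    have "?m z = F.zero" if z: "z \<in> cube k" for z
    proof -
      have c: "b s z \<in> carrier F" "b t z \<in> carrier F" using F.I0_closed b(1) st z by blast+
      have "2 * r \<le> l1dist k s z + l1dist k t z"
        using r(2)[OF st] l1dist_triangle[of k s t z] l1dist_commute[of k z t] by simp
      then have "r \<le> l1dist k s z \<or> r \<le> l1dist k t z" by linarith
      then have "b s z = F.zero \<or> b t z = F.zero" using b(2) st z by blast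
      then show ?thesis using z c by auto
    qed
    then have "\<rho> ?m = B.zero" by (rule rho_vanish_zero[OF m])
    then show "cs_mult (findim ns) (cs_star (findim ns) (\<rho> (b s))) (\<rho> (b t)) = cs_zero (findim ns)"
      using star_hom_mult[OF hom bs[OF st(1)] b(1)[OF st(2)]] star_hom_star[OF hom b(1)[OF st(1)]] by simp
  qed (use T b rho_closed in auto)
  then show False using T(2) by simp
qed

section \<open>Pushing a small-dimensional family off an open cell\<close>

lemma I0_compose:
  assumes F: "normed_star_algebra F" and b: "b \<in> carrier (I0_alg N F)"
    and f: "\<And>i. continuous_on (cube N) (\<lambda>y. f y i)" "\<And>y. y \<in> cube N \<Longrightarrow> f y \<in> cube N"
      "\<And>y. y \<in> cube_boundary N \<Longrightarrow> f y = y"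
  shows "(\<lambda>y\<in>cube N. b (f y)) \<in> carrier (I0_alg N F)"
proof -
  interpret F: normed_star_algebra F by (rule F)
  have "cs_continuous (cube N) F (\<lambda>y. b (f y))"
  proof (rule F.cs_continuous_compose[where g = b and p = f and X = "cube N"])
    show "cs_continuous (cube N) F b" using b by (simp add: I0_carrier C_alg_carrier)
    show "continuous_on (cube N) f" using f(1) by (rule continuous_on_coordinatewise_then_product)
  qed (use f in auto)
  then show ?thesis
    using b f(3) cube_boundary_subset[of N] by (auto simp: I0_carrier C_alg_carrier subset_iff)
qed

lemma cell_deformation:
  assumes F: "normed_star_algebra F"
    and e: "e \<in> carrier F" "\<And>x. x \<in> carrier F \<Longrightarrow> cs_mult F e x = x"
    and kN: "k < N"
    and \<tau>: "\<And>x. x \<in> cube k \<Longrightarrow> star_hom (I0_alg N F) (findim ns) (\<lambda>b. \<tau> b x)"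
    and \<tau>c: "\<And>b. b \<in> carrier (I0_alg N F) \<Longrightarrow> cs_continuous (cube k) (findim ns) (\<tau> b)"
  shows "\<exists>\<Psi>. (\<forall>i. continuous_on (cube k \<times> cube N) (\<lambda>z. \<Psi> (fst z) (snd z) i)) \<and>
    (\<forall>x\<in>cube k. \<forall>y\<in>cube N. \<Psi> x y \<in> cube N) \<and>
    (\<forall>x\<in>cube k. \<forall>y\<in>cube_boundary N. \<Psi> x y = y) \<and>
    (\<forall>x\<in>cube k. \<forall>b\<in>carrier (I0_alg N F). \<tau> (\<lambda>y\<in>cube N. b (\<Psi> x y)) x = cs_zero (findim ns))"
proof -
  interpret F: normed_star_algebra F by (rule F)
  interpret B: normed_star_algebra "findim ns" by (rule normed_star_algebra_findim)
  have rep: "cell_rep F (findim ns) N (\<lambda>b. \<tau> b x)" if "x \<in> cube k" for x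
    by unfold_locales (rule \<tau>[OF that])
  define u where "u h = fun_scale (cube N) F h (\<lambda>y\<in>cube N. e)" for h
  have u: "u h \<in> carrier (I0_alg N F)"
    if "continuous_on (cube N) h" "\<And>y. y \<in> cube_boundary N \<Longrightarrow> h y = 0" for h
    unfolding u_def using that e by (intro F.fun_scale_closed) (auto simp: C_alg_carrier F.cs_continuous_const)
  define Loc where "Loc a S h c d \<longleftrightarrow>
      finite S \<and> S \<subseteq> cube N \<and> continuous_on (cube N) h \<and> (\<forall>y\<in>cube_boundary N. h y = 0) \<and>
      (\<forall>i. continuous_on (cube N) (\<lambda>y. c y i)) \<and>
      (\<forall>y\<in>cube N. c y \<in> cube N \<and> (\<forall>i. \<bar>c y i - y i\<bar> \<le> 1 / 16)) \<and>
      (\<forall>y\<in>cube N. (\<forall>i<N. 1 / 4 \<le> y i \<and> y i \<le> 3 / 4) \<longrightarrow> h y \<noteq> 1 \<longrightarrow> c y \<in> S) \<and>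
      d > 0 \<and> (\<forall>x\<in>cube k. l1dist k a x < d \<longrightarrow> cs_norm (findim ns) (\<tau> (u h) x) < 1)"
    for a S h c d
  have "\<exists>S h c d. Loc a S h c d" if a: "a \<in> cube k" for a
  proof -
    interpret R: cell_rep F "findim ns" N "\<lambda>b. \<tau> b a" by (rule rep[OF a])
    have S: "finite R.support" "R.support \<subseteq> cube N"
      using finite_support[OF rep[OF a]] by (auto simp: R.support_def)
    have "(0::real) < 1 / 16" by simp
    from localisation_near_finite_set[OF S this]
    obtain h :: "(nat \<Rightarrow> real) \<Rightarrow> real" and c r where h: "continuous_on (cube N) h" "\<forall>y\<in>cube_boundary N. h y = 0"
      "r > 0" "\<forall>s\<in>R.support. \<forall>y\<in>cube N. l1dist N s y < r \<longrightarrow> h y = 0"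
      and c: "\<forall>i. continuous_on (cube N) (\<lambda>y. c y i)"
        "\<forall>y\<in>cube N. c y \<in> cube N \<and> (\<forall>i. \<bar>c y i - y i\<bar> \<le> 1 / 16)"
        "\<forall>y\<in>cube N. (\<forall>i<N. 1 / 4 \<le> y i \<and> y i \<le> 3 / 4) \<longrightarrow> h y \<noteq> 1 \<longrightarrow> c y \<in> R.support"
      by (elim exE conjE) (rule that; assumption)
    have uh: "u h \<in> carrier (I0_alg N F)" using u h by blast
    have "\<tau> (u h) a = B.zero"
      by (rule R.rho_vanish_near_support[OF uh h(3)]) (use h e in \<open>auto simp: u_def fun_scale_def\<close>)
    then have n0: "cs_norm (findim ns) (\<tau> (u h) a) = 0" by simp
    have "continuous_on (cube k) (\<lambda>x. cs_norm (findim ns) (\<tau> (u h) x))"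
      by (rule B.continuous_on_cs_norm[OF \<tau>c[OF uh]])
    then obtain U where U: "open U" "U \<inter> cube k = (\<lambda>x. cs_norm (findim ns) (\<tau> (u h) x)) -` {..<1} \<inter> cube k"
      unfolding continuous_on_open_invariant by (metis open_lessThan)
    have "a \<in> U" using U(2) n0 a by auto
    then obtain d where "d > 0" "\<forall>x\<in>cube k. l1dist k a x < d \<longrightarrow> x \<in> U"
      using l1ball_subset_open[OF a U(1)] by blast
    then have "d > 0" "\<forall>x\<in>cube k. l1dist k a x < d \<longrightarrow> cs_norm (findim ns) (\<tau> (u h) x) < 1"
      using U(2) by auto
    then have "Loc a R.support h c d" unfolding Loc_def using S h(1,2) c by simp
    then show ?thesis by blast
  qed
  then obtain S h c d where Loc: "\<And>a. a \<in> cube k \<Longrightarrow> Loc a (S a) (h a) (c a) (d a)" by metis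
  have S: "\<And>a. a \<in> cube k \<Longrightarrow> finite (S a) \<and> S a \<subseteq> cube N"
    and h: "\<And>a. a \<in> cube k \<Longrightarrow> continuous_on (cube N) (h a) \<and> (\<forall>y\<in>cube_boundary N. h a y = 0)"
    and cc: "\<And>a i. a \<in> cube k \<Longrightarrow> continuous_on (cube N) (\<lambda>y. c a y i)"
    and c: "\<And>a y. a \<in> cube k \<Longrightarrow> y \<in> cube N \<Longrightarrow> c a y \<in> cube N \<and> (\<forall>i. \<bar>c a y i - y i\<bar> \<le> 1 / 16)"
    and cS: "\<And>a y. a \<in> cube k \<Longrightarrow> y \<in> cube N \<Longrightarrow> \<forall>i<N. 1 / 4 \<le> y i \<and> y i \<le> 3 / 4 \<Longrightarrow> h a y \<noteq> 1 \<Longrightarrow> c a y \<in> S a"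
    and d: "\<And>a. a \<in> cube k \<Longrightarrow> d a > 0"
    and lt: "\<And>a x. a \<in> cube k \<Longrightarrow> x \<in> cube k \<Longrightarrow> l1dist k a x < d a \<Longrightarrow> cs_norm (findim ns) (\<tau> (u (h a)) x) < 1"
    using Loc unfolding Loc_def by simp_all
  obtain X where X: "X \<subseteq> cube k" "finite X" "cube k \<subseteq> (\<Union>a\<in>X. {x. l1dist k a x < d a})"
  proof (rule compactE_image[OF compact_cube, of "cube k" "\<lambda>a. {x. l1dist k a x < d a}" k])
    show "cube k \<subseteq> (\<Union>a\<in>cube k. {x. l1dist k a x < d a})" using d by force
    show "open {x. l1dist k a x < d a}" for a by (rule open_l1ball)
  qed (use that in auto)
  have "\<exists>\<phi> L. 0 \<le> L \<and> (\<forall>x\<in>cube k. (\<Sum>a\<in>X. \<phi> a x) = (1::real)) \<and>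
    (\<forall>a\<in>X. continuous_on (cube k) (\<phi> a)) \<and>
    (\<forall>a\<in>X. \<forall>x\<in>cube k. 0 \<le> \<phi> a x \<and> (\<phi> a x \<noteq> 0 \<longrightarrow> l1dist k a x < d a)) \<and>
    (\<forall>a\<in>X. \<forall>x\<in>cube k. \<forall>y\<in>cube k. \<bar>\<phi> a x - \<phi> a y\<bar> \<le> L * l1dist k x y)"
  proof (rule lipschitz_partition_of_unity[OF X(2)])
    show "d a > 0" if "a \<in> X" for a using that X(1) d by blast
    show "\<exists>a\<in>X. l1dist k a x < d a" if "x \<in> cube k" for x using that X(3) by blast
  qed
  then obtain \<phi> L where L: "0 \<le> L"
    and \<phi>': "\<forall>x\<in>cube k. (\<Sum>a\<in>X. \<phi> a x) = (1::real)" "\<forall>a\<in>X. continuous_on (cube k) (\<phi> a)"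
      "\<forall>a\<in>X. \<forall>x\<in>cube k. 0 \<le> \<phi> a x \<and> (\<phi> a x \<noteq> 0 \<longrightarrow> l1dist k a x < d a)"
      "\<forall>a\<in>X. \<forall>x\<in>cube k. \<forall>y\<in>cube k. \<bar>\<phi> a x - \<phi> a y\<bar> \<le> L * l1dist k x y"
    by (elim exE conjE) (rule that; assumption)
  note \<phi>1 = \<phi>'(1)[rule_format] and \<phi>c = \<phi>'(2)[rule_format] and \<phi>L = \<phi>'(4)[rule_format]
  have \<phi>0: "0 \<le> \<phi> a x" and \<phi>d: "\<phi> a x \<noteq> 0 \<Longrightarrow> l1dist k a x < d a" if "a \<in> X" "x \<in> cube k" for a x
    using \<phi>'(3) that by simp_all
  define G where "G s x i = (\<Sum>a\<in>X. \<phi> a x * s a i)" for s :: "(nat \<Rightarrow> real) \<Rightarrow> nat \<Rightarrow> real" and x i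
  define W where "W = PiE X (\<lambda>a. insert (\<lambda>_. 0) (S a))"
  have Wfin: "finite (G ` W)"
    unfolding W_def using X S by (intro finite_imageI finite_PiE) auto
  have lip: "\<bar>f x i - f y i\<bar> \<le> (L * card X) * l1dist k x y"
    if f: "f \<in> G ` W" and x: "x \<in> cube k" and y: "y \<in> cube k" and i: "i < N" for f x y i
  proof -
    obtain s where s: "s \<in> W" "f = G s" using f by auto
    have s1: "\<bar>s a i\<bar> \<le> 1" if "a \<in> X" for a
    proof -
      have "s a \<in> insert (\<lambda>_. 0) (S a)" using s(1) that by (auto simp: W_def)
      moreover have "S a \<subseteq> cube N" using S X that by auto
      ultimately show ?thesis using i by (auto simp: cube_def subset_iff)
    qed
    have "\<bar>f x i - f y i\<bar> = \<bar>\<Sum>a\<in>X. (\<phi> a x - \<phi> a y) * s a i\<bar>"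
      by (simp add: s(2) G_def left_diff_distrib sum_subtractf)
    also have "\<dots> \<le> (\<Sum>a\<in>X. \<bar>\<phi> a x - \<phi> a y\<bar> * \<bar>s a i\<bar>)"
      by (rule order_trans[OF sum_abs]) (simp add: abs_mult)
    also have "\<dots> \<le> (\<Sum>a\<in>X. (L * l1dist k x y) * 1)"
      using \<phi>L[OF _ x y] s1 L by (intro sum_mono mult_mono) auto
    finally show ?thesis by (simp add: mult_ac)
  qed
  have L': "0 \<le> L * card X" using L by simp
  have "\<exists>p e. e > 0 \<and> (\<forall>i<N. 3 / 8 \<le> p i \<and> p i \<le> 5 / 8) \<and> (\<forall>i\<ge>N. p i = 0) \<and>
    (\<forall>f\<in>G ` W. \<forall>x\<in>cube k. \<exists>i<N. e \<le> \<bar>f x i - p i\<bar>)"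
    by (rule lipschitz_images_avoid_point[where T = "G ` W", OF Wfin kN _ L']) (rule lip; assumption)
  then obtain p e0 where e0: "e0 > 0" and p: "\<forall>i<N. 3 / 8 \<le> p i \<and> p i \<le> 5 / 8" "\<forall>i\<ge>N. p i = 0"
    and avoid: "\<forall>f\<in>G ` W. \<forall>x\<in>cube k. \<exists>i<N. e0 \<le> \<bar>f x i - p i\<bar>"
    by (elim exE conjE) (rule that; assumption)
  have p01: "0 < p i \<and> p i < 1" if "i < N" for i using p(1) that by force
  define \<epsilon> where "\<epsilon> = min e0 (1 / 16)"
  have \<epsilon>: "\<epsilon> > 0" "\<epsilon> \<le> e0" "\<epsilon> \<le> 1 / 16" using e0 by (auto simp: \<epsilon>_def)
  define \<kappa> where "\<kappa> y = min 1 (2 - 2 * cube_gauge N (cube_center N) y)" for y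
  define \<Psi>0 where "\<Psi>0 x y i = y i + \<kappa> y * ((\<Sum>a\<in>X. \<phi> a x * c a y i) - y i)" for x y i
  define \<Psi> where "\<Psi> x y = push_from p (max (cube_gauge N p (\<Psi>0 x y)) \<epsilon>) (\<Psi>0 x y)" for x y
  have \<kappa>01: "0 \<le> \<kappa> y" "\<kappa> y \<le> 1" if "y \<in> cube N" for y
    using cube_gauge_le_1[of N "cube_center N" y] that by (auto simp: \<kappa>_def)
  have \<kappa>b: "\<kappa> y = 0" if "y \<in> cube_boundary N" for y
    using cube_gauge_boundary[of N "cube_center N" y] that by (simp add: \<kappa>_def)
  have \<kappa>1: "\<kappa> y = 1" if "\<forall>i<N. 1 / 4 \<le> y i \<and> y i \<le> 3 / 4" for y
  proof -
    have "cube_gauge N (cube_center N) y \<le> 1 / 2"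
      using that by (subst cube_gauge_le_iff) (auto simp: cube_center_def)
    then show ?thesis by (simp add: \<kappa>_def)
  qed
  have fst_c: "continuous_on (cube k \<times> cube N) (\<lambda>z. f (fst z))" if "continuous_on (cube k) f" for f :: "_ \<Rightarrow> real"
    by (rule continuous_on_compose2[OF that]) (auto intro: continuous_on_fst continuous_on_id)
  have snd_c: "continuous_on (cube k \<times> cube N) (\<lambda>z. f (snd z))" if "continuous_on (cube N) f" for f :: "_ \<Rightarrow> real"
    by (rule continuous_on_compose2[OF that]) (auto intro: continuous_on_snd continuous_on_id)
  have "continuous_on (cube N) \<kappa>"
    unfolding \<kappa>_def by (intro continuous_on_min continuous_on_diff continuous_on_mult continuous_on_const
      continuous_on_cube_gauge continuous_on_coordinate) auto
  then have \<Psi>0c: "continuous_on (cube k \<times> cube N) (\<lambda>z. \<Psi>0 (fst z) (snd z) i)" for i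
    unfolding \<Psi>0_def using X(1) cc \<phi>c
    by (intro continuous_on_add continuous_on_mult continuous_on_diff continuous_on_sum
        snd_c fst_c continuous_on_coordinate) auto
  have w: "(\<lambda>i. \<Sum>a\<in>X. \<phi> a x * c a y i) \<in> cube N" if x: "x \<in> cube k" and y: "y \<in> cube N" for x y
  proof -
    have ca: "c a y \<in> cube N" if "a \<in> X" for a using c[of a y] y X(1) that by auto
    have "(\<Sum>a\<in>X. \<phi> a x * c a y i) \<le> 1" if "i < N" for i
    proof -
      have "(\<Sum>a\<in>X. \<phi> a x * c a y i) \<le> (\<Sum>a\<in>X. \<phi> a x * 1)"
        using ca \<phi>0[OF _ x] that by (intro sum_mono mult_left_mono) (auto simp: cube_def)
      then show ?thesis using \<phi>1[OF x] by simp
    qed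
    moreover have "0 \<le> (\<Sum>a\<in>X. \<phi> a x * c a y i)" if "i < N" for i
      using ca \<phi>0[OF _ x] that by (intro sum_nonneg mult_nonneg_nonneg) (auto simp: cube_def)
    moreover have "(\<Sum>a\<in>X. \<phi> a x * c a y i) = 0" if "N \<le> i" for i
      using ca that by (intro sum.neutral) (auto simp: cube_def)
    ultimately show ?thesis by (simp add: cube_def)
  qed
  have \<Psi>0cube: "\<Psi>0 x y \<in> cube N" if "x \<in> cube k" "y \<in> cube N" for x y
  proof -
    have "\<Psi>0 x y = (\<lambda>i. y i + \<kappa> y * ((\<Sum>a\<in>X. \<phi> a x * c a y i) - y i))" by (simp add: \<Psi>0_def fun_eq_iff)
    then show ?thesis using cube_convex[OF that(2) w[OF that] \<kappa>01[OF that(2)]] by simp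
  qed
  have \<Psi>0near: "\<bar>\<Psi>0 x y i - y i\<bar> \<le> 1 / 16" if x: "x \<in> cube k" and y: "y \<in> cube N" for x y i
  proof -
    have "(\<Sum>a\<in>X. \<phi> a x * c a y i) - y i = (\<Sum>a\<in>X. \<phi> a x * (c a y i - y i))"
      using \<phi>1[OF x] by (simp add: right_diff_distrib sum_subtractf flip: sum_distrib_right)
    also have "\<bar>\<dots>\<bar> \<le> (\<Sum>a\<in>X. \<phi> a x * (1 / 16))"
    proof (rule order_trans[OF sum_abs], rule sum_mono)
      fix a assume a: "a \<in> X"
      have "\<bar>c a y i - y i\<bar> \<le> 1 / 16" using c[of a y] a X(1) y by auto
      then show "\<bar>\<phi> a x * (c a y i - y i)\<bar> \<le> \<phi> a x * (1 / 16)"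
        using \<phi>0[OF a x] by (simp only: abs_mult abs_of_nonneg mult_left_mono)
    qed
    also have "\<dots> = 1 / 16" using \<phi>1[OF x] by (simp flip: sum_divide_distrib)
    finally have *: "\<bar>(\<Sum>a\<in>X. \<phi> a x * c a y i) - y i\<bar> \<le> 1 / 16" .
    have "\<bar>\<Psi>0 x y i - y i\<bar> = \<kappa> y * \<bar>(\<Sum>a\<in>X. \<phi> a x * c a y i) - y i\<bar>"
      using \<kappa>01[OF y] by (simp add: \<Psi>0_def abs_mult)
    also have "\<dots> \<le> 1 * (1 / 16)" using \<kappa>01[OF y] * by (intro mult_mono) auto
    finally show ?thesis by simp
  qed
  have \<Psi>c: "continuous_on (cube k \<times> cube N) (\<lambda>z. \<Psi> (fst z) (snd z) i)" for i
    unfolding \<Psi>_def using \<epsilon>(1) \<Psi>0c p01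
    by (intro continuous_on_push_from continuous_on_max continuous_on_cube_gauge continuous_on_const)
      (auto simp: max_def)
  have \<Psi>cube: "\<Psi> x y \<in> cube N" if "x \<in> cube k" "y \<in> cube N" for x y
    unfolding \<Psi>_def using \<epsilon>(1) p01 p(2) \<Psi>0cube[OF that]
    by (intro push_from_in_cube) auto
  have \<Psi>b: "\<Psi> x y = y" if "x \<in> cube k" "y \<in> cube_boundary N" for x y
  proof -
    have "\<Psi>0 x y = y" by (simp add: \<Psi>0_def \<kappa>b[OF that(2)] fun_eq_iff)
    moreover have "cube_gauge N p y = 1" using p01 that(2) by (intro cube_gauge_boundary) auto
    ultimately show ?thesis using \<epsilon> by (simp add: \<Psi>_def)
  qed
  have "\<tau> (\<lambda>y\<in>cube N. b (\<Psi> x y)) x = B.zero" if x: "x \<in> cube k" and b: "b \<in> carrier (I0_alg N F)" for x b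
  proof -
    interpret R: cell_rep F "findim ns" N "\<lambda>b. \<tau> b x" by (rule rep[OF x])
    have bc: "(\<lambda>y\<in>cube N. b (\<Psi> x y)) \<in> carrier (I0_alg N F)"
    proof (rule I0_compose[OF F b])
      show "continuous_on (cube N) (\<lambda>y. \<Psi> x y i)" for i
      proof -
        have "continuous_on (cube N) (\<lambda>y. (x, y))"
          by (intro continuous_on_Pair continuous_on_const continuous_on_id)
        from continuous_on_compose2[OF \<Psi>c[of i] this] show ?thesis using x by auto
      qed
    qed (use \<Psi>cube[OF x] \<Psi>b[OF x] in auto)
    show ?thesis
    proof (rule R.rho_vanish[of "h ` {a \<in> X. \<phi> a x \<noteq> 0}", OF _ _ _ bc])
      fix g b assume "g \<in> h ` {a \<in> X. \<phi> a x \<noteq> 0}" and b: "b \<in> carrier (I0_alg N F)"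
        and 0: "\<tau> (fun_scale (cube N) F (\<lambda>y. 1 - g y) b) x = B.zero"
      then obtain a where a: "a \<in> X" "\<phi> a x \<noteq> 0" "g = h a" by auto
      have ac: "a \<in> cube k" using a X(1) by auto
      have "cs_norm (findim ns) (\<tau> (u (h a)) x) < 1" using lt[OF ac x \<phi>d[OF a(1) x a(2)]] .
      then show "\<tau> b x = B.zero"
        using R.rho_fun_scale_unit[OF e, of "h a" b] h[OF ac] b 0 a(3) unfolding u_def by auto
    next
      fix y assume y: "y \<in> cube N" and nz: "(\<lambda>y\<in>cube N. b (\<Psi> x y)) y \<noteq> F.zero"
      let ?w = "\<Psi>0 x y"
      have gl: "cube_gauge N p ?w < \<epsilon>"
      proof (rule ccontr)
        assume "\<not> cube_gauge N p ?w < \<epsilon>"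
        then have "\<Psi> x y = push_from p (cube_gauge N p ?w) ?w" "0 < cube_gauge N p ?w"
          using \<epsilon>(1) by (auto simp: \<Psi>_def max_def)
        then have "\<Psi> x y \<in> cube_boundary N"
          using push_from_in_boundary[of N p ?w "cube_gauge N p ?w"] p01 p(2) \<Psi>0cube[OF x y] by auto
        then show False using nz y b by (simp add: I0_carrier)
      qed
      have wp: "\<bar>?w i - p i\<bar> < \<epsilon>" if i: "i < N" for i
      proof -
        have *: "?w i - p i \<le> cube_gauge N p ?w * (1 - p i)" "p i - ?w i \<le> cube_gauge N p ?w * p i"
          using cube_gauge_le_iff[of N p ?w "cube_gauge N p ?w", OF p01] i by auto
        have "cube_gauge N p ?w * (1 - p i) \<le> cube_gauge N p ?w * 1" "cube_gauge N p ?w * p i \<le> cube_gauge N p ?w * 1"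
          using p01[OF i] cube_gauge_ge_0[of N p ?w] by (intro mult_left_mono; simp)+
        then show ?thesis using * gl by linarith
      qed
      have inner: "\<forall>i<N. 1 / 4 \<le> y i \<and> y i \<le> 3 / 4"
      proof (intro allI impI)
        fix i assume i: "i < N"
        have "\<bar>?w i - y i\<bar> \<le> 1 / 16" by (rule \<Psi>0near[OF x y])
        moreover have "3 / 8 \<le> p i \<and> p i \<le> 5 / 8" using p(1) i by blast
        ultimately show "1 / 4 \<le> y i \<and> y i \<le> 3 / 4" using wp[OF i] \<epsilon>(3) by linarith
      qed
      show "\<exists>g\<in>h ` {a \<in> X. \<phi> a x \<noteq> 0}. g y = 1"
      proof (rule ccontr)
        assume no: "\<not> ?thesis"
        define s where "s = (\<lambda>a\<in>X. if \<phi> a x \<noteq> 0 then c a y else (\<lambda>_. 0))"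
        have "s \<in> W"
          unfolding W_def s_def using no cS[OF _ y inner] X(1) by (auto simp: PiE_iff)
        then obtain i where i: "i < N" "e0 \<le> \<bar>G s x i - p i\<bar>" using avoid x by blast
        have "G s x i = (\<Sum>a\<in>X. \<phi> a x * c a y i)"
          unfolding G_def s_def by (rule sum.cong) auto
        then have "G s x i = ?w i" by (simp add: \<Psi>0_def \<kappa>1[OF inner])
        then show False using i wp[OF i(1)] \<epsilon>(2) by simp
      qed
    qed (use X h in auto)
  qed
  then show ?thesis using \<Psi>c \<Psi>cube \<Psi>b by (intro exI[of _ \<Psi>]) auto
qed

section \<open>Homotopies\<close>

abbreviation unit_interval :: "real set" ("\<I>") where "\<I> \<equiv> {0..1}"

definition homotopic_via ::
  "'a cstar \<Rightarrow> 'b cstar \<Rightarrow> ('a \<Rightarrow> 'b \<Rightarrow> bool) \<Rightarrow> ('a \<Rightarrow> 'b) \<Rightarrow> ('a \<Rightarrow> 'b) \<Rightarrow> bool" where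
  "homotopic_via A B R f h \<longleftrightarrow> (\<exists>\<Phi>. star_hom A (C_alg \<I> B) \<Phi> \<and>
     (\<forall>a\<in>carrier A. \<Phi> a 0 = f a \<and> \<Phi> a 1 = h a \<and> (\<forall>t\<in>\<I>. R a (\<Phi> a t))))"

lemma homotopic_viaI:
  assumes A: "normed_star_algebra A"
    and c: "\<And>a. a \<in> carrier A \<Longrightarrow> cs_continuous \<I> B (\<Phi> a)"
    and h: "\<And>t. t \<in> \<I> \<Longrightarrow> star_hom A B (\<lambda>a. \<Phi> a t)"
    and e: "\<And>a. a \<in> carrier A \<Longrightarrow> \<Phi> a 0 = f a" "\<And>a. a \<in> carrier A \<Longrightarrow> \<Phi> a 1 = h a"
    and r: "\<And>a t. a \<in> carrier A \<Longrightarrow> t \<in> \<I> \<Longrightarrow> R a (\<Phi> a t)"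
  shows "homotopic_via A B R f h"
proof -
  have "star_hom A (C_alg \<I> B) (\<lambda>a. restrict (\<Phi> a) \<I>)"
    unfolding star_hom_C_alg_iff[OF A] using c h by (simp add: C_alg_carrier)
  then show ?thesis
    unfolding homotopic_via_def using e r by (intro exI[of _ "\<lambda>a. restrict (\<Phi> a) \<I>"]) auto
qed

lemma homotopic_viaE:
  assumes "homotopic_via A B R f h" and A: "normed_star_algebra A"
  obtains \<Phi> where "\<And>a. a \<in> carrier A \<Longrightarrow> cs_continuous \<I> B (\<Phi> a)"
    "\<And>t. t \<in> \<I> \<Longrightarrow> star_hom A B (\<lambda>a. \<Phi> a t)"
    "\<And>a. a \<in> carrier A \<Longrightarrow> \<Phi> a 0 = f a" "\<And>a. a \<in> carrier A \<Longrightarrow> \<Phi> a 1 = h a"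
    "\<And>a t. a \<in> carrier A \<Longrightarrow> t \<in> \<I> \<Longrightarrow> R a (\<Phi> a t)"
proof -
  obtain \<Phi> where P: "star_hom A (C_alg \<I> B) \<Phi>"
    "\<forall>a\<in>carrier A. \<Phi> a 0 = f a \<and> \<Phi> a 1 = h a \<and> (\<forall>t\<in>\<I>. R a (\<Phi> a t))"
    using assms(1) unfolding homotopic_via_def by blast
  show ?thesis
  proof (rule that[of \<Phi>])
    show "cs_continuous \<I> B (\<Phi> a)" if "a \<in> carrier A" for a
      using star_hom_closed[OF P(1) that] by (simp add: C_alg_carrier)
    show "star_hom A B (\<lambda>a. \<Phi> a t)" if "t \<in> \<I>" for t
      using P(1) that unfolding star_hom_C_alg_iff[OF A] by blast
  qed (use P(2) in auto)
qed

lemma homotopic_via_refl: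
  assumes A: "normed_star_algebra A" and B: "normed_star_algebra B" and f: "star_hom A B f"
    and "\<And>a. a \<in> carrier A \<Longrightarrow> R a (f a)"
  shows "homotopic_via A B R f f"
proof -
  interpret B: normed_star_algebra B by (rule B)
  show ?thesis
    by (rule homotopic_viaI[OF A, of _ "\<lambda>a t. f a"])
      (use assms in \<open>auto intro!: B.cs_continuous_const star_hom_closed[OF f]\<close>)
qed

lemma homotopic_via_mono:
  assumes "homotopic_via A B R f h" "\<And>a v. a \<in> carrier A \<Longrightarrow> R a v \<Longrightarrow> R' a v"
  shows "homotopic_via A B R' f h"
  using assms unfolding homotopic_via_def by fast

lemma homotopic_via_trans:
  assumes A: "normed_star_algebra A" and B: "normed_star_algebra B"
    and fg: "homotopic_via A B R f g" and gh: "homotopic_via A B R g h"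
  shows "homotopic_via A B R f h"
proof -
  interpret B: normed_star_algebra B by (rule B)
  obtain \<Phi> where P: "\<And>a. a \<in> carrier A \<Longrightarrow> cs_continuous \<I> B (\<Phi> a)"
    "\<And>t. t \<in> \<I> \<Longrightarrow> star_hom A B (\<lambda>a. \<Phi> a t)"
    "\<And>a. a \<in> carrier A \<Longrightarrow> \<Phi> a 0 = f a" "\<And>a. a \<in> carrier A \<Longrightarrow> \<Phi> a 1 = g a"
    "\<And>a t. a \<in> carrier A \<Longrightarrow> t \<in> \<I> \<Longrightarrow> R a (\<Phi> a t)"
    using homotopic_viaE[OF fg A] by blast
  obtain \<Psi> where Q: "\<And>a. a \<in> carrier A \<Longrightarrow> cs_continuous \<I> B (\<Psi> a)"
    "\<And>t. t \<in> \<I> \<Longrightarrow> star_hom A B (\<lambda>a. \<Psi> a t)"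
    "\<And>a. a \<in> carrier A \<Longrightarrow> \<Psi> a 0 = g a" "\<And>a. a \<in> carrier A \<Longrightarrow> \<Psi> a 1 = h a"
    "\<And>a t. a \<in> carrier A \<Longrightarrow> t \<in> \<I> \<Longrightarrow> R a (\<Psi> a t)"
    using homotopic_viaE[OF gh A] by blast
  define X where "X a t = (if t \<le> 1 / 2 then \<Phi> a (2 * t) else \<Psi> a (2 * t - 1))" for a and t :: real
  show ?thesis
  proof (rule homotopic_viaI[OF A, of _ X])
    fix a assume a: "a \<in> carrier A"
    have "cs_continuous {0..1/2} B (\<lambda>t. \<Phi> a (2 * t))"
      by (rule B.cs_continuous_compose[OF P(1)[OF a]]) (auto intro!: continuous_intros)
    moreover have "cs_continuous {0..1/2} B (X a) \<longleftrightarrow> cs_continuous {0..1/2} B (\<lambda>t. \<Phi> a (2 * t))"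
      by (rule cs_continuous_cong) (simp add: X_def)
    moreover have "cs_continuous {1/2..1} B (\<lambda>t. \<Psi> a (2 * t - 1))"
      by (rule B.cs_continuous_compose[OF Q(1)[OF a]]) (auto intro!: continuous_intros)
    moreover have "cs_continuous {1/2..1} B (X a) \<longleftrightarrow> cs_continuous {1/2..1} B (\<lambda>t. \<Psi> a (2 * t - 1))"
    proof (rule cs_continuous_cong)
      fix t :: real assume t: "t \<in> {1/2..1}"
      show "X a t = \<Psi> a (2 * t - 1)"
      proof (cases "t = 1 / 2")
        case True
        show ?thesis unfolding True using P(4)[OF a] Q(3)[OF a] by (simp add: X_def)
      qed (use t in \<open>simp add: X_def\<close>)
    qed
    ultimately have "cs_continuous ({0..1/2} \<union> {1/2..1}) B (X a)"
      by (intro cs_continuous_Un) auto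
    moreover have "{0..1/2} \<union> {1/2..1} = \<I>" by auto
    ultimately show "cs_continuous \<I> B (X a)" by simp
    show "X a 0 = f a" "X a 1 = h a" using P(3) Q(4) a by (auto simp: X_def)
    fix t :: real assume t: "t \<in> \<I>"
    show "R a (X a t)"
    proof (cases "t \<le> 1 / 2")
      case True
      then show ?thesis using P(5)[OF a, of "2 * t"] t by (simp add: X_def)
    next
      case False
      then show ?thesis using Q(5)[OF a, of "2 * t - 1"] t by (simp add: X_def)
    qed
  next
    fix t :: real assume t: "t \<in> \<I>"
    show "star_hom A B (\<lambda>a. X a t)"
    proof (cases "t \<le> 1 / 2")
      case True
      then show ?thesis using P(2)[of "2 * t"] t by (simp add: X_def)
    next
      case False
      then show ?thesis using Q(2)[of "2 * t - 1"] t by (simp add: X_def)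
    qed
  qed
qed

lemma homotopic_via_precompose:
  assumes A: "normed_star_algebra A" and C: "normed_star_algebra C"
    and fh: "homotopic_via A B R f h" and p: "star_hom C A p"
  shows "homotopic_via C B (\<lambda>c. R (p c)) (\<lambda>c. f (p c)) (\<lambda>c. h (p c))"
proof -
  obtain \<Phi> where P: "\<And>a. a \<in> carrier A \<Longrightarrow> cs_continuous \<I> B (\<Phi> a)"
    "\<And>t. t \<in> \<I> \<Longrightarrow> star_hom A B (\<lambda>a. \<Phi> a t)"
    "\<And>a. a \<in> carrier A \<Longrightarrow> \<Phi> a 0 = f a" "\<And>a. a \<in> carrier A \<Longrightarrow> \<Phi> a 1 = h a"
    "\<And>a t. a \<in> carrier A \<Longrightarrow> t \<in> \<I> \<Longrightarrow> R a (\<Phi> a t)"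
    using homotopic_viaE[OF fh A] by blast
  show ?thesis
    by (rule homotopic_viaI[OF C, of _ "\<lambda>c. \<Phi> (p c)"])
      (use P star_hom_closed[OF p] star_hom_compose[OF p P(2)] in auto)
qed

lemma cs_continuous_lipschitz:
  assumes B: "normed_star_algebra B" and C: "normed_star_algebra C"
    and q: "\<And>b. b \<in> carrier B \<Longrightarrow> q b \<in> carrier C"
    and lip: "\<And>b b'. b \<in> carrier B \<Longrightarrow> b' \<in> carrier B \<Longrightarrow> cs_dist C (q b) (q b') \<le> K * cs_dist B b b'"
    and g: "cs_continuous X B g"
  shows "cs_continuous X C (\<lambda>x. q (g x))"
proof -
  interpret B: normed_star_algebra B by (rule B)
  interpret C: normed_star_algebra C by (rule C)
  have gc: "g x \<in> carrier B" if "x \<in> X" for x using g that by (rule cs_continuous_closed)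
  show ?thesis
  proof (rule C.cs_continuousI)
    fix x assume x: "x \<in> X"
    have "continuous_on X (\<lambda>y. K * cs_dist B (g y) (g x))"
      by (intro continuous_on_mult continuous_on_const B.continuous_on_cs_dist_const g gc x)
    then show "\<exists>u. continuous_on X u \<and> u x = 0 \<and> (\<forall>y\<in>X. cs_dist C (q (g y)) (q (g x)) \<le> u y)"
      using lip gc x by (intro exI[of _ "\<lambda>y. K * cs_dist B (g y) (g x)"]) auto
  qed (use q gc in auto)
qed

section \<open>Homotopy extension for a cell\<close>

text \<open>
  Radial retraction of \<open>\<I> \<times> cube k\<close> onto \<open>{0} \<times> cube k \<union> \<I> \<times> cube_boundary k\<close>, projecting from
  the point \<open>(2, cube_center k)\<close>.
\<close>

definition hep_scale :: "nat \<Rightarrow> real \<Rightarrow> (nat \<Rightarrow> real) \<Rightarrow> real" where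
  "hep_scale k t x = max (cube_gauge k (cube_center k) x) (1 - t / 2)"

definition hep_time :: "nat \<Rightarrow> real \<Rightarrow> (nat \<Rightarrow> real) \<Rightarrow> real" where
  "hep_time k t x = 2 - (2 - t) / hep_scale k t x"

definition hep_point :: "nat \<Rightarrow> real \<Rightarrow> (nat \<Rightarrow> real) \<Rightarrow> nat \<Rightarrow> real" where
  "hep_point k t x = push_from (cube_center k) (hep_scale k t x) x"

definition hep_extend ::
  "nat \<Rightarrow> ((nat \<Rightarrow> real) \<Rightarrow> 'a) \<Rightarrow> (real \<Rightarrow> (nat \<Rightarrow> real) \<Rightarrow> 'a) \<Rightarrow> real \<Rightarrow> (nat \<Rightarrow> real) \<Rightarrow> 'a" where
  "hep_extend k u w t = (\<lambda>x\<in>cube k. if hep_time k t x = 0 then u (hep_point k t x)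
     else w (hep_time k t x) (hep_point k t x))"

lemma hep_retraction:
  assumes t: "t \<in> \<I>" and x: "x \<in> cube k"
  shows "hep_point k t x \<in> cube k" "hep_time k t x \<in> \<I>"
    and "hep_time k t x \<noteq> 0 \<Longrightarrow> hep_point k t x \<in> cube_boundary k"
proof -
  let ?g = "cube_gauge k (cube_center k) x" and ?s = "hep_scale k t x"
  have s: "1 - t / 2 \<le> ?s" "?g \<le> ?s" "?s \<le> 1" "1 / 2 \<le> ?s"
    using cube_gauge_le_1[of k "cube_center k" x] x t by (auto simp: hep_scale_def max_def)
  show "hep_point k t x \<in> cube k"
    unfolding hep_point_def using s x by (intro push_from_in_cube) auto
  have "(2 - t) / ?s \<le> 2" "1 \<le> (2 - t) / ?s"
    using s t by (auto simp: pos_divide_le_eq pos_le_divide_eq)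
  then show "hep_time k t x \<in> \<I>" by (simp add: hep_time_def)
  show "hep_point k t x \<in> cube_boundary k" if "hep_time k t x \<noteq> 0"
  proof -
    have "?s \<noteq> 1 - t / 2"
    proof
      assume eq: "?s = 1 - t / 2"
      have "(2 - t) / (1 - t / 2) = 2" using t by (simp add: field_simps)
      then show False using that eq by (simp add: hep_time_def)
    qed
    then have "?s = ?g" by (auto simp: hep_scale_def max_def split: if_splits)
    then show ?thesis
      unfolding hep_point_def using s x by (intro push_from_in_boundary) auto
  qed
qed

lemma hep_time_0: "x \<in> cube k \<Longrightarrow> hep_time k 0 x = 0 \<and> hep_point k 0 x = x"
  using cube_gauge_le_1[of k "cube_center k" x]
  by (simp add: hep_time_def hep_point_def hep_scale_def max_def)

lemma hep_boundary:
  assumes "t \<in> \<I>" "x \<in> cube_boundary k"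
  shows "hep_time k t x = t \<and> hep_point k t x = x"
proof -
  have "hep_scale k t x = 1"
    using cube_gauge_boundary[of k "cube_center k" x] assms by (auto simp: hep_scale_def max_def)
  then show ?thesis by (simp add: hep_time_def hep_point_def)
qed

lemma hep_extend_0: "u \<in> extensional (cube k) \<Longrightarrow> hep_extend k u w 0 = u"
  by (rule C_alg_eqI[where X = "cube k"]) (auto simp: hep_extend_def hep_time_0)

lemma hep_extend_boundary:
  assumes "t \<in> \<I>" "x \<in> cube_boundary k" "w 0 x = u x"
  shows "hep_extend k u w t x = w t x"
  using assms hep_boundary[OF assms(1,2)] cube_boundary_subset[of k] by (auto simp: hep_extend_def)

lemma hep_extend_continuous:
  assumes F: "normed_star_algebra F" and k: "1 \<le> k"
    and u: "cs_continuous (cube k) F u"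
    and w: "cs_continuous \<I> (C_alg (cube_boundary k) F) w"
    and eq: "\<And>x. x \<in> cube_boundary k \<Longrightarrow> w 0 x = u x"
  shows "cs_continuous \<I> (C_alg (cube k) F) (hep_extend k u w)"
proof -
  interpret F: normed_star_algebra F by (rule F)
  let ?B = "cube_boundary k" and ?D = "({0::real} \<times> cube k) \<union> (\<I> \<times> cube_boundary k)"
  define E where "E = (\<lambda>(s, z). if s = 0 then u z else w s z)"
  have "cs_continuous ({0::real} \<times> cube k) F (\<lambda>z. u (snd z))"
    by (rule F.cs_continuous_compose[OF u]) (auto intro: continuous_on_snd continuous_on_id)
  moreover have "cs_continuous ({0::real} \<times> cube k) F E \<longleftrightarrow> cs_continuous ({0::real} \<times> cube k) F (\<lambda>z. u (snd z))"
    by (rule cs_continuous_cong) (auto simp: E_def)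
  moreover have "cs_continuous (\<I> \<times> ?B) F (\<lambda>(s, z). w s z)"
    by (rule F.cs_continuous_uncurry[OF compact_cube_boundary cube_boundary_nonempty[OF k] w])
  moreover have "cs_continuous (\<I> \<times> ?B) F E \<longleftrightarrow> cs_continuous (\<I> \<times> ?B) F (\<lambda>(s, z). w s z)"
    by (rule cs_continuous_cong) (auto simp: E_def eq)
  ultimately have E: "cs_continuous ?D F E"
    by (intro cs_continuous_Un closed_Times closed_cube closed_cube_boundary) auto
  have fst: "continuous_on (\<I> \<times> cube k) (\<lambda>v. fst v)"
    by (intro continuous_on_fst continuous_on_id)
  have snd: "continuous_on (\<I> \<times> cube k) (\<lambda>v. snd v i)" for i
    by (rule continuous_on_product_then_coordinatewise[OF continuous_on_snd[OF continuous_on_id]])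
  have sc: "continuous_on (\<I> \<times> cube k) (\<lambda>v. hep_scale k (fst v) (snd v))"
    unfolding hep_scale_def
    by (intro continuous_on_max continuous_on_cube_gauge continuous_on_diff continuous_on_divide
        continuous_on_const fst snd) auto
  have s0: "hep_scale k (fst v) (snd v) \<noteq> 0" if "v \<in> \<I> \<times> cube k" for v
    using that by (auto simp: hep_scale_def max_def)
  have "continuous_on (\<I> \<times> cube k) (\<lambda>v. (hep_time k (fst v) (snd v), hep_point k (fst v) (snd v)))"
  proof (rule continuous_on_Pair)
    show "continuous_on (\<I> \<times> cube k) (\<lambda>v. hep_time k (fst v) (snd v))"
      unfolding hep_time_def
      by (intro continuous_on_diff continuous_on_divide continuous_on_const fst sc ballI s0)
    show "continuous_on (\<I> \<times> cube k) (\<lambda>v. hep_point k (fst v) (snd v))"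
      unfolding hep_point_def
      by (intro continuous_on_coordinatewise_then_product continuous_on_push_from snd sc s0)
  qed
  then have "cs_continuous (\<I> \<times> cube k) F (\<lambda>v. E (hep_time k (fst v) (snd v), hep_point k (fst v) (snd v)))"
  proof (rule F.cs_continuous_compose[OF E])
    fix v assume "v \<in> \<I> \<times> cube k"
    then have "fst v \<in> \<I>" "snd v \<in> cube k" by auto
    from hep_retraction[OF this]
    show "(hep_time k (fst v) (snd v), hep_point k (fst v) (snd v)) \<in> ?D"
      by (cases "hep_time k (fst v) (snd v) = 0") simp_all
  qed
  then have "cs_continuous (\<I> \<times> cube k) F (\<lambda>(t, x). E (hep_time k t x, hep_point k t x))"
    by (simp add: split_def)
  from F.cs_continuous_curry[OF compact_cube cube_nonempty this]
  show ?thesis by (simp add: E_def hep_extend_def[abs_def])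
qed

section \<open>Maps out of and into a pullback\<close>

lemma star_hom_skel: "star_hom (pullback_alg k F \<sigma> A) A skel"
  by (rule star_homI) (auto elim: pullback_cases)

lemma star_hom_Cell:
  assumes g: "star_hom A (C_alg (cube k) F) g" and f: "star_hom A B f"
    and eq: "\<And>a. a \<in> carrier A \<Longrightarrow> restrict (g a) (cube_boundary k) = \<sigma> (f a)"
  shows "star_hom A (pullback_alg k F \<sigma> B) (\<lambda>a. Cell (g a) (f a))"
  by (rule star_homI)
    (simp_all add: pullback_carrier eq star_hom_closed[OF g] star_hom_closed[OF f]
      star_hom_add[OF g] star_hom_add[OF f] star_hom_mult[OF g] star_hom_mult[OF f]
      star_hom_scale[OF g] star_hom_scale[OF f] star_hom_star[OF g] star_hom_star[OF f])

lemma star_hom_cell: "star_hom (pullback_alg k F \<sigma> A) (C_alg (cube k) F) cell"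
  by (rule star_homI) (auto elim: pullback_cases)

lemma pullback_restrict_cell:
  "c \<in> carrier (pullback_alg k F \<sigma> A) \<Longrightarrow> restrict (cell c) (cube_boundary k) = \<sigma> (skel c)"
  by (auto elim: pullback_cases)

lemma pullback_collapse: "c \<in> carrier (pullback_alg k F \<sigma> A) \<Longrightarrow> Cell (cell c) (skel c) = c"
  by (auto elim: pullback_cases)

lemma cs_dist_pullback [simp]:
  "cs_dist (pullback_alg k F \<sigma> A) x y = max (cs_dist (C_alg (cube k) F) (cell x) (cell y)) (cs_dist A (skel x) (skel y))"
  by (simp add: cs_dist_def)

locale nccw_step = F: normed_star_algebra F + A: normed_star_algebra A
  for F :: "fd cstar" and A :: "nccw_elt cstar" +
  fixes k :: nat and \<sigma> :: "nccw_elt \<Rightarrow> (nat \<Rightarrow> real) \<Rightarrow> fd"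
  assumes k: "1 \<le> k" and connecting: "star_hom A (S_alg k F) \<sigma>"
begin

abbreviation "P \<equiv> pullback_alg k F \<sigma> A"

lemma normed_P: "normed_star_algebra P"
  using F.normed_star_algebra_axioms A.normed_star_algebra_axioms connecting
  by (rule normed_star_algebra_pullback)

sublocale C: normed_star_algebra "C_alg (cube k) F"
  by (rule F.normed_star_algebra_C_alg[OF compact_cube cube_nonempty])

sublocale S: normed_star_algebra "C_alg (cube_boundary k) F"
  by (rule F.normed_star_algebra_C_alg[OF compact_cube_boundary cube_boundary_nonempty[OF k]])

sublocale P: normed_star_algebra P by (rule normed_P)

lemma connecting': "star_hom A (C_alg (cube_boundary k) F) \<sigma>"
  using connecting by (simp add: S_alg_def)

lemma connecting_zero: "\<sigma> A.zero = (\<lambda>x\<in>cube_boundary k. F.zero)"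
  using star_hom_zero[OF A.normed_star_algebra_axioms S.normed_star_algebra_axioms connecting']
    F.C_alg_zero[OF compact_cube_boundary cube_boundary_nonempty[OF k]] by simp

lemma cs_continuous_Cell:
  assumes g: "cs_continuous U (C_alg (cube k) F) g" and f: "cs_continuous U A f"
    and eq: "\<And>u. u \<in> U \<Longrightarrow> restrict (g u) (cube_boundary k) = \<sigma> (f u)"
  shows "cs_continuous U P (\<lambda>u. Cell (g u) (f u))"
proof (rule P.cs_continuousI)
  fix u assume u: "u \<in> U"
  let ?d = "\<lambda>v. max (cs_dist (C_alg (cube k) F) (g v) (g u)) (cs_dist A (f v) (f u))"
  have "continuous_on U ?d"
    by (intro continuous_on_max C.continuous_on_cs_dist_const A.continuous_on_cs_dist_const g f
        cs_continuous_closed[OF g u] cs_continuous_closed[OF f u])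
  then show "\<exists>d. continuous_on U d \<and> d u = 0 \<and> (\<forall>v\<in>U. cs_dist P (Cell (g v) (f v)) (Cell (g u) (f u)) \<le> d v)"
    using cs_continuous_closed[OF g u] cs_continuous_closed[OF f u] by (intro exI[of _ ?d]) simp
qed (use g f eq in \<open>auto simp: pullback_carrier intro: cs_continuous_closed\<close>)

lemma skel_surjective:
  assumes a: "a \<in> carrier A"
  shows "\<exists>c\<in>carrier P. skel c = a"
proof -
  have sa: "\<sigma> a \<in> carrier (C_alg (cube_boundary k) F)" by (rule star_hom_closed[OF connecting' a])
  define w where "w t = cs_scale (C_alg (cube_boundary k) F) (of_real t) (\<sigma> a)" for t :: real
  have w: "cs_continuous \<I> (C_alg (cube_boundary k) F) w"
    unfolding w_def by (intro S.cs_continuous_scale S.cs_continuous_const sa continuous_on_of_real continuous_on_id)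
  define g where "g = hep_extend k (\<lambda>x. F.zero) w"
  have eq: "w 0 x = F.zero" if "x \<in> cube_boundary k" for x
    using that C_alg_closed[OF sa that] by (simp add: w_def)
  have "cs_continuous \<I> (C_alg (cube k) F) g"
    unfolding g_def
    by (rule hep_extend_continuous[OF F.normed_star_algebra_axioms k F.cs_continuous_const w eq]) simp_all
  then have g1: "g 1 \<in> carrier (C_alg (cube k) F)" by (rule cs_continuous_closed) simp
  have "restrict (g 1) (cube_boundary k) = \<sigma> a"
  proof (rule C_alg_eqI[where X = "cube_boundary k"])
    fix x assume x: "x \<in> cube_boundary k"
    have "g 1 x = w 1 x" unfolding g_def by (rule hep_extend_boundary) (use x eq in auto)
    then show "restrict (g 1) (cube_boundary k) x = \<sigma> a x"
      using x C_alg_closed[OF sa x] by (simp add: w_def)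
  qed (use sa in \<open>simp_all add: C_alg_carrier\<close>)
  then show ?thesis using g1 a by (intro bexI[of _ "Cell (g 1) a"]) (auto simp: pullback_carrier)
qed

lemma eq_if_skel_eq:
  assumes B: "normed_star_algebra B" and f: "star_hom P B f"
    and ker: "\<And>c. c \<in> carrier P \<Longrightarrow> skel c = A.zero \<Longrightarrow> f c = cs_zero B"
    and c: "c \<in> carrier P" "d \<in> carrier P" "skel c = skel d"
  shows "f c = f d"
proof -
  interpret B: normed_star_algebra B by (rule B)
  have "skel (P.add c (P.scale (-1) d)) = A.zero"
    using c star_hom_closed[OF star_hom_skel c(2)] by simp
  then have "f (P.add c (P.scale (-1) d)) = B.zero"
    by (rule ker[OF P.add_closed[OF c(1) P.scale_closed[OF c(2)]]])
  then have "B.add (f c) (B.scale (-1) (f d)) = B.zero"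
    using star_hom_add[OF f c(1) P.scale_closed[OF c(2)]] star_hom_scale[OF f c(2)] by metis
  then show ?thesis
    by (rule B.minus_eq_zeroD[OF star_hom_closed[OF f c(1)] star_hom_closed[OF f c(2)]])
qed

lemma factor_through_skel:
  assumes B: "normed_star_algebra B" and f: "star_hom P B f"
    and ker: "\<And>c. c \<in> carrier P \<Longrightarrow> skel c = A.zero \<Longrightarrow> f c = cs_zero B"
  shows "\<exists>f'. star_hom A B f' \<and> (\<forall>c\<in>carrier P. f c = f' (skel c))"
proof -
  obtain s where s: "\<And>a. a \<in> carrier A \<Longrightarrow> s a \<in> carrier P" "\<And>a. a \<in> carrier A \<Longrightarrow> skel (s a) = a"
    using skel_surjective by metis
  have fs: "f c = f (s (skel c))" if "c \<in> carrier P" for c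
  proof (rule eq_if_skel_eq[OF B f ker that])
    have "skel c \<in> carrier A" by (rule star_hom_closed[OF star_hom_skel that])
    then show "s (skel c) \<in> carrier P" "skel c = skel (s (skel c))" using s by simp_all
  qed
  have "star_hom A B (\<lambda>a. f (s a))"
  proof (rule star_homI)
    fix x y assume x: "x \<in> carrier A" and y: "y \<in> carrier A"
    show "f (s (A.add x y)) = cs_add B (f (s x)) (f (s y))"
      using fs[OF P.add_closed[OF s(1)[OF x] s(1)[OF y]]] s x y star_hom_add[OF f s(1)[OF x] s(1)[OF y]] by simp
    show "f (s (A.mult x y)) = cs_mult B (f (s x)) (f (s y))"
      using fs[OF P.mult_closed[OF s(1)[OF x] s(1)[OF y]]] s x y star_hom_mult[OF f s(1)[OF x] s(1)[OF y]] by simp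
  next
    fix x assume x: "x \<in> carrier A"
    show "f (s x) \<in> carrier B" using star_hom_closed[OF f s(1)[OF x]] .
    show "f (s (A.scale r x)) = cs_scale B r (f (s x))" for r
      using fs[OF P.scale_closed[OF s(1)[OF x]], of r] s x star_hom_scale[OF f s(1)[OF x]] by simp
    show "f (s (cs_star A x)) = cs_star B (f (s x))"
      using fs[OF P.star_closed[OF s(1)[OF x]]] s x star_hom_star[OF f s(1)[OF x]] by simp
  qed
  then show ?thesis using fs by blast
qed

lemma star_hom_I0_Cell: "star_hom (I0_alg k F) P (\<lambda>b. Cell b A.zero)"
proof (rule star_homI)
  fix b assume b: "b \<in> carrier (I0_alg k F)"
  have "restrict b (cube_boundary k) = \<sigma> A.zero"
    unfolding connecting_zero using b by (auto simp: I0_carrier restrict_def fun_eq_iff)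
  then show "Cell b A.zero \<in> carrier P" using b by (simp add: pullback_carrier I0_carrier)
qed simp_all

lemma I0_if_skel_zero:
  assumes "c \<in> carrier P" "skel c = A.zero"
  shows "cell c \<in> carrier (I0_alg k F)"
proof -
  have "restrict (cell c) (cube_boundary k) = (\<lambda>x\<in>cube_boundary k. F.zero)"
    using pullback_restrict_cell[OF assms(1)] assms(2) connecting_zero by simp
  then have "cell c x = F.zero" if "x \<in> cube_boundary k" for x
    using that by (metis restrict_apply)
  then show ?thesis using star_hom_closed[OF star_hom_cell assms(1)] by (simp add: I0_carrier)
qed

definition reparam :: "((nat \<Rightarrow> real) \<Rightarrow> nat \<Rightarrow> real) \<Rightarrow> nccw_elt \<Rightarrow> nccw_elt" where
  "reparam p c = Cell (\<lambda>y\<in>cube k. cell c (p y)) (skel c)"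

lemma star_hom_reparam:
  assumes p: "continuous_on (cube k) p" "\<And>y. y \<in> cube k \<Longrightarrow> p y \<in> cube k"
    "\<And>y. y \<in> cube_boundary k \<Longrightarrow> p y = y"
  shows "star_hom P P (reparam p)"
  unfolding reparam_def
proof (rule star_hom_Cell[OF _ star_hom_skel])
  have cc: "(\<lambda>y\<in>cube k. cell c (p y)) \<in> carrier (C_alg (cube k) F)" if "c \<in> carrier P" for c
  proof -
    have "cs_continuous (cube k) F (cell c)"
      using star_hom_closed[OF star_hom_cell that] by (simp add: C_alg_carrier)
    from F.cs_continuous_compose[OF this p(1,2)] show ?thesis by (simp add: C_alg_carrier)
  qed
  have "star_hom P F (\<lambda>c. cell c (p y))" if "y \<in> cube k" for y
    using star_hom_cell[of k F \<sigma> A] p(2)[OF that] unfolding star_hom_C_alg_iff[OF normed_P] by blast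
  then show "star_hom P (C_alg (cube k) F) (\<lambda>c. \<lambda>y\<in>cube k. cell c (p y))"
    unfolding star_hom_C_alg_iff[OF normed_P] using cc by simp
  fix c assume c: "c \<in> carrier P"
  show "restrict (\<lambda>y\<in>cube k. cell c (p y)) (cube_boundary k) = \<sigma> (skel c)"
    unfolding pullback_restrict_cell[OF c, symmetric]
    by (rule restrict_ext) (simp add: p(3) subsetD[OF cube_boundary_subset])
qed

lemma push_off_cell:
  assumes e: "e \<in> carrier F" "\<And>x. x \<in> carrier F \<Longrightarrow> cs_mult F e x = x"
    and j: "j < k" and g: "star_hom P (C_alg (cube j) (findim ns)) g"
  shows "\<exists>g'. star_hom A (C_alg (cube j) (findim ns)) g' \<and>
    homotopic_via P (C_alg (cube j) (findim ns))
      (\<lambda>c v. \<forall>x\<in>cube j. (\<forall>d\<in>carrier P. skel d = A.zero \<longrightarrow> g d x = cs_zero (findim ns)) \<longrightarrow> v x = g c x)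
      g (\<lambda>c. g' (skel c))"
proof -
  let ?E = "findim ns"
  interpret E: normed_star_algebra ?E by (rule normed_star_algebra_findim)
  interpret D: normed_star_algebra "C_alg (cube j) ?E"
    by (rule E.normed_star_algebra_C_alg[OF compact_cube cube_nonempty])
  have gx: "star_hom P ?E (\<lambda>c. g c x)" if "x \<in> cube j" for x
    using g that unfolding star_hom_C_alg_iff[OF normed_P] by blast
  have gc: "cs_continuous (cube j) ?E (g c)" and ge: "g c \<in> extensional (cube j)" if "c \<in> carrier P" for c
    using star_hom_closed[OF g that] by (simp_all add: C_alg_carrier)
  have "\<exists>\<Psi>. (\<forall>i. continuous_on (cube j \<times> cube k) (\<lambda>z. \<Psi> (fst z) (snd z) i)) \<and>
    (\<forall>x\<in>cube j. \<forall>y\<in>cube k. \<Psi> x y \<in> cube k) \<and>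
    (\<forall>x\<in>cube j. \<forall>y\<in>cube_boundary k. \<Psi> x y = y) \<and>
    (\<forall>x\<in>cube j. \<forall>b\<in>carrier (I0_alg k F). g (Cell (\<lambda>y\<in>cube k. b (\<Psi> x y)) A.zero) x = E.zero)"
  proof (rule cell_deformation[OF F.normed_star_algebra_axioms e j])
    show "star_hom (I0_alg k F) ?E (\<lambda>b. g (Cell b A.zero) x)" if "x \<in> cube j" for x
      by (rule star_hom_compose[OF star_hom_I0_Cell gx[OF that]])
    show "cs_continuous (cube j) ?E (g (Cell b A.zero))" if "b \<in> carrier (I0_alg k F)" for b
      by (rule gc[OF star_hom_closed[OF star_hom_I0_Cell that]])
  qed
  then obtain \<Psi> where \<Psi>: "\<forall>i. continuous_on (cube j \<times> cube k) (\<lambda>z. \<Psi> (fst z) (snd z) i)"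
    "\<forall>x\<in>cube j. \<forall>y\<in>cube k. \<Psi> x y \<in> cube k"
    "\<forall>x\<in>cube j. \<forall>y\<in>cube_boundary k. \<Psi> x y = y"
    "\<forall>x\<in>cube j. \<forall>b\<in>carrier (I0_alg k F). g (Cell (\<lambda>y\<in>cube k. b (\<Psi> x y)) A.zero) x = E.zero"
    by (elim exE conjE) (rule that; assumption)
  define H where "H t x y = (\<lambda>i. y i + t * (\<Psi> x y i - y i))" for t :: real and x and y :: "nat \<Rightarrow> real"
  let ?U = "\<I> \<times> cube j"
  have Hcube: "H t x y \<in> cube k" if "t \<in> \<I>" "x \<in> cube j" "y \<in> cube k" for t x y
    unfolding H_def using that \<Psi>(2) by (intro cube_convex) auto
  have Hb: "H t x y = y" if "x \<in> cube j" "y \<in> cube_boundary k" for t x y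
    using that \<Psi>(3) by (auto simp: H_def)
  have Hc: "continuous_on (?U \<times> cube k) (\<lambda>z. H (fst (fst z)) (snd (fst z)) (snd z))"
  proof (rule continuous_on_coordinatewise_then_product)
    fix i
    have "continuous_on (?U \<times> cube k) (\<lambda>z. (snd (fst z), snd z))"
      by (intro continuous_on_Pair continuous_on_fst continuous_on_snd continuous_on_id)
    moreover have "(\<lambda>z. (snd (fst z), snd z)) ` (?U \<times> cube k) \<subseteq> cube j \<times> cube k" by auto
    ultimately have "continuous_on (?U \<times> cube k) (\<lambda>z. \<Psi> (snd (fst z)) (snd z) i)"
      using continuous_on_compose2[OF \<Psi>(1)[rule_format, of i], of "?U \<times> cube k" "\<lambda>z. (snd (fst z), snd z)"]
      by simp
    moreover have "continuous_on (?U \<times> cube k) (\<lambda>z. snd z i)"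
      by (rule continuous_on_product_then_coordinatewise[OF continuous_on_snd[OF continuous_on_id]])
    moreover have "continuous_on (?U \<times> cube k) (\<lambda>z. fst (fst z))"
      by (intro continuous_on_fst continuous_on_id)
    ultimately show "continuous_on (?U \<times> cube k) (\<lambda>z. H (fst (fst z)) (snd (fst z)) (snd z) i)"
      unfolding H_def by (intro continuous_on_add continuous_on_mult continuous_on_diff)
  qed
  have Hc1: "continuous_on (cube k) (H t x)" if "t \<in> \<I>" "x \<in> cube j" for t x
  proof -
    have "continuous_on (cube k) (\<lambda>y. ((t, x), y))"
      by (intro continuous_on_Pair continuous_on_const continuous_on_id)
    moreover have "(\<lambda>y. ((t, x), y)) ` cube k \<subseteq> ?U \<times> cube k" using that by auto
    ultimately show ?thesis
      using continuous_on_compose2[OF Hc, of "cube k" "\<lambda>y. ((t, x), y)"] by simp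
  qed
  have rp: "star_hom P P (reparam (H t x))" if "t \<in> \<I>" "x \<in> cube j" for t x
    using Hc1[OF that] Hcube[OF that] Hb[OF that(2)] by (rule star_hom_reparam)
  define \<Phi> where "\<Phi> c t = (\<lambda>x\<in>cube j. g (reparam (H t x) c) x)" for c t
  have \<Phi>c: "cs_continuous \<I> (C_alg (cube j) ?E) (\<Phi> c)" if c: "c \<in> carrier P" for c
  proof -
    have cc: "cs_continuous (cube k) F (cell c)"
      using star_hom_closed[OF star_hom_cell c] by (simp add: C_alg_carrier)
    have "cs_continuous (?U \<times> cube k) F (\<lambda>z. cell c (H (fst (fst z)) (snd (fst z)) (snd z)))"
      by (rule F.cs_continuous_compose[OF cc Hc]) (use Hcube in \<open>simp add: mem_Times_iff\<close>)
    then have "cs_continuous (?U \<times> cube k) F (\<lambda>(u, y). cell c (H (fst u) (snd u) y))"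
      by (simp add: split_def)
    from F.cs_continuous_curry[OF compact_cube cube_nonempty this]
    have "cs_continuous ?U (C_alg (cube k) F) (\<lambda>u. \<lambda>y\<in>cube k. cell c (H (fst u) (snd u) y))" .
    then have "cs_continuous ?U P (\<lambda>u. Cell (\<lambda>y\<in>cube k. cell c (H (fst u) (snd u) y)) (skel c))"
    proof (rule cs_continuous_Cell)
      show "cs_continuous ?U A (\<lambda>u. skel c)"
        by (rule A.cs_continuous_const[OF star_hom_closed[OF star_hom_skel c]])
      fix u assume "u \<in> ?U"
      then have "reparam (H (fst u) (snd u)) c \<in> carrier P"
        by (intro star_hom_closed[OF rp c]) auto
      then show "restrict (\<lambda>y\<in>cube k. cell c (H (fst u) (snd u) y)) (cube_boundary k) = \<sigma> (skel c)"
        by (simp add: reparam_def pullback_carrier)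
    qed
    then have rc: "cs_continuous ?U P (\<lambda>u. reparam (H (fst u) (snd u)) c)" by (simp add: reparam_def)
    have "cs_continuous ?U ?E (\<lambda>u. g (reparam (H (fst u) (snd u)) c) (snd u))"
    proof (rule E.cs_continuousI)
      fix u assume u: "u \<in> ?U"
      let ?r = "\<lambda>u. reparam (H (fst u) (snd u)) c"
      have r: "?r v \<in> carrier P" if "v \<in> ?U" for v using cs_continuous_closed[OF rc that] .
      show "g (?r u) (snd u) \<in> carrier ?E"
        using star_hom_closed[OF gx r[OF u]] u by auto
      let ?d = "\<lambda>v. findim_hom_bound ns * cs_dist P (?r v) (?r u) + cs_dist ?E (g (?r u) (snd v)) (g (?r u) (snd u))"
      have gr: "cs_continuous ?U ?E (\<lambda>v. g (?r u) (snd v))"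
        by (rule E.cs_continuous_compose[OF gc[OF r[OF u]]]) (auto intro: continuous_on_snd continuous_on_id)
      have cgr: "g (?r u) (snd v) \<in> carrier ?E" if "v \<in> ?U" for v using cs_continuous_closed[OF gr that] .
      have "continuous_on ?U ?d"
        by (intro continuous_on_add continuous_on_mult continuous_on_const
            P.continuous_on_cs_dist_const[OF rc r[OF u]] E.continuous_on_cs_dist_const[OF gr cgr[OF u]])
      moreover have "?d u = 0" using P.dist_self[OF r[OF u]] E.dist_self[OF cgr[OF u]] by simp
      moreover have "cs_dist ?E (g (?r v) (snd v)) (g (?r u) (snd u)) \<le> ?d v" if v: "v \<in> ?U" for v
      proof -
        have x: "snd v \<in> cube j" using v by auto
        have "cs_dist ?E (g (?r v) (snd v)) (g (?r u) (snd u)) \<le>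
          cs_dist ?E (g (?r v) (snd v)) (g (?r u) (snd v)) + cs_dist ?E (g (?r u) (snd v)) (g (?r u) (snd u))"
          by (rule E.dist_triangle[OF star_hom_closed[OF gx[OF x] r[OF v]] cgr[OF v] cgr[OF u]])
        moreover have "cs_dist ?E (g (?r v) (snd v)) (g (?r u) (snd v)) \<le> findim_hom_bound ns * cs_dist P (?r v) (?r u)"
          by (rule star_hom_findim_dist[OF normed_P gx[OF x] r[OF v] r[OF u]])
        ultimately show ?thesis by linarith
      qed
      ultimately show "\<exists>d. continuous_on ?U d \<and> d u = 0 \<and>
          (\<forall>v\<in>?U. cs_dist ?E (g (?r v) (snd v)) (g (?r u) (snd u)) \<le> d v)"
        by (intro exI[of _ ?d] conjI ballI)
    qed
    then have "cs_continuous ?U ?E (\<lambda>(t, x). g (reparam (H t x) c) x)" by (simp add: split_def)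
    from E.cs_continuous_curry[OF compact_cube cube_nonempty this]
    show ?thesis by (simp add: \<Phi>_def[abs_def])
  qed
  have \<Phi>h: "star_hom P (C_alg (cube j) ?E) (\<lambda>c. \<Phi> c t)" if t: "t \<in> \<I>" for t
    unfolding star_hom_C_alg_iff[OF normed_P]
  proof (intro conjI ballI)
    show "\<Phi> c t \<in> carrier (C_alg (cube j) ?E)" if "c \<in> carrier P" for c
      using cs_continuous_closed[OF \<Phi>c[OF that] t] .
    show "star_hom P ?E (\<lambda>c. \<Phi> c t x)" if "x \<in> cube j" for x
      using star_hom_compose[OF rp[OF t that] gx[OF that]] that by (simp add: \<Phi>_def)
  qed
  have "\<exists>g'. star_hom A (C_alg (cube j) ?E) g' \<and> (\<forall>c\<in>carrier P. \<Phi> c 1 = g' (skel c))"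
  proof (rule factor_through_skel[OF D.normed_star_algebra_axioms \<Phi>h])
    fix c assume c: "c \<in> carrier P" "skel c = A.zero"
    have "g (reparam (H 1 x) c) x = E.zero" if x: "x \<in> cube j" for x
      using \<Psi>(4) x I0_if_skel_zero[OF c] c(2) by (simp add: reparam_def H_def)
    then show "\<Phi> c 1 = D.zero"
      unfolding E.C_alg_zero[OF compact_cube cube_nonempty] \<Phi>_def by (rule restrict_ext)
  qed simp
  then obtain g' where g': "star_hom A (C_alg (cube j) ?E) g'" "\<forall>c\<in>carrier P. \<Phi> c 1 = g' (skel c)"
    by blast
  have "homotopic_via P (C_alg (cube j) ?E)
      (\<lambda>c v. \<forall>x\<in>cube j. (\<forall>d\<in>carrier P. skel d = A.zero \<longrightarrow> g d x = E.zero) \<longrightarrow> v x = g c x)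
      g (\<lambda>c. g' (skel c))"
  proof (rule homotopic_viaI[OF normed_P \<Phi>c \<Phi>h])
    fix c assume c: "c \<in> carrier P"
    have "reparam (H 0 x) c = c" for x
    proof -
      have "(\<lambda>y\<in>cube k. cell c y) = cell c"
        using star_hom_closed[OF star_hom_cell c] by (simp add: C_alg_carrier extensional_restrict)
      then show ?thesis using pullback_collapse[OF c] by (simp add: reparam_def H_def)
    qed
    then show "\<Phi> c 0 = g c" using ge[OF c] by (simp add: \<Phi>_def extensional_restrict)
    show "\<Phi> c 1 = g' (skel c)" using g'(2) c by blast
    fix t :: real assume t: "t \<in> \<I>"
    show "\<forall>x\<in>cube j. (\<forall>d\<in>carrier P. skel d = A.zero \<longrightarrow> g d x = E.zero) \<longrightarrow> \<Phi> c t x = g c x"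
    proof (intro ballI impI)
      fix x assume x: "x \<in> cube j" and ker: "\<forall>d\<in>carrier P. skel d = A.zero \<longrightarrow> g d x = E.zero"
      have "g (reparam (H t x) c) x = g c x"
        by (rule eq_if_skel_eq[OF E.normed_star_algebra_axioms gx[OF x]])
          (use ker star_hom_closed[OF rp[OF t x] c] c in \<open>auto simp: reparam_def\<close>)
      then show "\<Phi> c t x = g c x" using x by (simp add: \<Phi>_def)
    qed
  qed
  then show ?thesis using g'(1) by blast
qed

end

section \<open>Skeleta\<close>

lemma nccw_complex_mono: "nccw_complex n A \<Longrightarrow> m \<le> n \<Longrightarrow> nccw_complex m A"
  unfolding nccw_complex_def by auto

lemma nccw_complex_0E:
  assumes "nccw_complex n A"
  obtains ns where "A 0 = vertex_alg (findim ns)"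
  using assms unfolding nccw_complex_def findim_cstar_def by blast

lemma nccw_complex_normed_and_step:
  assumes "nccw_complex n A"
  shows "p \<le> n \<Longrightarrow> normed_star_algebra (A p)"
    and "Suc p \<le> n \<Longrightarrow> \<exists>ns \<sigma>. nccw_step (findim ns) (A p) (Suc p) \<sigma> \<and>
      A (Suc p) = pullback_alg (Suc p) (findim ns) \<sigma> (A p)"
proof -
  have step: "\<exists>ns \<sigma>. star_hom (A p) (S_alg (Suc p) (findim ns)) \<sigma> \<and>
      A (Suc p) = pullback_alg (Suc p) (findim ns) \<sigma> (A p)" if "Suc p \<le> n" for p
  proof -
    have "Suc p \<in> {1..n}" using that by simp
    then have "\<exists>F \<sigma>. findim_cstar F \<and> star_hom (A (Suc p - 1)) (S_alg (Suc p) F) \<sigma> \<and>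
        A (Suc p) = pullback_alg (Suc p) F \<sigma> (A (Suc p - 1))"
      using assms unfolding nccw_complex_def by blast
    then show ?thesis unfolding findim_cstar_def by auto
  qed
  have normed: "normed_star_algebra (A p)" if "p \<le> n" for p
    using that
  proof (induction p)
    case 0
    then show ?case
      using nccw_complex_0E[OF assms] normed_star_algebra_vertex[OF normed_star_algebra_findim] by metis
  next
    case (Suc p)
    obtain ns \<sigma> where s: "star_hom (A p) (S_alg (Suc p) (findim ns)) \<sigma>"
      and e: "A (Suc p) = pullback_alg (Suc p) (findim ns) \<sigma> (A p)"
      using step[OF Suc.prems] by blast
    show ?case
      unfolding e using Suc s by (intro normed_star_algebra_pullback normed_star_algebra_findim) auto
  qed
  then show "p \<le> n \<Longrightarrow> normed_star_algebra (A p)" .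
  show "\<exists>ns \<sigma>. nccw_step (findim ns) (A p) (Suc p) \<sigma> \<and>
      A (Suc p) = pullback_alg (Suc p) (findim ns) \<sigma> (A p)" if p: "Suc p \<le> n"
  proof -
    obtain ns \<sigma> where s: "star_hom (A p) (S_alg (Suc p) (findim ns)) \<sigma>"
      "A (Suc p) = pullback_alg (Suc p) (findim ns) \<sigma> (A p)"
      using step[OF p] by blast
    have "nccw_step (findim ns) (A p) (Suc p) \<sigma>"
      using normed[of p] p s(1) normed_star_algebra_findim
      by (simp add: nccw_step_def nccw_step_axioms_def)
    then show ?thesis using s(2) by blast
  qed
qed

lemmas nccw_complex_normed = nccw_complex_normed_and_step(1)

lemma nccw_complex_SucE:
  assumes "nccw_complex n A" "Suc p \<le> n"
  obtains ns \<sigma> where "nccw_step (findim ns) (A p) (Suc p) \<sigma>"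
    "A (Suc p) = pullback_alg (Suc p) (findim ns) \<sigma> (A p)"
  using nccw_complex_normed_and_step(2)[OF assms] by blast

lemma skeleton_proj_id: "n \<le> p \<Longrightarrow> skeleton_proj n p a = a"
  by (simp add: skeleton_proj_def)

lemma skeleton_proj_Suc: "m \<le> n \<Longrightarrow> skeleton_proj (Suc n) m a = skeleton_proj n m (skel a)"
  by (simp add: skeleton_proj_def Suc_diff_le funpow_Suc_right del: funpow.simps)

lemma skeleton_proj_skeleton_proj:
  "m \<le> p \<Longrightarrow> p \<le> n \<Longrightarrow> skeleton_proj p m (skeleton_proj n p a) = skeleton_proj n m a"
  unfolding skeleton_proj_def by (simp add: funpow_add[symmetric, THEN fun_cong, simplified])

lemma skel_skeleton_proj: "Suc m \<le> n \<Longrightarrow> skel (skeleton_proj n (Suc m) a) = skeleton_proj n m a"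
  using skeleton_proj_skeleton_proj[of m "Suc m" n a] by (simp add: skeleton_proj_def)

lemma skeleton_proj_hom_surj:
  assumes "nccw_complex n A" "m \<le> n"
  shows "star_hom (A n) (A m) (skeleton_proj n m) \<and> (\<forall>a\<in>carrier (A m). \<exists>c\<in>carrier (A n). skeleton_proj n m c = a)"
  using assms(2,1)
proof (induction n rule: dec_induct)
  case base
  have "skeleton_proj m m = (\<lambda>x. x)" by (rule ext) (rule skeleton_proj_id, simp)
  then show ?case by (auto simp: star_hom_id)
next
  case (step n)
  obtain ns \<sigma> where s: "nccw_step (findim ns) (A n) (Suc n) \<sigma>"
    and e: "A (Suc n) = pullback_alg (Suc n) (findim ns) \<sigma> (A n)"
    using nccw_complex_SucE[OF step.prems, of n] by auto
  have IH: "star_hom (A n) (A m) (skeleton_proj n m)"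
    "\<forall>a\<in>carrier (A m). \<exists>c\<in>carrier (A n). skeleton_proj n m c = a"
    using step.IH nccw_complex_mono[OF step.prems, of n] by auto
  have p: "skeleton_proj (Suc n) m = (\<lambda>c. skeleton_proj n m (skel c))"
    using step.hyps by (auto simp: skeleton_proj_Suc)
  have "star_hom (A (Suc n)) (A m) (\<lambda>c. skeleton_proj n m (skel c))"
    unfolding e by (rule star_hom_compose[OF star_hom_skel IH(1)])
  moreover have "\<exists>c\<in>carrier (A (Suc n)). skeleton_proj n m (skel c) = a" if a: "a \<in> carrier (A m)" for a
  proof -
    obtain d where d: "d \<in> carrier (A n)" "skeleton_proj n m d = a" using IH(2) a by blast
    then show ?thesis using nccw_step.skel_surjective[OF s d(1)] unfolding e by blast
  qed
  ultimately show ?case unfolding p by blast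
qed

text \<open>
  The relation in the homotopy expresses that nothing moves over the points where \<open>g\<close> already
  factors through the \<open>m\<close>-skeleton.
\<close>

lemma homotopic_to_skeleton:
  assumes "nccw_complex n A" "m \<le> n" "star_hom (A n) (C_alg (cube m) (findim ns)) g"
  shows "\<exists>g'. star_hom (A m) (C_alg (cube m) (findim ns)) g' \<and>
    homotopic_via (A n) (C_alg (cube m) (findim ns))
      (\<lambda>c v. \<forall>x\<in>cube m. (\<forall>d\<in>carrier (A n). skeleton_proj n m d = cs_zero (A m) \<longrightarrow>
        g d x = cs_zero (findim ns)) \<longrightarrow> v x = g c x)
      g (\<lambda>c. g' (skeleton_proj n m c))"
  using assms(2,1,3)
proof (induction n arbitrary: g rule: dec_induct)
  case base
  have D: "normed_star_algebra (C_alg (cube m) (findim ns))"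
    by (rule normed_star_algebra.normed_star_algebra_C_alg[OF normed_star_algebra_findim compact_cube cube_nonempty])
  have A: "normed_star_algebra (A m)" using nccw_complex_normed[OF base.prems(1)] by simp
  show ?case
    using base.prems(2) homotopic_via_refl[OF A D base.prems(2)]
    by (intro exI[of _ g]) (simp add: skeleton_proj_id)
next
  case (step n)
  let ?D = "C_alg (cube m) (findim ns)"
  obtain ns' \<sigma> where s: "nccw_step (findim ns') (A n) (Suc n) \<sigma>"
    and e: "A (Suc n) = pullback_alg (Suc n) (findim ns') \<sigma> (A n)"
    using nccw_complex_SucE[OF step.prems(1), of n] by auto
  interpret nccw_step "findim ns'" "A n" "Suc n" \<sigma> by (rule s)
  interpret E: normed_star_algebra "findim ns" by (rule normed_star_algebra_findim)
  interpret D: normed_star_algebra ?D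
    by (rule E.normed_star_algebra_C_alg[OF compact_cube cube_nonempty])
  have n: "nccw_complex n A" using nccw_complex_mono[OF step.prems(1), of n] by simp
  define H where "H x \<longleftrightarrow> (\<forall>d\<in>carrier (A (Suc n)). skeleton_proj (Suc n) m d = cs_zero (A m) \<longrightarrow>
        g d x = E.zero)" for x
  have p: "skeleton_proj (Suc n) m c = skeleton_proj n m (skel c)" for c
    using step.hyps by (simp add: skeleton_proj_Suc)
  have p0: "skeleton_proj n m A.zero = cs_zero (A m)"
    using star_hom_zero[OF A.normed_star_algebra_axioms _ conjunct1[OF skeleton_proj_hom_surj[OF n step.hyps(1)]]]
      nccw_complex_normed[OF n step.hyps(1)] by blast
  obtain u where u: "u \<in> carrier (findim ns')" "\<forall>x\<in>carrier (findim ns'). cs_mult (findim ns') u x = x"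
    using findim_unit_exists by blast
  have "m < Suc n" using step.hyps by simp
  from push_off_cell[OF u(1) u(2)[rule_format] this step.prems(2)[unfolded e]]
  obtain g1 where g1: "star_hom (A n) ?D g1"
    and h1: "homotopic_via P ?D (\<lambda>c v. \<forall>x\<in>cube m. (\<forall>d\<in>carrier P. skel d = A.zero \<longrightarrow> g d x = E.zero) \<longrightarrow> v x = g c x)
      g (\<lambda>c. g1 (skel c))"
    by blast
  have H1: "\<forall>d\<in>carrier P. skel d = A.zero \<longrightarrow> g d x = E.zero" if "H x" for x
    using that p p0 unfolding H_def e by simp
  have h1': "homotopic_via P ?D (\<lambda>c v. \<forall>x\<in>cube m. H x \<longrightarrow> v x = g c x) g (\<lambda>c. g1 (skel c))"
    by (rule homotopic_via_mono[OF h1]) (use H1 in blast)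
  have g1_eq: "g1 (skel c) x = g c x" if c: "c \<in> carrier P" and x: "x \<in> cube m" "H x" for c x
  proof -
    have "(1::real) \<in> \<I>" by simp
    moreover obtain \<Phi> where "\<Phi> c 1 = g1 (skel c)" "\<forall>t\<in>\<I>. \<forall>x\<in>cube m. H x \<longrightarrow> \<Phi> c t x = g c x"
      using h1' c unfolding homotopic_via_def by blast
    ultimately show ?thesis using x by metis
  qed
  obtain g' where g': "star_hom (A m) ?D g'"
    and h2: "homotopic_via (A n) ?D (\<lambda>c v. \<forall>x\<in>cube m. (\<forall>d\<in>carrier (A n). skeleton_proj n m d = cs_zero (A m) \<longrightarrow>
        g1 d x = E.zero) \<longrightarrow> v x = g1 c x) g1 (\<lambda>c. g' (skeleton_proj n m c))"
    using step.IH[OF n g1] by blast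
  have H2: "g1 d x = E.zero"
    if x: "H x" "x \<in> cube m" and d: "d \<in> carrier (A n)" "skeleton_proj n m d = cs_zero (A m)" for d x
  proof -
    obtain c where c: "c \<in> carrier P" "skel c = d" using skel_surjective[OF d(1)] by blast
    then have "g c x = E.zero" using x(1) d(2) p[of c] unfolding H_def e by simp
    then show ?thesis using g1_eq[OF c(1) x(2,1)] c(2) by simp
  qed
  have "homotopic_via P ?D (\<lambda>c v. \<forall>x\<in>cube m. H x \<longrightarrow> v x = g c x) (\<lambda>c. g1 (skel c))
      (\<lambda>c. g' (skeleton_proj n m (skel c)))"
    by (rule homotopic_via_mono[OF homotopic_via_precompose[OF A.normed_star_algebra_axioms normed_P h2 star_hom_skel]])
      (use H2 g1_eq in simp)
  from homotopic_via_trans[OF normed_P D.normed_star_algebra_axioms h1' this]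
  show ?case using g' unfolding e[symmetric] p H_def by blast
qed

section \<open>Cellular approximation\<close>

lemma cellularI:
  assumes A: "nccw_complex n A" and h: "star_hom (A n) (B m) h"
    and low: "\<And>p. p < m \<Longrightarrow> \<exists>h'. star_hom (skeleton_alg n A p) (B p) h' \<and>
      (\<forall>a\<in>carrier (A n). skeleton_proj m p (h a) = h' (skeleton_proj n p a))"
    and top: "m \<le> n \<Longrightarrow> \<exists>h'. star_hom (A m) (B m) h' \<and> (\<forall>a\<in>carrier (A n). h a = h' (skeleton_proj n m a))"
  shows "cellular n A m B h"
  unfolding cellular_def
proof (intro conjI allI)
  show "star_hom (A n) (B m) h" by (rule h)
  fix p
  consider "p < m" | "m \<le> p" "n \<le> p" | "m \<le> p" "p < n" by linarith
  then show "\<exists>h\<^sub>p. star_hom (skeleton_alg n A p) (skeleton_alg m B p) h\<^sub>p \<and>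
      (\<forall>a\<in>carrier (A n). skeleton_proj m p (h a) = h\<^sub>p (skeleton_proj n p a))"
  proof cases
    case 1
    then show ?thesis using low[OF 1] by (simp add: skeleton_alg_def)
  next
    case 2
    then have "skeleton_alg n A p = A n" "skeleton_alg m B p = B m"
      by (auto simp: skeleton_alg_def)
    then show ?thesis using h 2 by (intro exI[of _ h]) (simp add: skeleton_proj_id)
  next
    case 3
    then have "m \<le> n" by simp
    then obtain h' where h': "star_hom (A m) (B m) h'" "\<forall>a\<in>carrier (A n). h a = h' (skeleton_proj n m a)"
      using top by blast
    have "star_hom (A p) (A m) (skeleton_proj p m)"
      using skeleton_proj_hom_surj[of p A m] nccw_complex_mono[OF A, of p] 3 by simp
    then have "star_hom (A p) (B m) (\<lambda>a. h' (skeleton_proj p m a))"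
      using h'(1) by (rule star_hom_compose)
    moreover have "skeleton_alg n A p = A p" "skeleton_alg m B p = B m"
      using 3 by (auto simp: skeleton_alg_def)
    moreover have "\<forall>a\<in>carrier (A n). skeleton_proj m p (h a) = h' (skeleton_proj p m (skeleton_proj n p a))"
      using h'(2) 3 by (simp add: skeleton_proj_id skeleton_proj_skeleton_proj)
    ultimately show ?thesis by auto
  qed
qed

lemma homotopic_to_cellular_0:
  assumes A: "nccw_complex n A" and B: "nccw_complex 0 B" and f: "star_hom (A n) (B 0) f"
  shows "\<exists>h. cellular n A 0 B h \<and> homotopic_via (A n) (B 0) (\<lambda>_ _. True) f h"
proof -
  obtain ns where B0: "B 0 = vertex_alg (findim ns)" using nccw_complex_0E[OF B] .
  interpret E: normed_star_algebra "findim ns" by (rule normed_star_algebra_findim)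
  interpret A: normed_star_algebra "A n" using nccw_complex_normed[OF A] by simp
  let ?D = "C_alg (cube 0) (findim ns)" and ?o = "\<lambda>_::nat. 0::real"
  interpret D: normed_star_algebra ?D
    by (rule E.normed_star_algebra_C_alg[OF compact_cube cube_nonempty])
  have o: "?o \<in> cube 0" by (simp add: cube_def)
  have fv: "vertex (f a) \<in> carrier (findim ns)" "Vertex (vertex (f a)) = f a" if "a \<in> carrier (A n)" for a
    using star_hom_closed[OF f that] by (auto simp: B0 vertex_alg_def)
  have fE: "star_hom (A n) (findim ns) (\<lambda>a. vertex (f a))"
    by (rule star_homI)
      (use fv(1) in \<open>auto simp: star_hom_add[OF f] star_hom_mult[OF f] star_hom_scale[OF f] star_hom_star[OF f]
        B0 vertex_alg_def\<close>)
  define g where "g a = (\<lambda>x\<in>cube 0. vertex (f a))" for a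
  have g: "star_hom (A n) ?D g"
    unfolding star_hom_C_alg_iff[OF A.normed_star_algebra_axioms] g_def
    using fE star_hom_closed[OF fE] by (simp add: C_alg_carrier E.cs_continuous_const)
  obtain g' where g': "star_hom (A 0) ?D g'"
    and hg: "homotopic_via (A n) ?D
      (\<lambda>c v. \<forall>x\<in>cube 0. (\<forall>d\<in>carrier (A n). skeleton_proj n 0 d = cs_zero (A 0) \<longrightarrow> g d x = E.zero) \<longrightarrow> v x = g c x)
      g (\<lambda>c. g' (skeleton_proj n 0 c))"
    using homotopic_to_skeleton[OF A le0 g] by blast
  obtain G where G: "\<And>a. a \<in> carrier (A n) \<Longrightarrow> cs_continuous \<I> ?D (G a)"
    "\<And>t. t \<in> \<I> \<Longrightarrow> star_hom (A n) ?D (\<lambda>a. G a t)"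
    "\<And>a. a \<in> carrier (A n) \<Longrightarrow> G a 0 = g a" "\<And>a. a \<in> carrier (A n) \<Longrightarrow> G a 1 = g' (skeleton_proj n 0 a)"
    by (rule homotopic_viaE[OF hg A.normed_star_algebra_axioms], rule that)
  define q where "q v = Vertex (v ?o)" for v :: "(nat \<Rightarrow> real) \<Rightarrow> fd"
  have q: "star_hom ?D (B 0) q"
    by (rule star_homI) (use o in \<open>auto simp: q_def B0 vertex_alg_def intro!: imageI C_alg_closed[OF _ o]\<close>)
  have lip: "cs_dist (B 0) (q b) (q b') \<le> 1 * cs_dist ?D b b'" if "b \<in> carrier ?D" "b' \<in> carrier ?D" for b b'
    using E.dist_le_C_alg_dist[OF compact_cube cube_nonempty that o]
    by (simp add: q_def B0 vertex_alg_def cs_dist_def)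
  have B0n: "normed_star_algebra (B 0)" using nccw_complex_normed[OF B] by simp
  have "homotopic_via (A n) (B 0) (\<lambda>_ _. True) f (\<lambda>a. q (g' (skeleton_proj n 0 a)))"
  proof (rule homotopic_viaI[OF A.normed_star_algebra_axioms, of _ "\<lambda>a t. q (G a t)"])
    fix a assume a: "a \<in> carrier (A n)"
    show "cs_continuous \<I> (B 0) (\<lambda>t. q (G a t))"
      by (rule cs_continuous_lipschitz[OF D.normed_star_algebra_axioms B0n star_hom_closed[OF q] lip G(1)[OF a]])
    show "q (G a 0) = f a" using G(3)[OF a] fv[OF a] o by (auto simp: q_def g_def)
    show "q (G a 1) = q (g' (skeleton_proj n 0 a))" using G(4)[OF a] by simp
  next
    fix t :: real assume "t \<in> \<I>"
    then show "star_hom (A n) (B 0) (\<lambda>a. q (G a t))" by (intro star_hom_compose[OF G(2) q])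
  qed simp
  moreover have hq: "star_hom (A 0) (B 0) (\<lambda>a. q (g' a))" by (rule star_hom_compose[OF g' q])
  have "cellular n A 0 B (\<lambda>a. q (g' (skeleton_proj n 0 a)))"
  proof (rule cellularI[OF A])
    show "star_hom (A n) (B 0) (\<lambda>a. q (g' (skeleton_proj n 0 a)))"
      by (rule star_hom_compose[OF conjunct1[OF skeleton_proj_hom_surj[OF A le0]] hq])
  qed (use hq in auto)
  ultimately show ?thesis by blast
qed

lemma homotopic_to_cellular_Suc:
  assumes A: "nccw_complex n A" and B: "nccw_complex (Suc m) B" and f: "star_hom (A n) (B (Suc m)) f"
    and IH: "\<And>f. star_hom (A n) (B m) f \<Longrightarrow>
      \<exists>h. cellular n A m B h \<and> homotopic_via (A n) (B m) (\<lambda>_ _. True) f h"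
  shows "\<exists>h. cellular n A (Suc m) B h \<and> homotopic_via (A n) (B (Suc m)) (\<lambda>_ _. True) f h"
proof -
  let ?k = "Suc m"
  obtain ns \<sigma> where s: "nccw_step (findim ns) (B m) ?k \<sigma>"
    and e: "B ?k = pullback_alg ?k (findim ns) \<sigma> (B m)"
    using nccw_complex_SucE[OF B, of m] by auto
  interpret Bm: nccw_step "findim ns" "B m" ?k \<sigma> by (rule s)
  interpret A: normed_star_algebra "A n" using nccw_complex_normed[OF A] by simp
  let ?F = "findim ns" and ?D = "C_alg (cube ?k) (findim ns)" and ?S = "C_alg (cube_boundary ?k) (findim ns)"
  note f' = f[unfolded e]
  have f1: "star_hom (A n) ?D (\<lambda>a. cell (f a))" by (rule star_hom_compose[OF f' star_hom_cell])
  have f2: "star_hom (A n) (B m) (\<lambda>a. skel (f a))" by (rule star_hom_compose[OF f' star_hom_skel])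
  obtain h0 where h0: "cellular n A m B h0" and hom0: "homotopic_via (A n) (B m) (\<lambda>_ _. True) (\<lambda>a. skel (f a)) h0"
    using IH[OF f2] by blast
  have h0s: "star_hom (A n) (B m) h0" using h0 by (simp add: cellular_def)
  obtain \<Phi> where P: "\<And>a. a \<in> carrier (A n) \<Longrightarrow> cs_continuous \<I> (B m) (\<Phi> a)"
    "\<And>t. t \<in> \<I> \<Longrightarrow> star_hom (A n) (B m) (\<lambda>a. \<Phi> a t)"
    "\<And>a. a \<in> carrier (A n) \<Longrightarrow> \<Phi> a 0 = skel (f a)" "\<And>a. a \<in> carrier (A n) \<Longrightarrow> \<Phi> a 1 = h0 a"
    by (rule homotopic_viaE[OF hom0 A.normed_star_algebra_axioms], rule that)
  have \<sigma>x: "star_hom (B m) ?F (\<lambda>b. \<sigma> b x)" if "x \<in> cube_boundary ?k" for x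
    using Bm.connecting' that unfolding star_hom_C_alg_iff[OF Bm.A.normed_star_algebra_axioms] by blast
  have \<sigma>lip: "cs_dist ?S (\<sigma> b) (\<sigma> b') \<le> findim_hom_bound ns * cs_dist (B m) b b'"
    if "b \<in> carrier (B m)" "b' \<in> carrier (B m)" for b b'
    by (rule Bm.F.C_alg_dist_le[OF cube_boundary_nonempty[OF Bm.k]])
      (rule star_hom_findim_dist[OF Bm.A.normed_star_algebra_axioms \<sigma>x that])
  have \<sigma>e: "\<sigma> b \<in> extensional (cube_boundary ?k)" if "b \<in> carrier (B m)" for b
    using star_hom_closed[OF Bm.connecting' that] by (simp add: C_alg_carrier)
  have \<Phi>c: "\<Phi> a t \<in> carrier (B m)" if "a \<in> carrier (A n)" "t \<in> \<I>" for a t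
    using cs_continuous_closed[OF P(1)[OF that(1)] that(2)] .
  have restr: "restrict (cell (f a)) (cube_boundary ?k) = \<sigma> (skel (f a))" if "a \<in> carrier (A n)" for a
    by (rule pullback_restrict_cell[OF star_hom_closed[OF f' that]])
  have eq0: "\<sigma> (\<Phi> a 0) x = cell (f a) x" if "a \<in> carrier (A n)" "x \<in> cube_boundary ?k" for a x
    using restr[OF that(1)] P(3)[OF that(1)] that(2) by (metis restrict_apply)
  define G where "G a = hep_extend ?k (cell (f a)) (\<lambda>t. \<sigma> (\<Phi> a t))" for a
  have Gc: "cs_continuous \<I> ?D (G a)" if a: "a \<in> carrier (A n)" for a
    unfolding G_def
  proof (rule hep_extend_continuous[OF Bm.F.normed_star_algebra_axioms Bm.k])
    show "cs_continuous (cube ?k) ?F (cell (f a))"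
      using star_hom_closed[OF f1 a] by (simp add: C_alg_carrier)
    show "cs_continuous \<I> ?S (\<lambda>t. \<sigma> (\<Phi> a t))"
      by (rule cs_continuous_lipschitz[OF Bm.A.normed_star_algebra_axioms Bm.S.normed_star_algebra_axioms
          star_hom_closed[OF Bm.connecting'] \<sigma>lip P(1)[OF a]])
  qed (rule eq0[OF a])
  have Gh: "star_hom (A n) ?D (\<lambda>a. G a t)" if t: "t \<in> \<I>" for t
    unfolding star_hom_C_alg_iff[OF A.normed_star_algebra_axioms]
  proof (intro conjI ballI)
    show "G a t \<in> carrier ?D" if "a \<in> carrier (A n)" for a
      using cs_continuous_closed[OF Gc[OF that] t] .
    fix x assume x: "x \<in> cube ?k"
    note r = hep_retraction[OF t x]
    show "star_hom (A n) ?F (\<lambda>a. G a t x)"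
    proof (cases "hep_time ?k t x = 0")
      case True
      have "star_hom (A n) ?F (\<lambda>a. cell (f a) (hep_point ?k t x))"
        using f1 r(1) unfolding star_hom_C_alg_iff[OF A.normed_star_algebra_axioms] by blast
      then show ?thesis using True x by (simp add: G_def hep_extend_def)
    next
      case False
      have "star_hom (A n) ?F (\<lambda>a. \<sigma> (\<Phi> a (hep_time ?k t x)) (hep_point ?k t x))"
        by (rule star_hom_compose[OF P(2)[OF r(2)] \<sigma>x[OF r(3)[OF False]]])
      then show ?thesis using False x by (simp add: G_def hep_extend_def)
    qed
  qed
  have Gr: "restrict (G a t) (cube_boundary ?k) = \<sigma> (\<Phi> a t)" if a: "a \<in> carrier (A n)" and t: "t \<in> \<I>" for a t
  proof (rule C_alg_eqI[where X = "cube_boundary ?k"])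
    fix x assume x: "x \<in> cube_boundary ?k"
    have "G a t x = \<sigma> (\<Phi> a t) x"
      unfolding G_def
      by (rule hep_extend_boundary[where w = "\<lambda>t. \<sigma> (\<Phi> a t)", OF t x]) (rule eq0[OF a x])
    then show "restrict (G a t) (cube_boundary ?k) x = \<sigma> (\<Phi> a t) x" using x by simp
  qed (use \<sigma>e[OF \<Phi>c[OF a t]] in simp_all)
  define h1 where "h1 a = Cell (G a 1) (h0 a)" for a
  have hom1: "homotopic_via (A n) (B ?k) (\<lambda>_ _. True) f h1"
    unfolding e
  proof (rule homotopic_viaI[OF A.normed_star_algebra_axioms, of _ "\<lambda>a t. Cell (G a t) (\<Phi> a t)"])
    fix a assume a: "a \<in> carrier (A n)"
    show "cs_continuous \<I> Bm.P (\<lambda>t. Cell (G a t) (\<Phi> a t))"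
      by (rule Bm.cs_continuous_Cell[OF Gc[OF a] P(1)[OF a] Gr[OF a]])
    have "G a 0 = cell (f a)"
      unfolding G_def by (rule hep_extend_0) (use star_hom_closed[OF f1 a] in \<open>simp add: C_alg_carrier\<close>)
    then show "Cell (G a 0) (\<Phi> a 0) = f a"
      using P(3)[OF a] pullback_collapse[OF star_hom_closed[OF f' a]] by simp
    show "Cell (G a 1) (\<Phi> a 1) = h1 a" using P(4)[OF a] by (simp add: h1_def)
  next
    fix t :: real assume t: "t \<in> \<I>"
    show "star_hom (A n) Bm.P (\<lambda>a. Cell (G a t) (\<Phi> a t))"
      by (rule star_hom_Cell[OF Gh[OF t] P(2)[OF t] Gr]) (use t in auto)
  qed simp
  have low: "\<exists>h'. star_hom (skeleton_alg n A p) (B p) h' \<and>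
      (\<forall>a\<in>carrier (A n). skeleton_proj ?k p (h a) = h' (skeleton_proj n p a))"
    if "p < ?k" "\<And>a. a \<in> carrier (A n) \<Longrightarrow> skel (h a) = h0 a" for p h
  proof -
    obtain h' where "star_hom (skeleton_alg n A p) (skeleton_alg m B p) h'"
      "\<forall>a\<in>carrier (A n). skeleton_proj m p (h0 a) = h' (skeleton_proj n p a)"
      using h0 unfolding cellular_def by blast
    then show ?thesis using that by (intro exI[of _ h']) (simp add: skeleton_proj_Suc skeleton_alg_def)
  qed
  have G1: "star_hom (A n) ?D (\<lambda>a. G a 1)" by (rule Gh) simp
  have G1r: "restrict (G a 1) (cube_boundary ?k) = \<sigma> (h0 a)" if "a \<in> carrier (A n)" for a
    using Gr[OF that, of 1] P(4)[OF that] by simp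
  have h1: "star_hom (A n) (B ?k) h1"
    unfolding e h1_def by (rule star_hom_Cell[OF G1 h0s G1r])
  show ?thesis
  proof (cases "?k \<le> n")
    case False
    have "cellular n A ?k B h1"
      by (rule cellularI[OF A h1 low]) (use False in \<open>simp_all add: h1_def\<close>)
    then show ?thesis using hom1 by blast
  next
    case True
    then have mn: "m \<le> n" by simp
    have "\<exists>hm. star_hom (skeleton_alg n A m) (skeleton_alg m B m) hm \<and>
        (\<forall>a\<in>carrier (A n). skeleton_proj m m (h0 a) = hm (skeleton_proj n m a))"
      using h0 unfolding cellular_def by blast
    then obtain hm where hm: "star_hom (A m) (B m) hm" "\<forall>a\<in>carrier (A n). h0 a = hm (skeleton_proj n m a)"
      using mn by (auto simp: skeleton_alg_def skeleton_proj_id)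
    have pm: "star_hom (A n) (A ?k) (skeleton_proj n ?k)"
      "\<forall>c\<in>carrier (A ?k). \<exists>a\<in>carrier (A n). skeleton_proj n ?k a = c"
      using skeleton_proj_hom_surj[OF A True] by blast+
    have Ak: "normed_star_algebra (A ?k)" "normed_star_algebra (A m)"
      using nccw_complex_normed[OF A] True by simp_all
    have skA: "star_hom (A ?k) (A m) skel"
    proof -
      obtain ns' \<sigma>' where "A ?k = pullback_alg ?k (findim ns') \<sigma>' (A m)"
        using nccw_complex_SucE[OF A True] .
      then show ?thesis by (simp only: star_hom_skel)
    qed
    obtain g' where g': "star_hom (A ?k) ?D g'"
      and hg: "homotopic_via (A n) ?D
        (\<lambda>c v. \<forall>x\<in>cube ?k. (\<forall>d\<in>carrier (A n). skeleton_proj n ?k d = cs_zero (A ?k) \<longrightarrow>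
          G d 1 x = cs_zero ?F) \<longrightarrow> v x = G c 1 x)
        (\<lambda>a. G a 1) (\<lambda>c. g' (skeleton_proj n ?k c))"
      using homotopic_to_skeleton[OF A True G1] by blast
    obtain \<Gamma> where \<Gamma>: "\<And>a. a \<in> carrier (A n) \<Longrightarrow> cs_continuous \<I> ?D (\<Gamma> a)"
      "\<And>t. t \<in> \<I> \<Longrightarrow> star_hom (A n) ?D (\<lambda>a. \<Gamma> a t)"
      "\<And>a. a \<in> carrier (A n) \<Longrightarrow> \<Gamma> a 0 = G a 1"
      "\<And>a. a \<in> carrier (A n) \<Longrightarrow> \<Gamma> a 1 = g' (skeleton_proj n ?k a)"
      "\<And>a t. a \<in> carrier (A n) \<Longrightarrow> t \<in> \<I> \<Longrightarrow>
        \<forall>x\<in>cube ?k. (\<forall>d\<in>carrier (A n). skeleton_proj n ?k d = cs_zero (A ?k) \<longrightarrow>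
          G d 1 x = cs_zero ?F) \<longrightarrow> \<Gamma> a t x = G a 1 x"
      by (rule homotopic_viaE[OF hg A.normed_star_algebra_axioms], rule that)
    have ker: "G d 1 x = cs_zero ?F"
      if d: "d \<in> carrier (A n)" "skeleton_proj n ?k d = cs_zero (A ?k)" and x: "x \<in> cube_boundary ?k" for d x
    proof -
      have "skeleton_proj n m d = skel (cs_zero (A ?k))"
        using skel_skeleton_proj[OF True, of d] d(2) by simp
      also have "\<dots> = cs_zero (A m)" by (rule star_hom_zero[OF Ak skA])
      finally have "h0 d = hm (cs_zero (A m))" using hm(2) d(1) by simp
      also have "\<dots> = Bm.A.zero"
        by (rule star_hom_zero[OF Ak(2) Bm.A.normed_star_algebra_axioms hm(1)])
      finally have "restrict (G d 1) (cube_boundary ?k) = \<sigma> Bm.A.zero" using G1r[OF d(1)] by simp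
      then have "restrict (G d 1) (cube_boundary ?k) x = (\<lambda>x\<in>cube_boundary ?k. Bm.F.zero) x"
        by (simp only: Bm.connecting_zero)
      then show ?thesis using x by simp
    qed
    have \<Gamma>r: "restrict (\<Gamma> a t) (cube_boundary ?k) = \<sigma> (h0 a)" if a: "a \<in> carrier (A n)" and t: "t \<in> \<I>" for a t
    proof -
      have "\<Gamma> a t x = G a 1 x" if x: "x \<in> cube_boundary ?k" for x
        using \<Gamma>(5)[OF a t] ker x cube_boundary_subset by blast
      then have "restrict (\<Gamma> a t) (cube_boundary ?k) = restrict (G a 1) (cube_boundary ?k)"
        by (rule restrict_ext)
      then show ?thesis using G1r[OF a] by simp
    qed
    define h where "h a = Cell (g' (skeleton_proj n ?k a)) (h0 a)" for a
    have hom2: "homotopic_via (A n) (B ?k) (\<lambda>_ _. True) h1 h"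
      unfolding e
    proof (rule homotopic_viaI[OF A.normed_star_algebra_axioms, of _ "\<lambda>a t. Cell (\<Gamma> a t) (h0 a)"])
      fix a assume a: "a \<in> carrier (A n)"
      show "cs_continuous \<I> Bm.P (\<lambda>t. Cell (\<Gamma> a t) (h0 a))"
        by (rule Bm.cs_continuous_Cell[OF \<Gamma>(1)[OF a] Bm.A.cs_continuous_const[OF star_hom_closed[OF h0s a]] \<Gamma>r[OF a]])
      show "Cell (\<Gamma> a 0) (h0 a) = h1 a" "Cell (\<Gamma> a 1) (h0 a) = h a"
        using \<Gamma>(3,4)[OF a] by (simp_all add: h1_def h_def)
    next
      fix t :: real assume t: "t \<in> \<I>"
      show "star_hom (A n) Bm.P (\<lambda>a. Cell (\<Gamma> a t) (h0 a))"
        by (rule star_hom_Cell[OF \<Gamma>(2)[OF t] h0s \<Gamma>r]) (use t in auto)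
    qed simp
    have "star_hom (A ?k) Bm.P (\<lambda>c. Cell (g' c) (hm (skel c)))"
    proof (rule star_hom_Cell[OF g' star_hom_compose[OF skA hm(1)]])
      fix c assume "c \<in> carrier (A ?k)"
      then obtain a where a: "a \<in> carrier (A n)" "skeleton_proj n ?k a = c" using pm(2) by blast
      have "g' c = \<Gamma> a 1" using \<Gamma>(4)[OF a(1)] a(2) by simp
      moreover have "hm (skel c) = h0 a" using hm(2) a skel_skeleton_proj[OF True, of a] by simp
      ultimately show "restrict (g' c) (cube_boundary ?k) = \<sigma> (hm (skel c))"
        using \<Gamma>r[OF a(1), of 1] by simp
    qed
    then have hk: "star_hom (A ?k) (B ?k) (\<lambda>c. Cell (g' c) (hm (skel c)))" unfolding e .
    have hh: "h a = Cell (g' (skeleton_proj n ?k a)) (hm (skel (skeleton_proj n ?k a)))" if "a \<in> carrier (A n)" for a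
      using hm(2) that skel_skeleton_proj[OF True, of a] by (simp add: h_def)
    have "star_hom (A n) (B ?k) h"
      by (rule star_hom_cong[OF star_hom_compose[OF pm(1) hk] _ A.normed_star_algebra_axioms]) (simp add: hh)
    then have "cellular n A ?k B h"
    proof (rule cellularI[OF A _ low])
      show "\<exists>h'. star_hom (A ?k) (B ?k) h' \<and> (\<forall>a\<in>carrier (A n). h a = h' (skeleton_proj n ?k a))"
        using hk hh by blast
    qed (simp_all add: h_def)
    moreover have "homotopic_via (A n) (B ?k) (\<lambda>_ _. True) f h"
      using homotopic_via_trans[OF A.normed_star_algebra_axioms _ hom1 hom2] nccw_complex_normed[OF B] by blast
    ultimately show ?thesis by blast
  qed
qed

lemma homotopic_to_cellular:
  assumes "nccw_complex n A" "nccw_complex m B" "star_hom (A n) (B m) f"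
  shows "\<exists>h. cellular n A m B h \<and> homotopic_via (A n) (B m) (\<lambda>_ _. True) f h"
  using assms(2,3)
proof (induction m arbitrary: f)
  case 0
  then show ?case by (rule homotopic_to_cellular_0[OF assms(1)])
next
  case (Suc m)
  show ?case
  proof (rule homotopic_to_cellular_Suc[OF assms(1) Suc.prems])
    show "\<exists>h. cellular n A m B h \<and> homotopic_via (A n) (B m) (\<lambda>_ _. True) f h"
      if "star_hom (A n) (B m) f" for f
      using Suc.IH[OF _ that] nccw_complex_mono[OF Suc.prems(1)] by simp
  qed
qed

theorem theorem4p5:
  fixes n m :: nat
    and A B :: "nat \<Rightarrow> nccw_elt cstar"
    and f :: "nccw_elt \<Rightarrow> nccw_elt"
  assumes "nccw_complex n A"
    and "nccw_complex m B"
    and "star_hom (A n) (B m) f"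
  shows "\<exists>h \<Phi>. cellular n A m B h \<and>
           star_hom (A n) (C_alg {0..1::real} (B m)) \<Phi> \<and>
           (\<forall>a\<in>carrier (A n). \<Phi> a 0 = f a \<and> \<Phi> a 1 = h a)"
  using homotopic_to_cellular[OF assms] unfolding homotopic_via_def by blast

end
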